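(* Let $n\ge1$ and $r\ge2$ be integers, and let $\alpha,\beta>0$, $q\ge0$. The multivariate partition function of the stationary distribution of the ASEP on $n$ sites with parameters $\alpha,\beta,q$ and $\gamma=\delta=0$ is a constant multiple of $$\sum_{\sigma\in\mathbb Z_r\wr\mathfrak S_n}\left(\frac r\alpha\right)^{\mathrm{zc}(\sigma)}\left(\frac{r}{(r-1)\beta}\right)^{\mathrm{nc}(\sigma)}q^{\mathrm{yy}(\sigma)}\prod_{i\in\mathcal X(\sigma)}x_i.$$ In particular, when $\alpha=r$ and $\beta=r/(r-1)$, the partition function is a constant multiple of $\sum_{\sigma\in\mathbb Z_r\wr\mathfrak S_n}q^{\mathrm{yy}(\sigma)}\prod_{i\in\mathcal X(\sigma)}x_i$.
   Context: The ASEP on $n$ sites with parameters $q,\alpha,\beta,\gamma,\delta\ge0$ is the continuous-time Markov chain on $\{0,1\}^n$ in which a particle at site $i$ jumps to $i+1$ at rate $1$ and to $i-1$ at rate $q$ if the target site (in $[n]$) is vacant; at site $1$ particles are created at rate $\alpha$ (if vacant) and annihilated at rate $\gamma$ (if occupied); at site $n$ particles are created at rate $\delta$ and annihilated at rate $\beta$. The partition function of a probability measure $\mu$ on $\{0,1\}^n$ is $\sum_\eta\mu(\eta)x_1^{\eta(1)}\cdots x_n^{\eta(n)}$. Marked cycles and $T(\sigma,s)$: for a finite nonempty totally ordered set $S$, a marked cycle is $(\sigma,s)$ with $\sigma$ a cyclic permutation of $S$ and $s\in\{\min S,\max S\}$. Write $W=a_1\cdots a_m$, $m=|S|-1$, $a_j=\sigma^j(s)$.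 If $s=\min S$ let $x_k>\cdots>x_1$ be the right-to-left maxima of $W$; if $s=\max S$ let $x_k<\cdots<x_1$ be the right-to-left minima of $W$. Then $W=W_kx_k\cdots W_1x_1$ for unique (possibly empty) words $W_i$. $T(\sigma,s)$: a single vertex if $S=\{s\}$; otherwise root $s$ with children $x_1,\ldots,x_k$, the subtree at $x_i$ being $T(\sigma_i,x_i)$ with $\sigma_i$ the cyclic permutation of the letters of $W_ix_i$ sending each letter to the next and $x_i$ to the first. Colored permutations: $\mathbb Z_r\wr\mathfrak S_n=\{(\kappa,\sigma):\kappa:[n]\to\mathbb Z_r,\sigma\in\mathfrak S_n\}$. For $\pi=(\kappa,\sigma)$: $i\in\mathcal X(\pi)$ iff $\sigma(i)>i$, or $\sigma(i)=i$ and $\kappa_i\ne0$. A cycle of $\sigma$ is a zero cycle if $\kappa_i=0$ for its maximal element $i$, otherwise a non-zero cycle; $\mathrm{zc}(\pi)$, $\mathrm{nc}(\pi)$ are the numbers of zero and non-zero cycles. $T''(\pi)$ is the rooted tree on $\{0,\ldots,n+1\}$ with root $0$ whose children are $n+1$ and the maxima $s_i$ of the zero cycles $\sigma_i$ (subtree $T(\sigma_i,s_i)$), and where the children of $n+1$ are the minima $t_i$ of the non-zero cycles $\tau_i$ (subtree $T(\tau_i,t_i)$). With $p(i)$ the parent of $i$ in $T''(\pi)$, $\mathrm{yy}(\pi)$ is the number of pairs $1\le i<j\le n$ with $p(j)<i<j<p(i)$. *)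

theory Defs
  imports "HOL-Probability.Probability" "HOL-Combinatorics.Combinatorics"
begin

section \<open>The ASEP on \<open>n\<close> sites\<close>

definition configs :: "nat \<Rightarrow> (nat \<Rightarrow> nat) set" where
  "configs n = {1..n} \<rightarrow>\<^sub>E {0, 1}"

text \<open>
  The jump rate from \<open>\<eta>\<close> to \<open>\<eta>'\<close>. The contributions are added because distinct mechanisms may
  cause the same transition: for \<open>n = 1\<close> both boundary reservoirs act on the same site.
\<close>

definition asep_rate ::
  "nat \<Rightarrow> real \<Rightarrow> real \<Rightarrow> real \<Rightarrow> real \<Rightarrow> real \<Rightarrow> (nat \<Rightarrow> nat) \<Rightarrow> (nat \<Rightarrow> nat) \<Rightarrow> real"
  where
  "asep_rate n q \<alpha> \<beta> \<gamma> \<delta> \<eta> \<eta>' =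
     (\<Sum>i\<in>{1..<n}. if \<eta> i = 1 \<and> \<eta> (i + 1) = 0 \<and> \<eta>' = \<eta>(i := 0, i + 1 := 1) then 1 else 0)
   + (\<Sum>i\<in>{2..n}. if \<eta> i = 1 \<and> \<eta> (i - 1) = 0 \<and> \<eta>' = \<eta>(i := 0, i - 1 := 1) then q else 0)
   + (if \<eta> 1 = 0 \<and> \<eta>' = \<eta>(1 := 1) then \<alpha> else 0)
   + (if \<eta> 1 = 1 \<and> \<eta>' = \<eta>(1 := 0) then \<gamma> else 0)
   + (if \<eta> n = 0 \<and> \<eta>' = \<eta>(n := 1) then \<delta> else 0)
   + (if \<eta> n = 1 \<and> \<eta>' = \<eta>(n := 0) then \<beta> else 0)"

definition asep_generator ::
  "nat \<Rightarrow> real \<Rightarrow> real \<Rightarrow> real \<Rightarrow> real \<Rightarrow> real \<Rightarrow> (nat \<Rightarrow> nat) \<Rightarrow> (nat \<Rightarrow> nat) \<Rightarrow> real"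
  where
  "asep_generator n q \<alpha> \<beta> \<gamma> \<delta> \<eta> \<eta>' =
     (if \<eta> = \<eta>' then - (\<Sum>\<zeta>\<in>configs n - {\<eta>}. asep_rate n q \<alpha> \<beta> \<gamma> \<delta> \<eta> \<zeta>)
      else asep_rate n q \<alpha> \<beta> \<gamma> \<delta> \<eta> \<eta>')"

text \<open>Stationarity of \<open>\<mu>\<close> for the continuous-time chain with generator \<open>Q\<close> means \<open>\<mu> Q = 0\<close>.\<close>

definition asep_stationary ::
  "nat \<Rightarrow> real \<Rightarrow> real \<Rightarrow> real \<Rightarrow> real \<Rightarrow> real \<Rightarrow> (nat \<Rightarrow> nat) pmf \<Rightarrow> bool" where
  "asep_stationary n q \<alpha> \<beta> \<gamma> \<delta> \<mu> \<longleftrightarrow>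
     set_pmf \<mu> \<subseteq> configs n \<and>
     (\<forall>\<eta>'\<in>configs n. (\<Sum>\<eta>\<in>configs n. pmf \<mu> \<eta> * asep_generator n q \<alpha> \<beta> \<gamma> \<delta> \<eta> \<eta>') = 0)"

text \<open>Multivariate polynomials are given as polynomial functions of \<open>x\<close>.\<close>

definition partition_function :: "nat \<Rightarrow> (nat \<Rightarrow> nat) pmf \<Rightarrow> (nat \<Rightarrow> real) \<Rightarrow> real" where
  "partition_function n \<mu> x = (\<Sum>\<eta>\<in>configs n. pmf \<mu> \<eta> * (\<Prod>i\<in>{1..n}. x i ^ \<eta> i))"


section \<open>The tree of a marked cycle\<close>

text \<open>Rooted labelled trees. The order in the list of children carries no meaning.\<close>

datatype rtree = Node (root: nat) (children: "rtree list")

text \<open>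
  \<open>record_split P W\<close> is the factorization \<open>[W\<^sub>k x\<^sub>k, \<dots>, W\<^sub>1 x\<^sub>1]\<close> of \<open>W\<close> after each
  right-to-left record, that is, each letter \<open>a\<close> with \<open>P a y\<close> for all letters \<open>y\<close> to its right.
  The records are the right-to-left maxima if \<open>P\<close> is \<open>>\<close>, and the right-to-left minima if
  \<open>P\<close> is \<open><\<close>. The last letter is always a record, so the branch \<open>[[a]]\<close> is never reached.
\<close>

fun record_split :: "(nat \<Rightarrow> nat \<Rightarrow> bool) \<Rightarrow> nat list \<Rightarrow> nat list list" where
  "record_split P [] = []"
| "record_split P (a # W) =
     (if \<forall>y\<in>set W. P a y then [a] # record_split P W
      else (case record_split P W of [] \<Rightarrow> [[a]] | u # us \<Rightarrow> (a # u) # us))"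

lemma concat_record_split: "concat (record_split P W) = W"
proof (induction W)
  case (Cons a W)
  then show ?case by (cases "record_split P W") auto
qed simp

lemma length_record_split: "u \<in> set (record_split P W) \<Longrightarrow> length u \<le> length W"
  by (metis concat_record_split length_append le_add1 le_add2 order_trans
      concat.simps(2) concat_append split_list)

definition cycle_word :: "nat set \<Rightarrow> (nat \<Rightarrow> nat) \<Rightarrow> nat \<Rightarrow> nat list" where
  "cycle_word S \<sigma> s = map (\<lambda>j. (\<sigma> ^^ j) s) [1..<card S]"

text \<open>
  \<open>cycle_tree S \<sigma> s\<close> is \<open>T(\<sigma>, s)\<close> for a marked cycle: \<open>\<sigma>\<close> is a cyclic permutation of the
  finite nonempty set \<open>S\<close>, and \<open>s\<close> is \<open>Min S\<close> or \<open>Max S\<close>.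
\<close>

function cycle_tree :: "nat set \<Rightarrow> (nat \<Rightarrow> nat) \<Rightarrow> nat \<Rightarrow> rtree" where
  "cycle_tree S \<sigma> s =
     (if S = {s} then Node s []
      else Node s
        (map (\<lambda>u. cycle_tree (set u) (cycle_of_list u) (last u))
          (record_split (if s = Min S then (>) else (<)) (cycle_word S \<sigma> s))))"
  by auto
termination
proof (relation "Wellfounded.measure (\<lambda>(S, \<sigma>, s). card S)", goal_cases)
  case 1
  show ?case by simp
next
  case (2 S \<sigma> s u)
  have len: "length u \<le> card S - 1"
    using length_record_split[OF 2(2)] by (simp add: cycle_word_def)
  have "cycle_word S \<sigma> s \<noteq> []"
    using 2(2) by auto
  then have "card S > 0"
    by (auto simp: cycle_word_def)
  then show ?case
    using len card_length[of u] by simp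
qed

declare cycle_tree.simps [simp del]

text \<open>The pairs (child, parent) of a tree.\<close>

fun parent_pairs :: "rtree \<Rightarrow> (nat \<times> nat) set" where
  "parent_pairs (Node a ts) = (\<Union>t\<in>set ts. insert (root t, a) (parent_pairs t))"

definition parent :: "rtree \<Rightarrow> nat \<Rightarrow> nat" where
  "parent t i = (THE p. (i, p) \<in> parent_pairs t)"


section \<open>Colored permutations\<close>

text \<open>
  Colors are the representatives \<open>0, \<dots>, r - 1\<close> of the residues modulo \<open>r\<close>. Only the
  underlying set of the wreath product matters here.
\<close>

definition colored_perms :: "nat \<Rightarrow> nat \<Rightarrow> ((nat \<Rightarrow> nat) \<times> (nat \<Rightarrow> nat)) set" where
  "colored_perms r n = ({1..n} \<rightarrow>\<^sub>E {0..<r}) \<times> {\<sigma>. \<sigma> permutes {1..n}}"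

definition excedance_set :: "nat \<Rightarrow> (nat \<Rightarrow> nat) \<times> (nat \<Rightarrow> nat) \<Rightarrow> nat set" where
  "excedance_set n = (\<lambda>(\<kappa>, \<sigma>). {i\<in>{1..n}. \<sigma> i > i \<or> (\<sigma> i = i \<and> \<kappa> i \<noteq> 0)})"

text \<open>Cycles, including fixed points, are represented by their supports.\<close>

definition zero_cycles :: "nat \<Rightarrow> (nat \<Rightarrow> nat) \<times> (nat \<Rightarrow> nat) \<Rightarrow> nat set set" where
  "zero_cycles n = (\<lambda>(\<kappa>, \<sigma>). {C \<in> orbit \<sigma> ` {1..n}. \<kappa> (Max C) = 0})"

definition nonzero_cycles :: "nat \<Rightarrow> (nat \<Rightarrow> nat) \<times> (nat \<Rightarrow> nat) \<Rightarrow> nat set set" where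
  "nonzero_cycles n = (\<lambda>(\<kappa>, \<sigma>). {C \<in> orbit \<sigma> ` {1..n}. \<kappa> (Max C) \<noteq> 0})"

definition zc :: "nat \<Rightarrow> (nat \<Rightarrow> nat) \<times> (nat \<Rightarrow> nat) \<Rightarrow> nat" where
  "zc n \<pi> = card (zero_cycles n \<pi>)"

definition nc :: "nat \<Rightarrow> (nat \<Rightarrow> nat) \<times> (nat \<Rightarrow> nat) \<Rightarrow> nat" where
  "nc n \<pi> = card (nonzero_cycles n \<pi>)"

text \<open>The tree \<open>T''(\<pi>)\<close>.\<close>

definition perm_tree :: "nat \<Rightarrow> (nat \<Rightarrow> nat) \<times> (nat \<Rightarrow> nat) \<Rightarrow> rtree" where
  "perm_tree n = (\<lambda>(\<kappa>, \<sigma>).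
     let T = (\<lambda>s. let C = orbit \<sigma> s in cycle_tree C (perm_restrict \<sigma> C) s) in
     Node 0
       (Node (n + 1) (map T (sorted_list_of_set (Min ` nonzero_cycles n (\<kappa>, \<sigma>))))
        # map T (sorted_list_of_set (Max ` zero_cycles n (\<kappa>, \<sigma>)))))"

definition yy :: "nat \<Rightarrow> (nat \<Rightarrow> nat) \<times> (nat \<Rightarrow> nat) \<Rightarrow> nat" where
  "yy n \<pi> = (let p = parent (perm_tree n \<pi>) in
     card {(i, j). 1 \<le> i \<and> i < j \<and> j \<le> n \<and> p j < i \<and> j < p i})"

end

theory Submission
  imports Defs
begin

text \<open>
  Unfolding the recursion, the parent in \<open>T''(\<pi>)\<close> of a letter \<open>a\<close> with \<open>\<sigma> a < a\<close> is the minimum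
  of the run \<open>\<sigma> a, \<sigma>\<^sup>2 a, \<dots>\<close> up to, and excluding, the first letter that is not smaller than
  \<open>a\<close>; dually for \<open>\<sigma> a > a\<close>. The exceptions are the maxima of zero cycles (parent \<open>0\<close>) and the
  minima of non-zero cycles (parent \<open>n + 1\<close>). Hence everything depends only on \<open>\<sigma>\<close> and on the
  union \<open>Z\<close> of the zero cycles, and summing over the colors of the letters which are not maximal in
  their cycle removes \<open>r\<close>.

  For \<open>S \<subseteq> [n]\<close> let \<open>F S H\<close> be the weighted sum over the permutations of \<open>S\<close> with marked
  cycles whose excedance set is \<open>H\<close>. If \<open>k \<in> H\<close> and \<open>k + 1 \<notin> H\<close>, then three cases arise: \<open>k\<close> is a
  leaf below \<open>k + 1\<close> and can be deleted, \<open>k + 1\<close> is a leaf below \<open>k\<close> and can be deleted, or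
  conjugation by the transposition \<open>(k k + 1)\<close> exchanges the two letters and destroys exactly one
  pair counted by \<open>yy\<close>. This is the relation \<open>DE = q ED + D + E\<close> of the matrix ansatz; fixed
  points at the two ends give the boundary relations. The stationarity equation then telescopes over
  the sites, and stationary vectors are unique up to a factor because every configuration can reach
  the full one.
\<close>

section \<open>Runs of a permutation\<close>

text \<open>The recursive definition of the tree alternates between minima and maxima and is not
  local in the letters. \<open>par\<close> only compares letters along one cycle, so a transposition
  of neighbours can matter only where these two are compared with each other. Deleting a letter
  leaves a gap, hence sums over permutations of an arbitrary finite \<open>S\<close> with the outer
  labels \<open>0\<close> and \<open>N\<close> kept fixed; letters are renamed only afterwards, by
  moving the gap past one neighbour at a time. The two-cycle on \<open>k\<close> and
  \<open>k + 1\<close> fits both deletions; whether it lies in \<open>Z\<close> decides which, and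
  this also keeps the contracted fixed point on the right side of the excedance set. In the
  telescoping sum a site is replaced by the scalar 1 if occupied and -1 if empty, the usual
  companions of D and E in the matrix ansatz. The weights per cycle are 1 / \<alpha> and 1 /
  \<beta>: after summing over colors each letter contributes one factor r, the r - 1 admissible
  colors at the maximum of a non-zero cycle cancelling the denominator r - 1.\<close>

inductive_set reach :: "('a \<Rightarrow> bool) \<Rightarrow> ('a \<Rightarrow> 'a) \<Rightarrow> 'a \<Rightarrow> 'a set" for Q f a where
  start: "Q (f a) \<Longrightarrow> f a \<in> reach Q f a"
| step: "b \<in> reach Q f a \<Longrightarrow> Q (f b) \<Longrightarrow> f b \<in> reach Q f a"

text \<open>
  The order is a parameter throughout: replacing \<open>(<)\<close> by \<open>(>)\<close>, and the union of the zero
  cycles by its complement, interchanges the two halves of every argument.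
\<close>

definition strict_total :: "('a \<Rightarrow> 'a \<Rightarrow> bool) \<Rightarrow> bool" where
  "strict_total P \<longleftrightarrow> irreflp P \<and> transp P \<and> totalp P"

text \<open>The \<open>P\<close>-first element: the minimum for \<open>(<)\<close> and, through the
  converse, the maximum. Unspecified on the empty set.\<close>

definition best :: "('a \<Rightarrow> 'a \<Rightarrow> bool) \<Rightarrow> 'a set \<Rightarrow> 'a" where
  "best P X = (THE m. m \<in> X \<and> (\<forall>y\<in>X. y = m \<or> P m y))"

text \<open>\<open>reach\<close> starts at \<open>f a\<close>, and for a strict order both
  predicates fail at \<open>a\<close> itself, so a run ends at the latest on returning to
  \<open>a\<close>. For a fixed point the second branch has an empty run and an unspecified value;
  \<open>par\<close> never asks for it, since a fixed point is always a root.\<close>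

definition run_parent :: "('a \<Rightarrow> 'a \<Rightarrow> bool) \<Rightarrow> ('a \<Rightarrow> 'a) \<Rightarrow> 'a \<Rightarrow> 'a" where
  "run_parent P f a =
     (if P (f a) a then best P (reach (\<lambda>b. P b a) f a) else best P\<inverse>\<inverse> (reach (P a) f a))"

definition cycle_root :: "('a \<Rightarrow> 'a \<Rightarrow> bool) \<Rightarrow> ('a \<Rightarrow> 'a) \<Rightarrow> 'a set \<Rightarrow> 'a \<Rightarrow> bool" where
  "cycle_root P f Y a \<longleftrightarrow> a \<in> Y \<and> (\<forall>b\<in>orbit f a. b = a \<or> P b a)"

text \<open>
  \<open>Y\<close> is the union of the zero cycles; \<open>lo\<close> and \<open>hi\<close> are the labels \<open>0\<close> and \<open>n + 1\<close>.
\<close>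

definition par :: "('a \<Rightarrow> 'a \<Rightarrow> bool) \<Rightarrow> 'a \<Rightarrow> 'a \<Rightarrow> ('a \<Rightarrow> 'a) \<Rightarrow> 'a set \<Rightarrow> 'a \<Rightarrow> 'a" where
  "par P lo hi f Y a =
     (if cycle_root P f Y a then lo else if cycle_root P\<inverse>\<inverse> f (- Y) a then hi else run_parent P f a)"

lemma strict_totalD:
  assumes "strict_total P"
  shows "\<not> P x x" "P x y \<Longrightarrow> P y z \<Longrightarrow> P x z" "x \<noteq> y \<Longrightarrow> P x y \<or> P y x" "P x y \<Longrightarrow> \<not> P y x"
  using assms unfolding strict_total_def irreflp_def transp_def totalp_on_def by blast+

lemma strict_total_conversep: "strict_total P \<Longrightarrow> strict_total P\<inverse>\<inverse>"
  unfolding strict_total_def by (auto simp: irreflp_def transp_def totalp_on_def)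

lemma strict_total_less [simp]: "strict_total ((<) :: 'a::linorder \<Rightarrow> _)"
  unfolding strict_total_def by (auto simp: irreflp_def transp_def totalp_on_def)

lemma strict_total_greater [simp]: "strict_total ((>) :: 'a::linorder \<Rightarrow> _)"
  unfolding strict_total_def by (auto simp: irreflp_def transp_def totalp_on_def)

lemma best_eqI:
  assumes "strict_total P" "m \<in> X" "\<And>y. y \<in> X \<Longrightarrow> y = m \<or> P m y"
  shows "best P X = m"
  unfolding best_def
proof (rule the_equality)
  show "m \<in> X \<and> (\<forall>y\<in>X. y = m \<or> P m y)" using assms by blast
next
  fix n assume "n \<in> X \<and> (\<forall>y\<in>X. y = n \<or> P n y)"
  then have "n \<in> X" "m = n \<or> P n m" using assms(2) by simp_all
  then show "n = m" using assms(3)[of n] strict_totalD(4)[OF assms(1), of m n] by auto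
qed

lemma best_props:
  assumes P: "strict_total P" and X: "finite X" "X \<noteq> {}"
  shows "best P X \<in> X" "y \<in> X \<Longrightarrow> y = best P X \<or> P (best P X) y"
proof -
  have "\<exists>m\<in>X. \<forall>y\<in>X. y = m \<or> P m y"
    using X
  proof (induction rule: finite_ne_induct)
    case (insert x F)
    obtain m where m: "m \<in> F" "\<forall>y\<in>F. y = m \<or> P m y" using insert.IH by blast
    show ?case
    proof (cases "P x m")
      case True
      then have "\<forall>y\<in>insert x F. y = x \<or> P x y"
        using m strict_totalD(2)[OF P True] by auto
      then show ?thesis by blast
    next
      case False
      then have "\<forall>y\<in>insert x F. y = m \<or> P m y"
        using m strict_totalD(3)[OF P, of x m] by auto
      then show ?thesis using m by blast
    qed
  qed simp
  then obtain m where m: "m \<in> X" "\<forall>y\<in>X. y = m \<or> P m y" by blast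
  have "best P X = m" by (rule best_eqI[OF P]) (use m in blast)+
  then show "best P X \<in> X" "y \<in> X \<Longrightarrow> y = best P X \<or> P (best P X) y" using m by auto
qed

lemma best_remove:
  assumes P: "strict_total P" and X: "finite X" "c \<in> X" "P c d"
  shows "best P (X - {d}) = best P X"
proof -
  have ne: "X \<noteq> {}" using X by blast
  have "best P X \<noteq> d"
    using best_props(2)[OF P X(1) ne X(2)] X(3) strict_totalD(4)[OF P X(3)] strict_totalD(1)[OF P, of d] by auto
  then show ?thesis
    using best_props[OF P X(1) ne] by (intro best_eqI[OF P]) blast+
qed

lemma reach_subset_orbit: "reach Q f a \<subseteq> orbit f a"
proof
  fix b assume "b \<in> reach Q f a"
  then show "b \<in> orbit f a" by induction (auto intro: orbit.intros)
qed

lemma orbit_eq_reach: "orbit f a = reach (\<lambda>_. True) f a"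
proof
  show "orbit f a \<subseteq> reach (\<lambda>_. True) f a"
  proof
    fix b assume "b \<in> orbit f a"
    then show "b \<in> reach (\<lambda>_. True) f a" by induction (auto intro: reach.intros)
  qed
qed (rule reach_subset_orbit)

lemma orbit_subset_permutes:
  assumes "f permutes S" "a \<in> S" shows "orbit f a \<subseteq> S"
  using assms by (metis permutes_orbit_subset)

lemma finite_orbit_permutes:
  assumes "f permutes S" "finite S"
  shows "finite (orbit f a)"
proof (cases "a \<in> S")
  case True then show ?thesis
    using orbit_subset_permutes[OF assms(1)] assms(2) by (meson finite_subset)
next
  case False
  then have "f a = a" using assms(1) by (simp add: permutes_not_in)
  then have "orbit f a = {a}" by (simp add: orbit_eq_singleton_iff)
  then show ?thesis by simp
qed

lemma finite_reach_permutes: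
  assumes "f permutes S" "finite S" shows "finite (reach Q f a)"
  using finite_orbit_permutes[OF assms] reach_subset_orbit by (rule finite_subset[rotated])

lemma reach_Q: "b \<in> reach Q f a \<Longrightarrow> Q b"
  by (induction rule: reach.induct) auto

text \<open>\<open>g\<close> is \<open>f\<close> with \<open>d\<close> bypassed on the way to
  \<open>e\<close>. The hypothesis on \<open>Q\<close> says that a run which may enter
  \<open>e\<close> may also pass \<open>d\<close>, so the bypass never prolongs a run.\<close>

lemma reach_delete_aux:
  assumes g: "\<And>b. b \<noteq> d \<Longrightarrow> g b = (if f b = d then e else f b)"
    and f: "f d = e" and de: "d \<noteq> e" and Q: "Q e \<Longrightarrow> Q d" and a: "a \<noteq> d"
  shows "reach Q g a = reach Q f a - {d}"
proof
  have e: "e \<in> reach Q f a" if "d \<in> reach Q f a" "Q e"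
    using reach.step[OF that(1), unfolded f] that(2) by blast
  show "reach Q g a \<subseteq> reach Q f a - {d}"
  proof
    fix b assume "b \<in> reach Q g a"
    then show "b \<in> reach Q f a - {d}"
    proof induction
      case start
      show ?case
      proof (cases "f a = d")
        case True
        then have "g a = e" using g a by simp
        then show ?thesis using start Q reach.start[of Q f a] True e de by simp
      next
        case False
        then have "g a = f a" using g a by simp
        then show ?thesis using start reach.start[of Q f a] False by simp
      qed
    next
      case (step b)
      then have b: "b \<noteq> d" "b \<in> reach Q f a" by auto
      show ?case
      proof (cases "f b = d")
        case True
        then have "g b = e" using g b by simp
        then show ?thesis using step.hyps Q reach.step[OF b(2)] True e de by simp
      next
        case False
        then have "g b = f b" using g b by simp
        then show ?thesis using step.hyps reach.step[OF b(2)] False by simp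
      qed
    qed
  qed
  \<comment> \<open>The run of \<open>g\<close> does not visit \<open>d\<close>, so at
    \<open>d\<close> the invariant speaks of the next letter \<open>e\<close> instead.\<close>
  have "b \<in> reach Q f a \<Longrightarrow> (b \<noteq> d \<longrightarrow> b \<in> reach Q g a) \<and>
     (b = d \<longrightarrow> (Q e \<longrightarrow> e \<in> reach Q g a))" for b
  proof (induction rule: reach.induct)
    case start
    then show ?case using g[OF a] reach.start[of Q g a] by auto
  next
    case (step b)
    show ?case
    proof (cases "b = d")
      case True
      then show ?thesis using step f de by auto
    next
      case False
      then show ?thesis using step g[of b] reach.step[of b Q g a] by auto
    qed
  qed
  then show "reach Q f a - {d} \<subseteq> reach Q g a" by blast
qed

lemma reach_delete:
  assumes f: "inj f" "f d = e" and de: "d \<noteq> e" and Q: "Q e \<Longrightarrow> Q d" and a: "a \<noteq> d"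
  shows "reach Q (Transposition.transpose d e \<circ> f) a = reach Q f a - {d}"
proof (rule reach_delete_aux)
  fix b assume "b \<noteq> d"
  then have "f b \<noteq> e" using f by (metis injD)
  then show "(Transposition.transpose d e \<circ> f) b = (if f b = d then e else f b)"
    by (simp add: Transposition.transpose_def)
qed fact+

section \<open>Deleting a leaf\<close>

lemma cycle_root_fixed:
  "f a = a \<Longrightarrow> cycle_root P f Y a \<longleftrightarrow> a \<in> Y"
  unfolding cycle_root_def by (simp add: orbit_eq_singleton_iff[THEN iffD2])

text \<open>The run of \<open>d\<close> consists of \<open>e\<close> only, so \<open>d\<close> is a leaf with parent \<open>e\<close>.\<close>

locale leaf_deletion =
  fixes P :: "'a \<Rightarrow> 'a \<Rightarrow> bool" and S :: "'a set" and f :: "'a \<Rightarrow> 'a" and Y :: "'a set" and d e :: 'a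
  assumes P: "strict_total P" and f: "f permutes S" and S: "finite S"
    and inv: "\<And>a. f a \<in> Y \<longleftrightarrow> a \<in> Y"
    and fd: "f d = e" and de: "P d e"
    and adj: "\<And>x. x \<noteq> d \<Longrightarrow> x \<noteq> e \<Longrightarrow> P x d \<longleftrightarrow> P x e"
    and fe: "P (f e) e" and cyc: "f e = d \<Longrightarrow> d \<in> Y"
begin

abbreviation g where "g \<equiv> Transposition.transpose d e \<circ> f"

lemma d_ne_e: "d \<noteq> e" using de strict_totalD(1)[OF P, of d] by auto

text \<open>\<open>adj\<close> makes \<open>d\<close> and \<open>e\<close> neighbours, so a letter
  before \<open>e\<close> is \<open>d\<close> or precedes \<open>d\<close>.\<close>

lemma fe_d: "f e = d \<or> P (f e) d"
  using fe adj[of "f e"] strict_totalD(1)[OF P, of e] by (cases "f e = e") auto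

lemma adj': "x \<noteq> d \<Longrightarrow> x \<noteq> e \<Longrightarrow> P d x \<longleftrightarrow> P e x"
  using adj[of x] strict_totalD(3)[OF P, of x d] strict_totalD(3)[OF P, of x e]
    strict_totalD(4)[OF P, of x d] strict_totalD(4)[OF P, of d x]
    strict_totalD(4)[OF P, of x e] strict_totalD(4)[OF P, of e x]
  by blast

lemma reach_g: "(Q e \<Longrightarrow> Q d) \<Longrightarrow> a \<noteq> d \<Longrightarrow> reach Q g a = reach Q f a - {d}"
  using reach_delete[OF permutes_inj[OF f] fd d_ne_e] by simp

lemma orbit_g: "a \<noteq> d \<Longrightarrow> orbit g a = orbit f a - {d}"
  unfolding orbit_eq_reach by (rule reach_g) auto

lemma orbit_e: "d \<in> orbit f a \<Longrightarrow> e \<in> orbit f a"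
  using orbit.step[of d f a] fd by simp

lemma cycle_root_g:
  assumes a: "a \<noteq> d"
  shows "cycle_root P g (Y - {d}) a \<longleftrightarrow> cycle_root P f Y a"
proof -
  have "d = a \<or> P d a" if "\<forall>b\<in>orbit f a - {d}. b = a \<or> P b a" "d \<in> orbit f a"
  proof -
    have "e = a \<or> P e a" using orbit_e that d_ne_e by auto
    then show ?thesis using de strict_totalD(2)[OF P de, of a] by auto
  qed
  then show ?thesis unfolding cycle_root_def using a by (auto simp: orbit_g)
qed

text \<open>The danger is a cycle whose \<open>P\<close>-first letter is \<open>d\<close> and which
  would pass this role to \<open>e\<close>. Since \<open>f e\<close> precedes \<open>e\<close>, this
  forces \<open>f e = d\<close>; but by \<open>cyc\<close> that two-cycle lies in \<open>Y\<close>,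
  where roots of this kind do not occur.\<close>

lemma cycle_root_conversep_g:
  assumes a: "a \<noteq> d"
  shows "cycle_root P\<inverse>\<inverse> g (- (Y - {d})) a \<longleftrightarrow> cycle_root P\<inverse>\<inverse> f (- Y) a"
proof -
  have "P a d" if b: "\<forall>b\<in>orbit f a - {d}. b = a \<or> P a b" and d: "d \<in> orbit f a" and Y: "a \<notin> Y"
  proof (cases "a = e")
    case True
    then have "f e \<noteq> d" using cyc Y inv[of d] fd by auto
    then have "f e = e \<or> P e (f e)"
      using b True orbit.base[of f e] by auto
    then have False using fe strict_totalD(1)[OF P, of e] strict_totalD(4)[OF P, of "f e" e] by auto
    then show ?thesis ..
  next
    case False
    then have "P a e" using orbit_e[OF d] b d_ne_e by auto
    then show ?thesis using adj a False by auto
  qed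
  then show ?thesis unfolding cycle_root_def using a by (auto simp: orbit_g)
qed

text \<open>\<open>d\<close> never decides a run: an upward run through \<open>d\<close> goes on to
  the later letter \<open>e\<close>, and a downward run through \<open>d\<close> goes on through
  \<open>e\<close> to \<open>f e\<close>, which precedes \<open>d\<close>. The assumption for
  \<open>a = e\<close> excludes the two-cycle, where \<open>e\<close> becomes fixed.\<close>

lemma run_parent_g:
  assumes a: "a \<noteq> d" "f a \<noteq> a" and ea: "a = e \<Longrightarrow> f e \<noteq> d"
  shows "run_parent P g a = run_parent P f a"
proof -
  have fin: "finite (reach Q f a)" for Q by (rule finite_reach_permutes[OF f S])
  have ga: "g a = (if f a = d then e else f a)"
  proof -
    have "f a \<noteq> e" using a(1) fd permutes_inj[OF f] by (metis injD)
    then show ?thesis by (simp add: Transposition.transpose_def)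
  qed
  have dir: "P (g a) a \<longleftrightarrow> P (f a) a"
    using ga ea adj'[of a] a by auto
  show ?thesis
  proof (cases "P (f a) a")
    case True
    let ?R = "reach (\<lambda>b. P b a) f a"
    have "best P (?R - {d}) = best P ?R"
    proof (cases "d \<in> ?R")
      case dR: True
      have "f e \<in> ?R \<and> P (f e) d"
      proof (cases "a = e")
        case True
        then show ?thesis using ea fe_d fe reach.start[of "\<lambda>b. P b a" f a] by auto
      next
        case False
        have Pd: "P d a" using reach_Q[OF dR] .
        then have "P e a" using adj' a(1) False by auto
        then have eR: "e \<in> ?R" using reach.step[of d "\<lambda>b. P b a" f a] dR fd by auto
        have ne: "f e \<noteq> d"
        proof
          assume fed: "f e = d"
          have "b \<in> ?R \<Longrightarrow> b \<notin> {d, e}" for b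
          proof (induction rule: reach.induct)
            case start
            then show ?case using fd fed a False permutes_inj[OF f] by (metis empty_iff injD insert_iff)
          next
            case (step b)
            then show ?case using fd fed permutes_inj[OF f] by (metis empty_iff injD insert_iff)
          qed
          then show False using dR by blast
        qed
        then have fed: "P (f e) d" using fe_d by auto
        then have "P (f e) a" using Pd strict_totalD(2)[OF P, of "f e" d a] by blast
        then show ?thesis using reach.step[of e "\<lambda>b. P b a" f a] eR fed by auto
      qed
      then show ?thesis using best_remove[OF P fin] by blast
    qed simp
    moreover have "reach (\<lambda>b. P b a) g a = ?R - {d}"
      using strict_totalD(2)[OF P de] a(1) by (intro reach_g) auto
    ultimately show ?thesis using True dir by (simp add: run_parent_def)
  next
    case False
    let ?R = "reach (P a) f a"
    have Pfa: "P a (f a)" using False a(2) strict_totalD(3)[OF P, of a "f a"] by auto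
    have "a \<noteq> e"
      using Pfa fe strict_totalD(4)[OF P, of "f e" e] by auto
    then have imp: "P a d \<longleftrightarrow> P a e" using adj a by auto
    have "best P\<inverse>\<inverse> (?R - {d}) = best P\<inverse>\<inverse> ?R"
    proof (cases "d \<in> ?R")
      case dR: True
      then have "e \<in> ?R" using reach.step[of d "P a" f a] fd reach_Q[OF dR] imp by auto
      then show ?thesis using de best_remove[OF strict_total_conversep[OF P] fin, of e] by auto
    qed simp
    moreover have "reach (P a) g a = ?R - {d}"
      using imp a(1) by (intro reach_g) auto
    ultimately show ?thesis using False dir by (simp add: run_parent_def)
  qed
qed

lemma par_g:
  assumes a: "a \<noteq> d"
  shows "par P lo hi g (Y - {d}) a = par P lo hi f Y a"
proof (cases "cycle_root P f Y a \<or> cycle_root P\<inverse>\<inverse> f (- Y) a")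
  case True
  then show ?thesis
    unfolding par_def cycle_root_g[OF a] cycle_root_conversep_g[OF a] by auto
next
  case False
  then have fa: "f a \<noteq> a" by (auto simp: cycle_root_fixed)
  \<comment> \<open>In a two-cycle \<open>cyc\<close> puts both letters into \<open>Y\<close>, so
    \<open>e\<close> would be a root, contrary to the case.\<close>
  have "f e \<noteq> d" if "a = e"
  proof
    assume fed: "f e = d"
    then have "e \<in> Y" using cyc inv[of d] fd by auto
    moreover have "b \<in> orbit f e \<Longrightarrow> b \<in> {d, e}" for b
      by (induction rule: orbit.induct) (use fed fd in auto)
    ultimately show False using False de that unfolding cycle_root_def by auto
  qed
  then show ?thesis using False run_parent_g[OF a fa]
    unfolding par_def cycle_root_g[OF a] cycle_root_conversep_g[OF a] by auto
qed

lemma not_cycle_root_d: "\<not> cycle_root P f Y d"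
  unfolding cycle_root_def using orbit.base[of f d] fd de d_ne_e strict_totalD(4)[OF P de] by auto

lemma not_cycle_root_conversep_d: "\<not> cycle_root P\<inverse>\<inverse> f (- Y) d"
  unfolding cycle_root_def
  using orbit.step[OF orbit.base[of f d]] fd fe_d cyc strict_totalD(4)[OF P, of "f e" d]
    strict_totalD(1)[OF P] by auto

lemma par_d: "par P lo hi f Y d = e"
proof -
  have sub: "b = e" if "b \<in> reach (P d) f d" for b
    using that
  proof (induction rule: reach.induct)
    case (step b)
    then have "P d (f e)" by simp
    then show ?case using fe_d strict_totalD(1)[OF P, of d] strict_totalD(4)[OF P, of "f e" d] by auto
  qed (use fd in simp)
  have e: "e \<in> reach (P d) f d" using reach.start[of "P d" f d] fd de by simp
  have "reach (P d) f d = {e}"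
  proof (intro equalityI subsetI)
    show "b \<in> {e}" if "b \<in> reach (P d) f d" for b using sub[OF that] by simp
  qed (use e in simp)
  moreover have "best P\<inverse>\<inverse> {e} = e" by (rule best_eqI[OF strict_total_conversep[OF P]]) auto
  moreover have "\<not> P (f d) d" using fd de strict_totalD(4)[OF P] by blast
  ultimately show ?thesis
    using not_cycle_root_d not_cycle_root_conversep_d by (simp add: par_def run_parent_def)
qed

end

section \<open>Exchanging adjacent letters\<close>

lemma reach_conj:
  assumes g: "\<And>x. g (h x) = h (f x)"
  shows "reach Q g (h a) = h ` reach (\<lambda>b. Q (h b)) f a"
proof (intro equalityI subsetI)
  fix b assume "b \<in> reach Q g (h a)"
  then show "b \<in> h ` reach (\<lambda>b. Q (h b)) f a"
  proof induction
    case start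
    then show ?case using g reach.start[of "\<lambda>b. Q (h b)" f a] by simp
  next
    case (step b)
    then obtain c where c: "c \<in> reach (\<lambda>b. Q (h b)) f a" "b = h c" by blast
    then show ?case using step.hyps g reach.step[OF c(1)] by simp
  qed
next
  fix b assume "b \<in> h ` reach (\<lambda>b. Q (h b)) f a"
  then obtain c where c: "c \<in> reach (\<lambda>b. Q (h b)) f a" "b = h c" by blast
  from c(1) have "h c \<in> reach Q g (h a)"
  proof induction
    case start
    then show ?case using g reach.start[of Q g "h a"] by simp
  next
    case (step c)
    then show ?case using g reach.step[of "h c" Q g "h a"] by simp
  qed
  then show "b \<in> reach Q g (h a)" using c by simp
qed

lemma orbit_conj: "(\<And>x. g (h x) = h (f x)) \<Longrightarrow> orbit g (h a) = h ` orbit f a"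
  unfolding orbit_eq_reach by (rule reach_conj)

lemma reach_cong:
  assumes "\<And>b. b \<in> orbit f a \<Longrightarrow> Q b \<longleftrightarrow> Q' b"
  shows "reach Q f a = reach Q' f a"
proof -
  have "reach Q f a \<subseteq> reach Q' f a" if Q: "\<And>b. b \<in> orbit f a \<Longrightarrow> Q b \<longleftrightarrow> Q' b" for Q Q'
  proof
    fix b assume "b \<in> reach Q f a"
    then show "b \<in> reach Q' f a"
    proof induction
      case start
      then show ?case using Q[OF orbit.base] reach.start[of Q' f a] by simp
    next
      case (step b)
      then have "b \<in> orbit f a" using reach_subset_orbit by fastforce
      then show ?case using step Q[OF orbit.step] reach.step[of b Q' f a] by simp
    qed
  qed
  from this[of Q Q'] this[of Q' Q] assms show ?thesis by blast
qed

lemma fixed_notin_reach: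
  assumes "inj f" "f b = b" "a \<noteq> b" shows "b \<notin> reach Q f a"
proof -
  have "c \<noteq> b" if "c \<in> reach Q f a" for c
    using that
  proof induction
    case start
    then show ?case using assms by (metis injD)
  next
    case (step c)
    then show ?case using assms(1,2) by (metis injD)
  qed
  then show ?thesis by blast
qed

text \<open>Reversing the order interchanges the two branches together with the two kinds of
  optimum. A fixed point, which moves in neither direction, has to be excluded.\<close>

lemma run_parent_conversep:
  assumes "strict_total P" "f a \<noteq> a"
  shows "run_parent P\<inverse>\<inverse> f a = run_parent P f a"
proof -
  have "P a (f a) \<longleftrightarrow> \<not> P (f a) a"
    using strict_totalD(3)[OF assms(1), of a "f a"] strict_totalD(4)[OF assms(1), of a "f a"] assms(2)
    by auto
  moreover have "P\<inverse>\<inverse> a = (\<lambda>b. P b a)" by auto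
  ultimately show ?thesis by (simp add: run_parent_def)
qed

lemma run_parent_down:
  assumes P: "strict_total P" and f: "f permutes S" "finite S" and a: "P (f a) a"
  shows "run_parent P f a \<in> reach (\<lambda>b. P b a) f a"
    and "b \<in> reach (\<lambda>b. P b a) f a \<Longrightarrow> b = run_parent P f a \<or> P (run_parent P f a) b"
    and "P (run_parent P f a) a"
proof -
  have ne: "reach (\<lambda>b. P b a) f a \<noteq> {}" using reach.start[of "\<lambda>b. P b a" f a, OF a] by auto
  have r: "run_parent P f a = best P (reach (\<lambda>b. P b a) f a)" using a by (simp add: run_parent_def)
  show 1: "run_parent P f a \<in> reach (\<lambda>b. P b a) f a"
    unfolding r by (rule best_props(1)[OF P finite_reach_permutes[OF f] ne])
  show "b \<in> reach (\<lambda>b. P b a) f a \<Longrightarrow> b = run_parent P f a \<or> P (run_parent P f a) b"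
    unfolding r by (rule best_props(2)[OF P finite_reach_permutes[OF f] ne])
  show "P (run_parent P f a) a" using reach_Q[OF 1] .
qed

text \<open>The complement of the two leaf cases: \<open>k\<close> goes up, \<open>l\<close> goes
  down, they are neighbours in the order, and neither is mapped to the other. A fixed point counts
  as up outside \<open>Y\<close> and as down inside.\<close>

locale peak_swap =
  fixes P :: "'a \<Rightarrow> 'a \<Rightarrow> bool" and S :: "'a set" and f :: "'a \<Rightarrow> 'a" and Y :: "'a set" and k l :: 'a
  assumes P: "strict_total P" and f: "f permutes S" and S: "finite S"
    and inv: "\<And>a. f a \<in> Y \<longleftrightarrow> a \<in> Y"
    and kl: "P k l"
    and adj: "\<And>x. x \<noteq> k \<Longrightarrow> x \<noteq> l \<Longrightarrow> P x k \<longleftrightarrow> P x l"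
    and adj': "\<And>x. x \<noteq> k \<Longrightarrow> x \<noteq> l \<Longrightarrow> P k x \<longleftrightarrow> P l x"
    and k: "P k (f k) \<and> f k \<noteq> l \<or> f k = k \<and> k \<notin> Y"
    and l: "P (f l) l \<and> f l \<noteq> k \<or> f l = l \<and> l \<in> Y"
begin

abbreviation t where "t \<equiv> Transposition.transpose k l"
abbreviation g where "g \<equiv> t \<circ> f \<circ> t"

text \<open>Turns every statement about downward runs and \<open>l\<close> into one about upward
  runs and \<open>k\<close>.\<close>

lemma dual: "peak_swap P\<inverse>\<inverse> S f (- Y) l k"
  by unfold_locales (use P f S inv kl adj adj' k l in \<open>auto intro: strict_total_conversep\<close>)

lemma k_ne_l: "k \<noteq> l" using kl strict_totalD(1)[OF P] by auto

lemma t_eq: "b \<noteq> k \<Longrightarrow> b \<noteq> l \<Longrightarrow> t b = b"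
  by simp

text \<open>Neighbours have the same relation to every third letter, so \<open>t\<close> reverses
  only the comparison of \<open>k\<close> with \<open>l\<close>. The lemmas below show that this
  comparison never decides a parent or a root.\<close>

lemma t_mono:
  assumes "P x y" "\<not> (x = k \<and> y = l)"
  shows "P (t x) (t y)"
proof -
  have ne: "x \<noteq> y" using assms strict_totalD(1)[OF P, of x] by auto
  consider "x = k" | "x = l" | "x \<noteq> k" "x \<noteq> l" by blast
  then show ?thesis
  proof cases
    case 1
    then show ?thesis using assms ne adj'[of y] by simp
  next
    case 2
    then have "y \<noteq> k" using assms strict_totalD(4)[OF P kl] by auto
    then show ?thesis using 2 assms ne adj'[of y] by simp
  next
    case 3
    consider "y = k" | "y = l" | "y \<noteq> k" "y \<noteq> l" by blast
    then show ?thesis using assms 3 adj[of x] by cases simp_all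
  qed
qed

lemma g_t: "g (t x) = t (f x)" by simp

lemma fk: "f k \<noteq> k \<Longrightarrow> P k (f k) \<and> P l (f k) \<and> f k \<noteq> l"
  using k adj'[of "f k"] by auto

lemma fl: "f l \<noteq> l \<Longrightarrow> P (f l) l \<and> P (f l) k \<and> f l \<noteq> k"
  using l adj[of "f l"] by auto

text \<open>A downward run that meets \<open>l\<close> cannot end there, since \<open>l\<close>
  moves down past \<open>k\<close> as well. Hence neither \<open>k\<close> nor \<open>l\<close> is
  the \<open>P\<close>-first letter of such a run.\<close>

lemma l_in_reach:
  assumes "l \<in> reach (\<lambda>b. P b a) f a" "a \<noteq> l"
  shows "f l \<in> reach (\<lambda>b. P b a) f a" "P (f l) k"
proof -
  have "f l \<noteq> l" using fixed_notin_reach[OF permutes_inj[OF f] _ assms(2)] assms(1) by blast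
  then show "P (f l) k" using fl by blast
  have "P (f l) a" using fl \<open>f l \<noteq> l\<close> strict_totalD(2)[OF P, of "f l" l a] reach_Q[OF assms(1)] by blast
  then show "f l \<in> reach (\<lambda>b. P b a) f a" by (rule reach.step[OF assms(1)])
qed

lemma best_t_reach:
  assumes a: "P (f a) a" "a \<noteq> k" "a \<noteq> l"
  shows "run_parent P g a = t (run_parent P f a)"
proof -
  have ta: "t a = a" using a by (simp add: Transposition.transpose_def)
  let ?R = "reach (\<lambda>b. P b a) f a" and ?m = "run_parent P f a"
  note rp = run_parent_down[OF P f S a(1)]
  have R: "reach (\<lambda>b. P b a) g a = t ` ?R"
  proof -
    have "P (t b) a \<longleftrightarrow> P b a" for b
      using adj'[OF a(2,3)] by (auto simp: Transposition.transpose_def)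
    then show ?thesis using reach_conj[of g t f "\<lambda>b. P b a" a] g_t ta by simp
  qed
  have "best P (t ` ?R) = t ?m"
  proof (rule best_eqI[OF P])
    fix y assume "y \<in> t ` ?R"
    then obtain x where x: "x \<in> ?R" "y = t x" by blast
    \<comment> \<open>The reversed comparison would require \<open>k\<close> as the optimum and
      \<open>l\<close> in the run; but then \<open>f l\<close> is in the run and precedes
      \<open>k\<close>.\<close>
    have kl': "\<not> (?m = k \<and> x = l)"
    proof
      assume ass: "?m = k \<and> x = l"
      then have lR: "l \<in> ?R" using x by simp
      have fl: "f l \<in> ?R" "P (f l) k" using l_in_reach[OF lR] a by simp_all
      then have "f l = k \<or> P k (f l)" using rp(2)[OF fl(1)] ass by simp
      then show False
        using fl(2) strict_totalD(4)[OF P fl(2)] strict_totalD(1)[OF P, of k] by auto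
    qed
    have "x = ?m \<or> P ?m x" using rp(2)[OF x(1)] .
    then have "x = ?m \<or> P (t ?m) (t x)" using t_mono[of ?m x] kl' by auto
    then show "y = t ?m \<or> P (t ?m) y" using x(2) by auto
  qed (use rp(1) in simp)
  moreover have "P (g a) a"
  proof -
    have "g a = t (f a)" using g_t[of a] ta by simp
    moreover have "P (t (f a)) (t a)" by (rule t_mono[OF a(1)]) (use a(3) in simp)
    ultimately show ?thesis unfolding ta by (simp only:)
  qed
  ultimately show ?thesis by (simp add: run_parent_def R)
qed

text \<open>Under \<open>t\<close> the letter \<open>l\<close> becomes \<open>k\<close>, whose run
  stops already where the run of \<open>l\<close> would meet \<open>k\<close>. Only \<open>k\<close>
  itself is lost: it moves up beyond \<open>l\<close>, so the run of \<open>l\<close> ends right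
  after it, and it is not the optimum because \<open>f l\<close> precedes it.\<close>

lemma run_parent_l:
  assumes fll: "f l \<noteq> l"
  shows "run_parent P g k = t (run_parent P f l)" "P (run_parent P f l) k"
proof -
  let ?R = "reach (\<lambda>b. P b l) f l" and ?m = "run_parent P f l"
  have Pl: "P (f l) l" using fl fll by blast
  note rp = run_parent_down[OF P f S Pl]
  show mk: "P ?m k"
    using rp(2)[OF reach.start[of "\<lambda>b. P b l" f l, OF Pl]] fl[OF fll]
      strict_totalD(2)[OF P, of ?m "f l" k] by auto
  have "reach (\<lambda>b. P b k) g k = t ` reach (\<lambda>b. P (t b) k) f l"
    using reach_conj[of g t f "\<lambda>b. P b k" l] g_t by simp
  also have "reach (\<lambda>b. P (t b) k) f l = ?R - {k}"
  proof -
    have Q: "P (t b) k \<longleftrightarrow> b \<noteq> k \<and> P b l" for b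
      using adj[of b] strict_totalD(1)[OF P] strict_totalD(4)[OF P kl]
      by (auto simp: Transposition.transpose_def)
    have "b \<in> reach (\<lambda>b. b \<noteq> k \<and> P b l) f l \<Longrightarrow> b \<in> ?R" for b
      by (induction rule: reach.induct) (auto intro: reach.intros)
    moreover have "b \<noteq> k" if "b \<in> reach (\<lambda>b. b \<noteq> k \<and> P b l) f l" for b
      using reach_Q[OF that] by simp
    moreover have "b \<in> ?R \<Longrightarrow> b = k \<or> b \<in> reach (\<lambda>b. b \<noteq> k \<and> P b l) f l" for b
    proof (induction rule: reach.induct)
      case start
      then show ?case using reach.start[of "\<lambda>b. b \<noteq> k \<and> P b l" f l] by auto
    next
      case (step b)
      show ?case
      proof (cases "b = k")
        case True
        have "f k = k \<or> \<not> P (f k) l" using fk strict_totalD(4)[OF P, of l "f k"] by auto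
        then show ?thesis using step True by auto
      next
        case False
        then show ?thesis using step reach.step[of b "\<lambda>b. b \<noteq> k \<and> P b l" f l] by auto
      qed
    qed
    ultimately show ?thesis unfolding Q by blast
  qed
  also have "t ` (?R - {k}) = ?R - {k}"
  proof -
    have "l \<notin> ?R" using reach_Q strict_totalD(1)[OF P] by fastforce
    then have "t b = b" if "b \<in> ?R - {k}" for b using that by (metis DiffE insertI1 t_eq)
    then show ?thesis by (simp add: image_def)
  qed
  finally have R: "reach (\<lambda>b. P b k) g k = ?R - {k}" .
  have "best P (?R - {k}) = ?m"
    using rp mk strict_totalD(1)[OF P, of k] by (intro best_eqI[OF P]) auto
  moreover have "g k = f l" using fl[OF fll] fll by (simp add: Transposition.transpose_def)
  moreover have "?m \<noteq> k" "?m \<noteq> l" using mk rp(3) strict_totalD(1)[OF P] by auto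
  ultimately show "run_parent P g k = t ?m"
    using R fl[OF fll] by (simp add: run_parent_def t_eq)
qed

lemma run_parent_g:
  assumes a: "f a \<noteq> a"
  shows "run_parent P g (t a) = t (run_parent P f a)"
proof -
  interpret D: peak_swap "P\<inverse>\<inverse>" S f "- Y" l k by (rule dual)
  have tt: "D.t = t" by (simp add: transpose_commute)
  have ga: "g (t a) \<noteq> t a" using a g_t[of a] by (metis transpose_involutory)
  consider "a = l" | "a = k" | "a \<noteq> k" "a \<noteq> l" "P (f a) a" | "a \<noteq> k" "a \<noteq> l" "P a (f a)"
    using a strict_totalD(3)[OF P, of a "f a"] by metis
  then show ?thesis
  proof cases
    case 1
    then show ?thesis using run_parent_l a by simp
  next
    case 2
    then show ?thesis
      using D.run_parent_l(1) a ga unfolding tt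
      by (simp add: run_parent_conversep[OF P])
  next
    case 3
    then show ?thesis using best_t_reach[of a] by simp
  next
    case 4
    then have "run_parent P\<inverse>\<inverse> g a = t (run_parent P\<inverse>\<inverse> f a)"
      using D.best_t_reach[of a] unfolding tt by simp
    then show ?thesis using ga a 4
      by (simp add: run_parent_conversep[OF P])
  qed
qed

text \<open>The critical cases are \<open>a = k\<close> in \<open>Y\<close>, and
  \<open>a = l\<close> with \<open>k\<close> in its cycle. In both, \<open>f k\<close> lies in the
  cycle of \<open>a\<close> beyond \<open>k\<close> and \<open>l\<close>, so neither side
  holds.\<close>

lemma cycle_root_g: "cycle_root P g (t ` Y) (t a) \<longleftrightarrow> cycle_root P f Y a"
proof -
  have "cycle_root P g (t ` Y) (t a) \<longleftrightarrow>
      a \<in> Y \<and> (\<forall>b\<in>orbit f a. b = a \<or> P (t b) (t a))"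
    using orbit_conj[of g t f a] g_t by (auto simp: cycle_root_def image_iff dest: injD[OF inj_transpose])
  also have "\<dots> \<longleftrightarrow> cycle_root P f Y a"
  proof (cases "a = k \<or> a = l")
    case False
    then have "P (t b) (t a) \<longleftrightarrow> P b a" for b
      using adj'[of a] by (auto simp: Transposition.transpose_def)
    then show ?thesis by (simp add: cycle_root_def)
  next
    case kl': True
    show ?thesis
    proof (cases "a = k")
      case True
      show ?thesis
      proof (cases "k \<in> Y")
        case kY: True
        then have "f k \<noteq> k" using k strict_totalD(1)[OF P, of k] by auto
        then have "P k (f k)" "P l (f k)" "f k \<noteq> l" "f k \<noteq> k" using fk by auto
        moreover have "f k \<in> orbit f k" by (rule orbit.base)
        ultimately show ?thesis
          using strict_totalD(4)[OF P, of k "f k"] strict_totalD(4)[OF P, of l "f k"] True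
          by (auto simp: cycle_root_def dest!: bspec[of _ _ "f k"])
      qed (simp add: True cycle_root_def)
    next
      case False
      then have al: "a = l" using kl' by simp
      show ?thesis
      proof (cases "k \<in> orbit f l")
        case True
        have "f k \<noteq> k"
          using fixed_notin_reach[OF permutes_inj[OF f], of k l] True k_ne_l
          unfolding orbit_eq_reach by metis
        then have "P l (f k)" "f k \<noteq> l" "f k \<in> orbit f l" using fk orbit.step[OF True] by auto
        then have "\<not> cycle_root P f Y l"
          using strict_totalD(4)[OF P, of l "f k"] by (auto simp: cycle_root_def)
        moreover have "\<not> P (t k) (t l)" using strict_totalD(4)[OF P kl] by simp
        ultimately show ?thesis using True al k_ne_l by auto
      next
        case False
        then have "b = l \<or> (P (t b) (t l) \<longleftrightarrow> P b l)" if "b \<in> orbit f l" for b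
          using adj[of b] that by (cases "b = k"; cases "b = l") auto
        then show ?thesis unfolding cycle_root_def al by blast
      qed
    qed
  qed
  finally show ?thesis .
qed

lemma cycle_root_conversep_g:
  "cycle_root P\<inverse>\<inverse> g (- (t ` Y)) (t a) \<longleftrightarrow> cycle_root P\<inverse>\<inverse> f (- Y) a"
proof -
  interpret D: peak_swap "P\<inverse>\<inverse>" S f "- Y" l k by (rule dual)
  have tt: "D.t = t" by (simp add: transpose_commute)
  have "- (t ` Y) = t ` (- Y)" by (rule bij_image_Compl_eq[symmetric]) simp
  then show ?thesis using D.cycle_root_g[of a] unfolding tt by simp
qed

lemma par_g:
  assumes "t lo = lo" "t hi = hi"
  shows "par P lo hi g (t ` Y) (t a) = t (par P lo hi f Y a)"
proof (cases "f a = a")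
  case True
  then show ?thesis
    unfolding par_def cycle_root_g cycle_root_conversep_g using assms by (auto simp: cycle_root_fixed)
next
  case False
  then show ?thesis
    unfolding par_def cycle_root_g cycle_root_conversep_g using assms run_parent_g by auto
qed

lemma run_parent_ne_l:
  assumes "P (f a) a" "a \<noteq> l"
  shows "run_parent P f a \<noteq> l"
proof
  assume eq: "run_parent P f a = l"
  note rp = run_parent_down[OF P f S assms(1)]
  have "f l \<in> reach (\<lambda>b. P b a) f a" "P (f l) k" using l_in_reach[OF _ assms(2)] rp(1) eq by auto
  then have "f l = l \<or> P l (f l)" using rp(2) eq by auto
  moreover have "P (f l) l" using \<open>P (f l) k\<close> strict_totalD(2)[OF P _ kl] by blast
  ultimately show False using strict_totalD(1)[OF P, of l] strict_totalD(4)[OF P, of l "f l"] by auto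
qed

end

section \<open>Generating sums of marked permutations\<close>

lemma conversep_less_greater: "(<)\<inverse>\<inverse> = ((>) :: 'a::ord \<Rightarrow> _)" "(>)\<inverse>\<inverse> = ((<) :: 'a::ord \<Rightarrow> _)"
  by (auto simp: fun_eq_iff)

text \<open>Allows the locales to be used with \<open>(>)\<close> and the result to be read in terms
  of \<open>(<)\<close>: deleting \<open>Suc k\<close> is deleting \<open>k\<close> upside
  down.\<close>

lemma par_conversep:
  assumes "strict_total P"
  shows "par P\<inverse>\<inverse> hi lo f (- Y) a = par P lo hi f Y a"
  using run_parent_conversep[OF assms, of f a]
  by (cases "f a = a") (auto simp: par_def cycle_root_fixed, auto simp: cycle_root_def)

definition marked_perms :: "nat set \<Rightarrow> ((nat \<Rightarrow> nat) \<times> nat set) set" where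
  "marked_perms S = {(f, Z). f permutes S \<and> Z \<subseteq> S \<and> (\<forall>a. f a \<in> Z \<longleftrightarrow> a \<in> Z)}"

text \<open>A fixed point outside \<open>Z\<close> stands for a fixed point of non-zero color, which
  belongs to the excedance set.\<close>

definition up_set :: "nat set \<Rightarrow> (nat \<Rightarrow> nat) \<times> nat set \<Rightarrow> nat set" where
  "up_set S = (\<lambda>(f, Z). {a \<in> S. a < f a \<or> f a = a \<and> a \<notin> Z})"

definition crossings :: "nat set \<Rightarrow> (nat \<Rightarrow> nat) \<Rightarrow> (nat \<times> nat) set" where
  "crossings S p = {(i, j). i \<in> S \<and> j \<in> S \<and> i < j \<and> p j < i \<and> j < p i}"

text \<open>A cycle in \<open>Z\<close> has one root, its maximum, and any other cycle one root, its
  minimum, so the first two exponents count cycles. \<open>N\<close> labels the outer vertex and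
  does not change when \<open>S\<close> loses letters.\<close>

definition weight ::
  "nat \<Rightarrow> real \<Rightarrow> real \<Rightarrow> real \<Rightarrow> nat set \<Rightarrow> (nat \<Rightarrow> nat) \<times> nat set \<Rightarrow> real" where
  "weight N a b q S = (\<lambda>(f, Z).
     a ^ card {x \<in> S. cycle_root (<) f Z x} * b ^ card {x \<in> S. cycle_root (>) f (- Z) x}
     * q ^ card (crossings S (par (<) 0 N f Z)))"

definition gen_sum ::
  "nat \<Rightarrow> real \<Rightarrow> real \<Rightarrow> real \<Rightarrow> nat set \<Rightarrow> nat set \<Rightarrow> real" where
  "gen_sum N a b q S H = (\<Sum>\<pi> | \<pi> \<in> marked_perms S \<and> up_set S \<pi> = H. weight N a b q S \<pi>)"

lemma finite_crossings: "finite S \<Longrightarrow> finite (crossings S p)"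
  by (rule finite_subset[of _ "S \<times> S"]) (auto simp: crossings_def)

lemma finite_marked_perms: "finite S \<Longrightarrow> finite (marked_perms S)"
  by (rule finite_subset[of _ "{f. f permutes S} \<times> Pow S"])
    (auto simp: marked_perms_def finite_permutations)

lemma crossings_cong:
  "(\<And>x. x \<in> S \<Longrightarrow> p x = p' x) \<Longrightarrow> crossings S p = crossings S p'"
  by (auto simp: crossings_def)

text \<open>A crossing that involves \<open>d\<close> would need a letter strictly between
  \<open>d\<close> and its parent \<open>e\<close>, but these are consecutive.\<close>

lemma crossings_delete:
  assumes "p d = e" "e = Suc d \<or> d = Suc e"
  shows "crossings (S - {d}) p = crossings S p"
  using assms by (auto simp: crossings_def)

lemma weight_delete:
  assumes p: "\<And>x. x \<in> S - {d} \<Longrightarrow> par (<) 0 N g Z' x = par (<) 0 N f Z x"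
    and r1: "\<And>x. x \<in> S - {d} \<Longrightarrow> cycle_root (<) g Z' x \<longleftrightarrow> cycle_root (<) f Z x"
    and r2: "\<And>x. x \<in> S - {d} \<Longrightarrow> cycle_root (>) g (- Z') x \<longleftrightarrow> cycle_root (>) f (- Z) x"
    and d: "\<not> cycle_root (<) f Z d" "\<not> cycle_root (>) f (- Z) d" "par (<) 0 N f Z d = e"
    and e: "e = Suc d \<or> d = Suc e"
  shows "weight N a b q (S - {d}) (g, Z') = weight N a b q S (f, Z)"
proof -
  have "{x \<in> S - {d}. cycle_root (<) g Z' x} = {x \<in> S. cycle_root (<) f Z x}"
    using r1 d by auto
  moreover have "{x \<in> S - {d}. cycle_root (>) g (- Z') x} = {x \<in> S. cycle_root (>) f (- Z) x}"
    using r2 d by blast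
  moreover have "crossings (S - {d}) (par (<) 0 N g Z') = crossings (S - {d}) (par (<) 0 N f Z)"
    by (rule crossings_cong) (rule p)
  ultimately show ?thesis
    using crossings_delete[of "par (<) 0 N f Z" d e S, OF d(3) e] by (simp add: weight_def)
qed

text \<open>\<open>d\<close> is contracted into its image \<open>e\<close>; inversely,
  \<open>d\<close> is inserted just before \<open>e\<close> in its cycle and joins \<open>Z\<close>
  if \<open>e\<close> is there. \<open>z\<close> prescribes the side of the two-cycle, which
  contracts to the fixed point \<open>e\<close>.\<close>

lemma bij_betw_delete:
  assumes d: "d \<in> S" and e: "e \<in> S" and de: "d \<noteq> e"
  shows "bij_betw (\<lambda>(f, Z). (Transposition.transpose d e \<circ> f, Z - {d}))
     {(f, Z) \<in> marked_perms S. f d = e \<and> (f e = d \<longrightarrow> (d \<in> Z \<longleftrightarrow> z))}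
     {(g, Z) \<in> marked_perms (S - {d}). g e = e \<longrightarrow> (e \<in> Z \<longleftrightarrow> z)}"
proof (rule bij_betw_byWitness)
  let ?t = "Transposition.transpose d e"
  let ?h = "\<lambda>(f, Z). (?t \<circ> f, Z - {d})" and ?h' = "\<lambda>(g, Z). (?t \<circ> g, if e \<in> Z then insert d Z else Z)"
  let ?X = "{(f, Z) \<in> marked_perms S. f d = e \<and> (f e = d \<longrightarrow> (d \<in> Z \<longleftrightarrow> z))}"
  let ?Y = "{(g, Z) \<in> marked_perms (S - {d}). g e = e \<longrightarrow> (e \<in> Z \<longleftrightarrow> z)}"
  have tt: "?t \<circ> (?t \<circ> f) = f" for f by (simp add: fun_eq_iff)
  show "\<forall>\<pi>\<in>?X. ?h' (?h \<pi>) = \<pi>"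
  proof
    fix \<pi> assume "\<pi> \<in> ?X"
    then obtain f Z where \<pi>: "\<pi> = (f, Z)" "(f, Z) \<in> marked_perms S" "f d = e" by auto
    then have "e \<in> Z \<longleftrightarrow> d \<in> Z" by (auto simp: marked_perms_def)
    then have "(if e \<in> Z - {d} then insert d (Z - {d}) else Z - {d}) = Z" using de by auto
    then show "?h' (?h \<pi>) = \<pi>" unfolding \<pi>(1) prod.case tt by (rule arg_cong)
  qed
  show "\<forall>\<pi>\<in>?Y. ?h (?h' \<pi>) = \<pi>"
  proof
    fix \<pi> assume "\<pi> \<in> ?Y"
    then obtain g Z where \<pi>: "\<pi> = (g, Z)" "(g, Z) \<in> marked_perms (S - {d})" by auto
    then have "d \<notin> Z" by (auto simp: marked_perms_def)
    then have "(if e \<in> Z then insert d Z else Z) - {d} = Z" by auto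
    then show "?h (?h' \<pi>) = \<pi>" unfolding \<pi>(1) prod.case tt by (rule arg_cong)
  qed
  show "?h ` ?X \<subseteq> ?Y"
  proof (rule image_subsetI)
    fix \<pi> assume "\<pi> \<in> ?X"
    then obtain f Z where \<pi>: "\<pi> = (f, Z)" and f: "f permutes S" and Z: "Z \<subseteq> S" "\<And>a. f a \<in> Z \<longleftrightarrow> a \<in> Z"
      and fd: "f d = e" and fe: "f e = d \<Longrightarrow> (d \<in> Z \<longleftrightarrow> z)"
      unfolding marked_perms_def by blast
    have eZ: "e \<in> Z \<longleftrightarrow> d \<in> Z" using Z(2)[of d] fd by simp
    have "?t \<circ> f permutes S"
      using f d e by (intro permutes_compose permutes_swap_id)
    then have 1: "?t \<circ> f permutes S - {d}"
      by (rule permutes_superset) (use fd in auto)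
    have 2: "(?t \<circ> f) a \<in> Z - {d} \<longleftrightarrow> a \<in> Z - {d}" for a
    proof (cases "a = d")
      case False
      then have "f a \<noteq> e" using fd f by (metis permutes_inj injD)
      then show ?thesis using Z(2)[of a] eZ de False
        by (cases "f a = d") auto
    qed (use fd in simp)
    have 3: "e \<in> Z - {d} \<longleftrightarrow> z" if "(?t \<circ> f) e = e"
    proof -
      have "f e = d" using arg_cong[OF that, of ?t] by simp
      then show ?thesis using fe eZ de by simp
    qed
    have "(?t \<circ> f, Z - {d}) \<in> marked_perms (S - {d})"
      unfolding marked_perms_def using 1 2 Z(1) by blast
    with 3 show "?h \<pi> \<in> ?Y" unfolding \<pi> prod.case by blast
  qed
  show "?h' ` ?Y \<subseteq> ?X"
  proof (rule image_subsetI)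
    fix \<pi> assume "\<pi> \<in> ?Y"
    then obtain g Z where \<pi>: "\<pi> = (g, Z)" and g: "g permutes S - {d}"
      and Z: "Z \<subseteq> S - {d}" "\<And>a. g a \<in> Z \<longleftrightarrow> a \<in> Z" and ge: "g e = e \<Longrightarrow> (e \<in> Z \<longleftrightarrow> z)"
      unfolding marked_perms_def by blast
    let ?Z = "if e \<in> Z then insert d Z else Z"
    have gd: "g d = d" using g by (auto simp: permutes_def)
    have "g permutes S" using g by (rule permutes_subset) auto
    then have 1: "?t \<circ> g permutes S"
      using d e by (intro permutes_compose permutes_swap_id)
    have 2: "(?t \<circ> g) a \<in> ?Z \<longleftrightarrow> a \<in> ?Z" for a
    proof (cases "a = d")
      case True
      then show ?thesis using gd de Z(1) by auto
    next
      case False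
      then have "g a \<noteq> d" using gd g by (metis permutes_inj injD)
      then show ?thesis using Z(2)[of a] False Z(1)
        by (cases "g a = e") auto
    qed
    have 3: "d \<in> ?Z \<longleftrightarrow> z" if "(?t \<circ> g) e = d"
    proof -
      have "g e = e" using arg_cong[OF that, of ?t] by simp
      then show ?thesis using ge Z(1) by auto
    qed
    have 4: "(?t \<circ> g) d = e" using gd by simp
    have "?Z \<subseteq> S" using Z(1) d by auto
    then have "(?t \<circ> g, ?Z) \<in> marked_perms S"
      unfolding marked_perms_def using 1 2 by blast
    with 3 4 show "?h' \<pi> \<in> ?X" unfolding \<pi> prod.case by blast
  qed
qed

lemma up_set_delete:
  assumes f: "(f, Z) \<in> marked_perms S" "f d = e" and e: "e = Suc d \<or> d = Suc e"
    and cyc: "f e = d \<Longrightarrow> (d \<in> Z \<longleftrightarrow> d < e)"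
  shows "up_set (S - {d}) (Transposition.transpose d e \<circ> f, Z - {d}) = up_set S (f, Z) - {d}"
proof -
  have "(a < Transposition.transpose d e (f a) \<or> Transposition.transpose d e (f a) = a \<and> a \<notin> Z)
      \<longleftrightarrow> (a < f a \<or> f a = a \<and> a \<notin> Z)" if "a \<noteq> d" for a
  proof -
    have inj: "inj f" using f by (auto simp: marked_perms_def permutes_inj)
    then have fa: "f a \<noteq> e" using that f(2) by (metis injD)
    have de: "e \<in> Z \<longleftrightarrow> d \<in> Z" using f by (auto simp: marked_perms_def)
    show ?thesis
    proof (cases "f a = d")
      case True
      then show ?thesis using cyc de e that by (cases "a = e") auto
    qed (use fa in simp)
  qed
  then show ?thesis by (auto simp: up_set_def)
qed

text \<open>With \<open>d < e\<close> as the prescribed side, a contracted two-cycle becomes a fixed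
  point \<open>e\<close> in \<open>Z\<close> if \<open>e\<close> goes down and outside
  \<open>Z\<close> if \<open>e\<close> goes up. The excedance set already enforces this, so no side
  condition is left on the right.\<close>

lemma gen_sum_delete:
  assumes d: "d \<in> S" and e: "e \<in> S" and de: "e = Suc d \<or> d = Suc e"
    and H: "d \<in> H \<longleftrightarrow> d < e" "e \<in> H \<longleftrightarrow> e < d"
    and w: "\<And>f Z. (f, Z) \<in> marked_perms S \<Longrightarrow> f d = e \<Longrightarrow> (f e = d \<Longrightarrow> (d \<in> Z \<longleftrightarrow> d < e)) \<Longrightarrow>
       up_set S (f, Z) = H \<Longrightarrow>
       weight N a b q (S - {d}) (Transposition.transpose d e \<circ> f, Z - {d}) = weight N a b q S (f, Z)"
  shows "(\<Sum>\<pi> | \<pi> \<in> marked_perms S \<and> up_set S \<pi> = H \<and>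
            fst \<pi> d = e \<and> (fst \<pi> e = d \<longrightarrow> (d \<in> snd \<pi> \<longleftrightarrow> d < e)). weight N a b q S \<pi>)
         = gen_sum N a b q (S - {d}) (H - {d})"
    (is "sum _ ?A = _")
proof -
  let ?h = "\<lambda>(f, Z). (Transposition.transpose d e \<circ> f, Z - {d})"
  let ?X = "{(f, Z) \<in> marked_perms S. f d = e \<and> (f e = d \<longrightarrow> (d \<in> Z \<longleftrightarrow> d < e))}"
  let ?Y = "{(g, Z) \<in> marked_perms (S - {d}). g e = e \<longrightarrow> (e \<in> Z \<longleftrightarrow> d < e)}"
  let ?B = "{\<pi>. \<pi> \<in> marked_perms (S - {d}) \<and> up_set (S - {d}) \<pi> = H - {d}}"
  have ne: "d \<noteq> e" using de by auto
  have bij: "bij_betw ?h ?X ?Y" by (rule bij_betw_delete[OF d e ne])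
  have up: "up_set (S - {d}) (?h \<pi>) = up_set S \<pi> - {d}" if "\<pi> \<in> ?X" for \<pi>
  proof -
    obtain f Z where "\<pi> = (f, Z)" by (cases \<pi>)
    then show ?thesis using that up_set_delete[of f Z S d e, OF _ _ de] by simp
  qed
  have dup: "d \<in> up_set S \<pi> \<longleftrightarrow> d < e" if "\<pi> \<in> ?X" for \<pi>
    using that d ne by (cases \<pi>) (auto simp: up_set_def)
  have A: "?A = {\<pi> \<in> ?X. up_set S \<pi> = H}" by auto
  have B: "?B = {\<pi> \<in> ?Y. up_set (S - {d}) \<pi> = H - {d}}"
  proof -
    have "g e = e \<longrightarrow> (e \<in> Z \<longleftrightarrow> d < e)" if "up_set (S - {d}) (g, Z) = H - {d}" for g Z
    proof -
      have "e \<in> up_set (S - {d}) (g, Z) \<longleftrightarrow> e < d" using that H ne by auto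
      then show ?thesis using e ne by (auto simp: up_set_def)
    qed
    then show ?thesis by auto
  qed
  have "bij_betw ?h ?A ?B"
    unfolding A B using bij
  proof (rule bij_betw_Collect)
    fix \<pi> assume \<pi>: "\<pi> \<in> ?X"
    show "up_set (S - {d}) (?h \<pi>) = H - {d} \<longleftrightarrow> up_set S \<pi> = H"
      unfolding up[OF \<pi>] using dup[OF \<pi>] H by blast
  qed
  moreover have "weight N a b q (S - {d}) (?h \<pi>) = weight N a b q S \<pi>" if \<pi>: "\<pi> \<in> ?A" for \<pi>
  proof -
    obtain f Z where "\<pi> = (f, Z)" by (cases \<pi>)
    then show ?thesis using \<pi> w[of f Z] by simp
  qed
  ultimately have "sum (weight N a b q (S - {d})) ?B = sum (weight N a b q S) ?A"
    using sum.reindex_bij_betw[of ?h ?A ?B "weight N a b q (S - {d})"] by simp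
  then show ?thesis by (simp add: gen_sum_def)
qed

lemma sum_delete_up:
  assumes S: "finite S" and k: "k \<in> S" "Suc k \<in> S" and H: "k \<in> H" "Suc k \<notin> H"
  shows "(\<Sum>\<pi> | \<pi> \<in> marked_perms S \<and> up_set S \<pi> = H \<and>
            fst \<pi> k = Suc k \<and> (fst \<pi> (Suc k) = k \<longrightarrow> k \<in> snd \<pi>). weight N a b q S \<pi>)
         = gen_sum N a b q (S - {k}) (H - {k})"
proof -
  have w: "weight N a b q (S - {k}) (Transposition.transpose k (Suc k) \<circ> f, Z - {k}) = weight N a b q S (f, Z)"
    if fZ: "(f, Z) \<in> marked_perms S" and fk: "f k = Suc k" and cyc: "f (Suc k) = k \<Longrightarrow> (k \<in> Z \<longleftrightarrow> k < Suc k)"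
      and up: "up_set S (f, Z) = H" for f Z
  proof -
    have f: "f permutes S" and inv: "\<And>a. f a \<in> Z \<longleftrightarrow> a \<in> Z"
      using fZ by (auto simp: marked_perms_def)
    have "f (Suc k) \<noteq> Suc k" using injD[OF permutes_inj[OF f], of k "Suc k"] fk by auto
    then have "f (Suc k) < Suc k" using up H(2) k by (auto simp: up_set_def)
    then interpret leaf_deletion "(<)" S f Z k "Suc k"
      using f inv fk cyc S by unfold_locales auto
    show ?thesis
    proof (rule weight_delete[where e = "Suc k"])
      show "par (<) 0 N g (Z - {k}) x = par (<) 0 N f Z x" if "x \<in> S - {k}" for x
        using that par_g by simp
      show "cycle_root (<) g (Z - {k}) x \<longleftrightarrow> cycle_root (<) f Z x" if "x \<in> S - {k}" for x
        using that cycle_root_g by simp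
      show "cycle_root (>) g (- (Z - {k})) x \<longleftrightarrow> cycle_root (>) f (- Z) x" if "x \<in> S - {k}" for x
        using that cycle_root_conversep_g unfolding conversep_less_greater by blast
      show "\<not> cycle_root (<) f Z k" by (rule not_cycle_root_d)
      show "\<not> cycle_root (>) f (- Z) k"
        using not_cycle_root_conversep_d unfolding conversep_less_greater .
      show "par (<) 0 N f Z k = Suc k" by (rule par_d)
    qed simp
  qed
  have "(\<Sum>\<pi> | \<pi> \<in> marked_perms S \<and> up_set S \<pi> = H \<and>
            fst \<pi> k = Suc k \<and> (fst \<pi> (Suc k) = k \<longrightarrow> (k \<in> snd \<pi> \<longleftrightarrow> k < Suc k)). weight N a b q S \<pi>)
         = gen_sum N a b q (S - {k}) (H - {k})"
    by (rule gen_sum_delete[OF k]) (simp, simp add: H, simp add: H, rule w)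
  then show ?thesis by simp
qed

lemma sum_delete_down:
  assumes S: "finite S" and k: "k \<in> S" "Suc k \<in> S" and H: "k \<in> H" "Suc k \<notin> H"
  shows "(\<Sum>\<pi> | \<pi> \<in> marked_perms S \<and> up_set S \<pi> = H \<and>
            fst \<pi> (Suc k) = k \<and> (fst \<pi> k = Suc k \<longrightarrow> Suc k \<notin> snd \<pi>). weight N a b q S \<pi>)
         = gen_sum N a b q (S - {Suc k}) H"
proof -
  have w: "weight N a b q (S - {Suc k}) (Transposition.transpose (Suc k) k \<circ> f, Z - {Suc k}) = weight N a b q S (f, Z)"
    if fZ: "(f, Z) \<in> marked_perms S" and fk: "f (Suc k) = k" and cyc: "f k = Suc k \<Longrightarrow> (Suc k \<in> Z \<longleftrightarrow> Suc k < k)"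
      and up: "up_set S (f, Z) = H" for f Z
  proof -
    have f: "f permutes S" and inv: "\<And>a. f a \<in> Z \<longleftrightarrow> a \<in> Z"
      using fZ by (auto simp: marked_perms_def)
    have "f k \<noteq> k" using injD[OF permutes_inj[OF f], of k "Suc k"] fk by auto
    then have "f k > k" using up H(1) k by (auto simp: up_set_def)
    then interpret leaf_deletion "(>)" S f "- Z" "Suc k" k
      using f inv fk cyc S by unfold_locales auto
    \<comment> \<open>In the reversed picture the deletion takes \<open>Suc k\<close> out of the
      complement of \<open>Z\<close>, that is, adds it to \<open>Z\<close>. For all other letters
      this has the same effect as removing it from \<open>Z\<close>.\<close>
    have Z: "- Z - {Suc k} = - insert (Suc k) Z" by auto
    have par': "par (>) N 0 h (- X) x = par (<) 0 N h X x" for h and X :: "nat set" and x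
      using par_conversep[of "(<)" N 0 h X x] by (simp add: conversep_less_greater)
    have g1: "par (<) 0 N g (insert (Suc k) Z) x = par (<) 0 N f Z x"
      "cycle_root (>) g (- insert (Suc k) Z) x \<longleftrightarrow> cycle_root (>) f (- Z) x"
      "cycle_root (<) g (insert (Suc k) Z) x \<longleftrightarrow> cycle_root (<) f Z x"
      if "x \<noteq> Suc k" for x
      using par_g[of x N 0, OF that] cycle_root_g[of x, OF that] cycle_root_conversep_g[of x, OF that]
      unfolding par' conversep_less_greater Z double_complement by this+
    have g2: "cycle_root P g (Z - {Suc k}) x \<longleftrightarrow> cycle_root P g (insert (Suc k) Z) x"
      "cycle_root P g (- (Z - {Suc k})) x \<longleftrightarrow> cycle_root P g (- insert (Suc k) Z) x"
      if "x \<noteq> Suc k" for x P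
      using that by (auto simp: cycle_root_def)
    show ?thesis
    proof (rule weight_delete[where e = k])
      fix x assume x: "x \<in> S - {Suc k}"
      have x': "x \<noteq> Suc k" using x by simp
      have "par (<) 0 N g (Z - {Suc k}) x = par (<) 0 N g (insert (Suc k) Z) x"
        unfolding par_def g2[OF x'] ..
      then show "par (<) 0 N g (Z - {Suc k}) x = par (<) 0 N f Z x"
        using g1(1)[OF x'] by simp
      show "cycle_root (<) g (Z - {Suc k}) x \<longleftrightarrow> cycle_root (<) f Z x"
        using g1(3)[of x] g2[of x] x by simp
      show "cycle_root (>) g (- (Z - {Suc k})) x \<longleftrightarrow> cycle_root (>) f (- Z) x"
        using g1(2)[of x] g2[of x] x by simp
    next
      show "\<not> cycle_root (>) f (- Z) (Suc k)" by (rule not_cycle_root_d)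
      show "\<not> cycle_root (<) f Z (Suc k)"
        using not_cycle_root_conversep_d unfolding conversep_less_greater double_complement .
      show "par (<) 0 N f Z (Suc k) = k" using par_d[of N 0] unfolding par' .
    qed simp
  qed
  have "(\<Sum>\<pi> | \<pi> \<in> marked_perms S \<and> up_set S \<pi> = H \<and>
            fst \<pi> (Suc k) = k \<and> (fst \<pi> k = Suc k \<longrightarrow> (Suc k \<in> snd \<pi> \<longleftrightarrow> Suc k < k)). weight N a b q S \<pi>)
         = gen_sum N a b q (S - {Suc k}) (H - {Suc k})"
    by (rule gen_sum_delete[OF k(2,1)]) (simp, simp add: H, simp add: H, rule w)
  moreover have "H - {Suc k} = H" using H by simp
  ultimately show ?thesis by simp
qed

section \<open>The effect of the exchange on crossings\<close>

context peak_swap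
begin

text \<open>Together with its mirror image this puts the parents of \<open>l\<close> and
  \<open>k\<close> on the far sides of the pair, which makes \<open>k\<close> and \<open>l\<close> a
  crossing before the exchange.\<close>

lemma par_l: "par P lo hi f Y l = lo \<or> P (par P lo hi f Y l) k"
proof (cases "cycle_root P f Y l")
  case False
  have ll: "f l \<noteq> l" using False l strict_totalD(1)[OF P, of l] by (auto simp: cycle_root_fixed)
  then have "\<not> cycle_root P\<inverse>\<inverse> f (- Y) l"
    using fl orbit.base[of f l] strict_totalD(4)[OF P, of "f l" l] by (auto simp: cycle_root_def)
  then show ?thesis using False run_parent_l(2)[OF ll] by (simp add: par_def)
qed (simp add: par_def)

text \<open>A downward run passes through \<open>l\<close> without stopping. This protects the
  crossings other than the one formed by \<open>k\<close> and \<open>l\<close>.\<close>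

lemma par_ne_l:
  assumes "lo \<noteq> l" "hi \<noteq> l" "a \<noteq> l" "P (par P lo hi f Y a) a"
  shows "par P lo hi f Y a \<noteq> l"
proof
  assume eq: "par P lo hi f Y a = l"
  have nr: "\<not> cycle_root P f Y a" "\<not> cycle_root P\<inverse>\<inverse> f (- Y) a"
    using eq assms(1,2) unfolding par_def by (auto split: if_splits)
  then have rp: "run_parent P f a = l" and fa: "f a \<noteq> a" using eq by (auto simp: par_def cycle_root_fixed)
  show False
  proof (cases "P (f a) a")
    case True
    then show False using run_parent_ne_l[OF True assms(3)] rp by simp
  next
    case False
    then have "P\<inverse>\<inverse> (f a) a" using fa strict_totalD(3)[OF P, of a "f a"] by auto
    from run_parent_down(3)[OF strict_total_conversep[OF P] f S this]
    have "P\<inverse>\<inverse> (run_parent P f a) a" unfolding run_parent_conversep[of P f a, OF P fa] .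
    then show False using rp eq assms(4) strict_totalD(4)[OF P, of a l] by simp
  qed
qed

end

abbreviation swap_conj :: "nat \<Rightarrow> (nat \<Rightarrow> nat) \<times> nat set \<Rightarrow> (nat \<Rightarrow> nat) \<times> nat set" where
  "swap_conj k \<equiv> \<lambda>(f, Z).
     (Transposition.transpose k (Suc k) \<circ> f \<circ> Transposition.transpose k (Suc k),
      Transposition.transpose k (Suc k) ` Z)"

lemma swap_conj_swap_conj: "swap_conj k (swap_conj k \<pi>) = \<pi>"
  by (cases \<pi>) (simp add: fun_eq_iff image_image)

lemma swap_conj_marked_perms:
  assumes "\<pi> \<in> marked_perms S"
  shows "swap_conj k \<pi> \<in> marked_perms (Transposition.transpose k (Suc k) ` S)"
proof -
  let ?t = "Transposition.transpose k (Suc k)"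
  obtain f Z where \<pi>: "\<pi> = (f, Z)" and f: "f permutes S" and Z: "Z \<subseteq> S" "\<And>a. f a \<in> Z \<longleftrightarrow> a \<in> Z"
    using assms unfolding marked_perms_def by blast
  have mem: "?t x \<in> X \<longleftrightarrow> x \<in> ?t ` X" for x X
    by (metis image_iff transpose_involutory)
  have "?t \<circ> f \<circ> ?t permutes ?t ` S"
  proof (rule bij_imp_permutes)
    have 1: "bij_betw ?t (?t ` S) S" "bij_betw ?t S (?t ` S)"
      by (auto intro!: bij_betw_byWitness[where f' = ?t])
    show "bij_betw (?t \<circ> f \<circ> ?t) (?t ` S) (?t ` S)"
      using bij_betw_trans[OF bij_betw_trans[OF 1(1) permutes_imp_bij[OF f]] 1(2)] by (simp add: comp_assoc)
    fix x assume "x \<notin> ?t ` S"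
    then have "?t x \<notin> S" using mem by blast
    then show "(?t \<circ> f \<circ> ?t) x = x" using f by (simp add: permutes_not_in)
  qed
  moreover have "(?t \<circ> f \<circ> ?t) a \<in> ?t ` Z \<longleftrightarrow> a \<in> ?t ` Z" for a
    using Z(2)[of "?t a"] mem[of a Z] by (simp add: inj_image_mem_iff)
  ultimately show ?thesis unfolding \<pi> prod.case marked_perms_def using Z(1) by blast
qed

lemma transpose_image_both:
  "a \<in> S \<Longrightarrow> b \<in> S \<Longrightarrow> Transposition.transpose a b ` S = S"
  by (simp add: permutes_image permutes_swap_id)

lemma transpose_Suc_less:
  assumes "\<not> (x = k \<and> y = Suc k)" "\<not> (x = Suc k \<and> y = k)"
  shows "Transposition.transpose k (Suc k) x < Transposition.transpose k (Suc k) y \<longleftrightarrow> x < y"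
  using assms by (auto simp: Transposition.transpose_def)

text \<open>The pair \<open>(k, Suc k)\<close> is lost because its letters change order. Elsewhere a
  comparison between a letter and a parent can flip only if these are \<open>k\<close> and
  \<open>Suc k\<close>; then either \<open>down\<close> or \<open>up\<close> is violated, or the
  pair fails on both sides because the parents of \<open>k\<close> and \<open>Suc k\<close> lie on
  the far sides.\<close>

lemma crossings_swap:
  fixes p p' :: "nat \<Rightarrow> nat"
  assumes S: "finite S" and k: "k \<in> S" "Suc k \<in> S"
    and p': "\<And>a. p' (Transposition.transpose k (Suc k) a) = Transposition.transpose k (Suc k) (p a)"
    and pk: "p k > Suc k" "p (Suc k) < k"
    and down: "\<And>j. j \<in> S \<Longrightarrow> j \<noteq> Suc k \<Longrightarrow> p j < j \<Longrightarrow> p j \<noteq> Suc k"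
    and up: "\<And>i. i \<in> S \<Longrightarrow> i \<noteq> k \<Longrightarrow> i < p i \<Longrightarrow> p i \<noteq> k"
  shows "card (crossings S p) = Suc (card (crossings S p'))"
proof -
  let ?t = "Transposition.transpose k (Suc k)"
  have tS: "?t x \<in> S \<longleftrightarrow> x \<in> S" for x using k by (auto simp: Transposition.transpose_def)
  have iff: "(?t i, ?t j) \<in> crossings S p' \<longleftrightarrow> (i, j) \<in> crossings S p \<and> (i, j) \<noteq> (k, Suc k)" for i j
  proof (cases "(i, j) = (k, Suc k) \<or> (i, j) = (Suc k, k)")
    case True
    then show ?thesis using pk by (auto simp: crossings_def p')
  next
    case False
    then have ij: "?t i < ?t j \<longleftrightarrow> i < j" by (intro transpose_Suc_less) auto
    have "?t i \<in> S \<and> ?t j \<in> S \<and> i < j \<and> ?t (p j) < ?t i \<and> ?t j < ?t (p i) \<longleftrightarrow>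
        i \<in> S \<and> j \<in> S \<and> i < j \<and> p j < i \<and> j < p i"
    proof (cases "i \<in> S \<and> j \<in> S \<and> i < j")
      case T: True
      show ?thesis
      proof (cases "(p j = k \<and> i = Suc k) \<or> (p j = Suc k \<and> i = k) \<or>
          (j = k \<and> p i = Suc k) \<or> (j = Suc k \<and> p i = k)")
        case True
        then consider "p j = k" "i = Suc k" | "p j = Suc k" "i = k" | "j = k" "p i = Suc k" | "j = Suc k" "p i = k"
          by blast
        then show ?thesis
        proof cases
          case 1
          then have "p i < k" "?t (p i) < k" using pk by auto
          then show ?thesis using 1 T pk tS by (auto simp: Transposition.transpose_def split: if_splits)
        next
          case 2
          then have "j > Suc k" using T False by auto
          then have "p j \<noteq> Suc k" using down[of j] T 2 by auto
          then show ?thesis using 2 by simp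
        next
          case 3
          then show ?thesis using T pk tS by (auto simp: Transposition.transpose_def)
        next
          case 4
          then have "i < k" using T False by auto
          then have "p i \<noteq> k" using up[of i] T 4 by auto
          then show ?thesis using 4 by simp
        qed
      next
        case N: False
        have "?t (p j) < ?t i \<longleftrightarrow> p j < i" by (rule transpose_Suc_less) (use N in auto)
        moreover have "?t j < ?t (p i) \<longleftrightarrow> j < p i" by (rule transpose_Suc_less) (use N in auto)
        ultimately show ?thesis using tS by simp
      qed
    qed (use tS in auto)
    then show ?thesis using ij False by (auto simp: crossings_def p')
  qed
  have "crossings S p = insert (k, Suc k) (map_prod ?t ?t ` crossings S p')" (is "_ = insert _ ?I")
  proof (intro set_eqI)
    fix x :: "nat \<times> nat"
    obtain i j where x: "x = (i, j)" by (cases x)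
    have "x \<in> ?I \<longleftrightarrow> (?t i, ?t j) \<in> crossings S p'"
    proof
      assume "(?t i, ?t j) \<in> crossings S p'"
      then have "map_prod ?t ?t (?t i, ?t j) \<in> ?I" by blast
      then show "x \<in> ?I" by (simp add: x)
    qed (auto simp: x)
    moreover have "(k, Suc k) \<in> crossings S p" using k pk by (auto simp: crossings_def)
    ultimately show "x \<in> crossings S p \<longleftrightarrow> x \<in> insert (k, Suc k) ?I" using iff[of i j] x by auto
  qed
  moreover have "(k, Suc k) \<notin> ?I"
  proof
    assume "(k, Suc k) \<in> ?I"
    then obtain i j where ij: "(i, j) \<in> crossings S p'" "?t i = k" "?t j = Suc k" by auto
    then have "(?t k, ?t (Suc k)) \<in> crossings S p'" by (metis transpose_involutory)
    then show False using iff[of k "Suc k"] by simp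
  qed
  moreover have "card ?I = card (crossings S p')"
    by (rule card_image) (auto intro!: inj_onI dest: injD[OF inj_transpose])
  moreover have "finite ?I" using finite_crossings[OF S] by blast
  ultimately show ?thesis by simp
qed

lemma up_set_swap_conj:
  assumes "(f, Z) \<in> marked_perms S" and k: "k \<in> S" "Suc k \<in> S"
    and fk: "k < f k \<and> f k \<noteq> Suc k \<or> f k = k \<and> k \<notin> Z"
    and fl: "f (Suc k) < Suc k \<and> f (Suc k) \<noteq> k \<or> f (Suc k) = Suc k \<and> Suc k \<in> Z"
  shows "up_set S (swap_conj k (f, Z)) = insert (Suc k) (up_set S (f, Z) - {k})"
    and "k \<in> up_set S (f, Z)" and "Suc k \<notin> up_set S (f, Z)"
proof -
  let ?t = "Transposition.transpose k (Suc k)"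
  have mem: "x \<in> ?t ` Z \<longleftrightarrow> ?t x \<in> Z" for x
    by (metis image_iff transpose_involutory)
  show "k \<in> up_set S (f, Z)" "Suc k \<notin> up_set S (f, Z)" using fk fl k by (auto simp: up_set_def)
  have "x \<in> up_set S (swap_conj k (f, Z)) \<longleftrightarrow> x \<in> insert (Suc k) (up_set S (f, Z) - {k})" for x
  proof -
    have x: "x \<in> up_set S (swap_conj k (f, Z)) \<longleftrightarrow> x \<in> S \<and> (x < ?t (f (?t x)) \<or> ?t (f (?t x)) = x \<and> ?t x \<notin> Z)"
      by (simp add: up_set_def mem)
    consider "x = k" | "x = Suc k" | "x \<noteq> k" "x \<noteq> Suc k" by blast
    then show ?thesis
    proof cases
      case 1
      have "\<not> (k < ?t (f (Suc k)) \<or> ?t (f (Suc k)) = k \<and> Suc k \<notin> Z)"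
        using fl by (auto simp: Transposition.transpose_def)
      then show ?thesis using x 1 by simp
    next
      case 2
      have "Suc k < ?t (f k) \<or> ?t (f k) = Suc k \<and> k \<notin> Z"
        using fk by (auto simp: Transposition.transpose_def)
      then show ?thesis using x 2 k by simp
    next
      case 3
      then have "(x < ?t (f x) \<or> ?t (f x) = x \<and> x \<notin> Z) \<longleftrightarrow> (x < f x \<or> f x = x \<and> x \<notin> Z)"
        by (auto simp: Transposition.transpose_def)
      then show ?thesis using x 3 by (simp add: up_set_def)
    qed
  qed
  then show "up_set S (swap_conj k (f, Z)) = insert (Suc k) (up_set S (f, Z) - {k})" by blast
qed

lemma weight_swap_conj:
  assumes S: "finite S" "S \<subseteq> {1..<N}" and fZ: "(f, Z) \<in> marked_perms S" and k: "k \<in> S" "Suc k \<in> S"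
    and fk: "k < f k \<and> f k \<noteq> Suc k \<or> f k = k \<and> k \<notin> Z"
    and fl: "f (Suc k) < Suc k \<and> f (Suc k) \<noteq> k \<or> f (Suc k) = Suc k \<and> Suc k \<in> Z"
  shows "weight N a b q S (f, Z) = q * weight N a b q S (swap_conj k (f, Z))"
proof -
  have f: "f permutes S" and inv: "\<And>a. f a \<in> Z \<longleftrightarrow> a \<in> Z"
    using fZ by (auto simp: marked_perms_def)
  interpret A: peak_swap "(<)" S f Z k "Suc k"
    using f inv S fk fl by unfold_locales auto
  interpret B: peak_swap "(>)" S f "- Z" "Suc k" k
    using A.dual unfolding conversep_less_greater .
  have par': "par (>) N 0 f (- Z) x = par (<) 0 N f Z x" for x
    using par_conversep[of "(<)" N 0 f Z x] by (simp add: conversep_less_greater)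
  let ?p = "par (<) 0 N f Z" and ?p' = "par (<) 0 N A.g (A.t ` Z)"
  have bounds: "0 < k" "Suc k < N" using S k by auto
  have "card (crossings S ?p) = Suc (card (crossings S ?p'))"
  proof (rule crossings_swap[OF S(1) k])
    show "?p' (A.t x) = A.t (?p x)" for x
      by (rule A.par_g) (use bounds in auto)
    show "?p k > Suc k" using B.par_l[of N 0] bounds unfolding par' by auto
    show "?p (Suc k) < k" using A.par_l[of 0 N] bounds by auto
    show "?p j \<noteq> Suc k" if "j \<noteq> Suc k" "?p j < j" for j
      using A.par_ne_l[of 0 N j] that bounds by auto
    show "?p i \<noteq> k" if "i \<noteq> k" "i < ?p i" for i
      using B.par_ne_l[of N 0 i] that bounds unfolding par' by auto
  qed
  moreover have im: "card {x \<in> S. R' x} = card {x \<in> S. R x}" if "\<And>x. R' (A.t x) \<longleftrightarrow> R x" for R R'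
  proof -
    have "bij_betw A.t S S" using k by (metis permutes_imp_bij permutes_swap_id)
    then have "bij_betw A.t {x \<in> S. R x} {x \<in> S. R' x}"
      by (rule bij_betw_Collect) (rule that)
    then show ?thesis by (rule bij_betw_same_card[symmetric])
  qed
  have "card {x \<in> S. cycle_root (<) A.g (A.t ` Z) x} = card {x \<in> S. cycle_root (<) f Z x}"
    by (rule im) (rule A.cycle_root_g)
  moreover have "card {x \<in> S. cycle_root (>) A.g (- (A.t ` Z)) x} = card {x \<in> S. cycle_root (>) f (- Z) x}"
    by (rule im) (use A.cycle_root_conversep_g in \<open>unfold conversep_less_greater\<close>)
  ultimately show ?thesis by (simp add: weight_def)
qed

text \<open>No condition on images remains on the right: where \<open>k\<close> goes down and
  \<open>Suc k\<close> goes up, neither can be mapped to the other, so the exchange is onto.\<close>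

lemma sum_swap:
  assumes S: "finite S" "S \<subseteq> {1..<N}" and k: "k \<in> S" "Suc k \<in> S" and H: "k \<in> H" "Suc k \<notin> H"
  shows "(\<Sum>\<pi> | \<pi> \<in> marked_perms S \<and> up_set S \<pi> = H \<and>
            fst \<pi> k \<noteq> Suc k \<and> fst \<pi> (Suc k) \<noteq> k. weight N a b q S \<pi>)
         = q * gen_sum N a b q S (insert (Suc k) (H - {k}))"
    (is "sum _ ?A = _ * gen_sum _ _ _ _ _ ?H")
proof -
  let ?C = "\<lambda>f Z. (k < f k \<and> f k \<noteq> Suc k \<or> f k = k \<and> k \<notin> Z) \<and>
     (f (Suc k) < Suc k \<and> f (Suc k) \<noteq> k \<or> f (Suc k) = Suc k \<and> Suc k \<in> Z)"
  let ?B = "{\<pi>. \<pi> \<in> marked_perms S \<and> up_set S \<pi> = ?H}"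
  have tS: "Transposition.transpose k (Suc k) ` S = S" by (rule transpose_image_both[OF k])
  have A: "\<exists>f Z. \<pi> = (f, Z) \<and> \<pi> \<in> marked_perms S \<and> ?C f Z \<and> up_set S \<pi> = H" if \<pi>: "\<pi> \<in> ?A" for \<pi>
  proof -
    obtain f Z where fZ: "\<pi> = (f, Z)" by (cases \<pi>)
    have "k \<in> up_set S (f, Z)" "Suc k \<notin> up_set S (f, Z)" using \<pi> H fZ by auto
    then have "?C f Z" using \<pi> fZ k by (auto simp: up_set_def)
    then show ?thesis using \<pi> fZ by blast
  qed
  have "sum (weight N a b q S) ?A = sum (\<lambda>\<pi>. q * weight N a b q S \<pi>) ?B"
  proof (rule sum.reindex_bij_witness[of _ "swap_conj k" "swap_conj k"])
    fix \<pi> assume "\<pi> \<in> ?A"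
    from A[OF this] obtain f Z where
      fZ: "\<pi> = (f, Z)" "(f, Z) \<in> marked_perms S" "?C f Z" "up_set S (f, Z) = H" by blast
    show "swap_conj k \<pi> \<in> ?B"
      using swap_conj_marked_perms[OF fZ(2), of k] up_set_swap_conj(1)[OF fZ(2) k] fZ
      unfolding tS by simp
    show "q * weight N a b q S (swap_conj k \<pi>) = weight N a b q S \<pi>"
      using weight_swap_conj[OF S fZ(2) k, of a b q] fZ by simp
  next
    fix \<pi> assume \<pi>: "\<pi> \<in> ?B"
    obtain g Z where gZ: "swap_conj k \<pi> = (g, Z)" by (cases "swap_conj k \<pi>")
    have mem: "(g, Z) \<in> marked_perms S"
      using swap_conj_marked_perms[of \<pi> S k] \<pi> gZ unfolding tS by simp
    have up: "k \<notin> up_set S \<pi>" "Suc k \<in> up_set S \<pi>" using \<pi> by auto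
    have C: "?C g Z"
    proof -
      let ?t = "Transposition.transpose k (Suc k)"
      obtain f Y where fY: "\<pi> = (f, Y)" by (cases \<pi>)
      have m: "x \<in> ?t ` Y \<longleftrightarrow> ?t x \<in> Y" for x
        by (metis image_iff transpose_involutory)
      have gg: "g x = ?t (f (?t x))" "x \<in> Z \<longleftrightarrow> ?t x \<in> Y" for x using gZ fY m by auto
      have 1: "Suc k < f (Suc k) \<or> f (Suc k) = Suc k \<and> Suc k \<notin> Y"
        using up(2) fY by (auto simp: up_set_def)
      have 2: "f k < k \<or> f k = k \<and> k \<in> Y"
        using up(1) fY k by (auto simp: up_set_def)
      show ?thesis using 1 2 by (auto simp: gg Transposition.transpose_def)
    qed
    have "up_set S \<pi> = insert (Suc k) (up_set S (g, Z) - {k})"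
      using up_set_swap_conj(1)[OF mem k] C swap_conj_swap_conj[of k \<pi>] unfolding gZ by simp
    then have "up_set S (g, Z) = H"
      using up_set_swap_conj(2,3)[OF mem k] C \<pi> H by (simp add: insert_eq_iff) blast
    then show "swap_conj k \<pi> \<in> ?A" using mem C by (auto simp: gZ)
  qed (simp_all only: swap_conj_swap_conj)
  then show ?thesis by (simp add: gen_sum_def sum_distrib_left)
qed

text \<open>With D for a letter in \<open>H\<close> and E for a letter outside, the terms at the
  places \<open>k\<close> and \<open>Suc k\<close> are DE on the left and q ED, E, D on the right,
  in this order.\<close>

theorem gen_sum_peak:
  assumes S: "finite S" "S \<subseteq> {1..<N}" and k: "k \<in> S" "Suc k \<in> S" and H: "k \<in> H" "Suc k \<notin> H"
  shows "gen_sum N a b q S H = q * gen_sum N a b q S (insert (Suc k) (H - {k}))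
     + gen_sum N a b q (S - {k}) (H - {k}) + gen_sum N a b q (S - {Suc k}) H"
proof -
  \<comment> \<open>The two-cycle on \<open>k\<close> and \<open>Suc k\<close> meets both conditions
    on images; it is counted in \<open>?A\<close> if it lies in the marked part and in
    \<open>?B\<close> otherwise.\<close>
  let ?A = "{\<pi>. \<pi> \<in> marked_perms S \<and> up_set S \<pi> = H \<and>
            fst \<pi> k = Suc k \<and> (fst \<pi> (Suc k) = k \<longrightarrow> k \<in> snd \<pi>)}"
  let ?B = "{\<pi>. \<pi> \<in> marked_perms S \<and> up_set S \<pi> = H \<and>
            fst \<pi> (Suc k) = k \<and> (fst \<pi> k = Suc k \<longrightarrow> Suc k \<notin> snd \<pi>)}"
  let ?C = "{\<pi>. \<pi> \<in> marked_perms S \<and> up_set S \<pi> = H \<and>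
            fst \<pi> k \<noteq> Suc k \<and> fst \<pi> (Suc k) \<noteq> k}"
  have fin: "finite ?A" "finite ?B" "finite ?C"
    using finite_marked_perms[OF S(1)] by (auto intro: finite_subset[rotated])
  have inv: "k \<in> snd \<pi> \<longleftrightarrow> Suc k \<in> snd \<pi>" if "\<pi> \<in> marked_perms S" "fst \<pi> k = Suc k" for \<pi>
  proof -
    obtain f Z where "\<pi> = (f, Z)" by (cases \<pi>)
    then have "\<forall>x. f x \<in> Z \<longleftrightarrow> x \<in> Z" "f k = Suc k" using that by (simp_all add: marked_perms_def)
    then have "k \<in> Z \<longleftrightarrow> Suc k \<in> Z" by metis
    then show ?thesis using \<open>\<pi> = (f, Z)\<close> by simp
  qed
  have "{\<pi>. \<pi> \<in> marked_perms S \<and> up_set S \<pi> = H} = ?A \<union> ?B \<union> ?C" using inv by auto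
  moreover have "(?A \<union> ?B) \<inter> ?C = {}" "?A \<inter> ?B = {}" using inv by auto
  ultimately have "gen_sum N a b q S H =
      sum (weight N a b q S) ?A + sum (weight N a b q S) ?B + sum (weight N a b q S) ?C"
    using fin by (simp add: gen_sum_def sum.union_disjoint)
  then show ?thesis
    using sum_delete_up[OF S(1) k H] sum_delete_down[OF S(1) k H] sum_swap[OF S k H] by simp
qed

section \<open>Boundary letters and relabelling\<close>

lemma cycle_root_remove:
  assumes "x \<noteq> s"
  shows "cycle_root P f (Z - {s}) x \<longleftrightarrow> cycle_root P f Z x"
    and "cycle_root P f (- (Z - {s})) x \<longleftrightarrow> cycle_root P f (- Z) x"
  using assms by (auto simp: cycle_root_def)

lemma par_remove:
  assumes "x \<noteq> s"
  shows "par P lo hi f (Z - {s}) x = par P lo hi f Z x"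
  unfolding par_def cycle_root_remove[OF assms] ..

lemma par_in:
  assumes P: "strict_total P" and f: "f permutes S" "finite S" and a: "a \<in> S"
  shows "par P lo hi f Y a \<in> insert lo (insert hi S)"
proof (cases "cycle_root P f Y a \<or> cycle_root P\<inverse>\<inverse> f (- Y) a")
  case False
  then have fa: "f a \<noteq> a" by (auto simp: cycle_root_fixed)
  have sub: "reach Q f a \<subseteq> S" for Q
    using reach_subset_orbit orbit_subset_permutes[OF f(1) a] by (rule order_trans)
  have "run_parent P f a \<in> S"
  proof (cases "P (f a) a")
    case True
    then show ?thesis using run_parent_down(1)[OF P f True] sub by blast
  next
    case F: False
    then have "P\<inverse>\<inverse> (f a) a" using strict_totalD(3)[OF P, of a "f a"] fa by auto
    from run_parent_down(1)[OF strict_total_conversep[OF P] f this] show ?thesis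
      unfolding run_parent_conversep[of P f a, OF P fa] using sub by blast
  qed
  then show ?thesis by (simp add: par_def)
qed (auto simp: par_def)

text \<open>A smallest letter with parent \<open>0\<close> and a largest letter with parent
  \<open>N\<close> have no possible partner in a crossing, so only the factor of the one-element
  cycle is lost.\<close>

lemma weight_remove_fixed:
  assumes S: "finite S" "S \<subseteq> {1..<N}" and s: "s \<in> S" and fs: "f s = s"
    and ext: "\<And>x. x \<in> S \<Longrightarrow> if s \<in> Z then s \<le> x else x \<le> s"
  shows "weight N a b q S (f, Z) =
    (if s \<in> Z then a else b) * weight N a b q (S - {s}) (f, Z - {s})"
proof -
  have fin: "finite {x \<in> S - {s}. R x}" for R using S by simp
  have sN: "0 < s" "s < N" using s S by auto
  have "{x \<in> S. cycle_root (<) f Z x} =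
      (if s \<in> Z then insert s else id) {x \<in> S - {s}. cycle_root (<) f (Z - {s}) x}"
    using s fs by (auto simp: cycle_root_remove cycle_root_fixed)
  then have z: "card {x \<in> S. cycle_root (<) f Z x} =
      (if s \<in> Z then Suc else id) (card {x \<in> S - {s}. cycle_root (<) f (Z - {s}) x})"
    using fin[of "cycle_root (<) f (Z - {s})"] by simp
  have "{x \<in> S. cycle_root (>) f (- Z) x} =
      (if s \<in> Z then id else insert s) {x \<in> S - {s}. cycle_root (>) f (- (Z - {s})) x}"
  proof (rule set_eqI)
    fix x
    show "x \<in> {x \<in> S. cycle_root (>) f (- Z) x} \<longleftrightarrow>
      x \<in> (if s \<in> Z then id else insert s) {x \<in> S - {s}. cycle_root (>) f (- (Z - {s})) x}"
    proof (cases "x = s")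
      case True
      then show ?thesis using s fs by (simp add: cycle_root_fixed)
    next
      case False
      show ?thesis unfolding mem_Collect_eq using cycle_root_remove(2)[OF False, of "(>)" f Z] False
        by (auto simp del: Compl_Diff_eq)
    qed
  qed
  then have n: "card {x \<in> S. cycle_root (>) f (- Z) x} =
      (if s \<in> Z then id else Suc) (card {x \<in> S - {s}. cycle_root (>) f (- (Z - {s})) x})"
    using card_insert_disjoint[OF fin, of s "cycle_root (>) f (- (Z - {s}))"] by simp
  have ps: "par (<) 0 N f Z s = (if s \<in> Z then 0 else N)"
    using fs by (simp add: par_def cycle_root_fixed)
  have "crossings S (par (<) 0 N f Z) = crossings (S - {s}) (par (<) 0 N f Z)"
  proof -
    have "i \<noteq> s \<and> j \<noteq> s" if "(i, j) \<in> crossings S (par (<) 0 N f Z)" for i j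
      using that ps sN S ext[of i] ext[of j] by (fastforce simp: crossings_def split: if_splits)
    then show ?thesis by (auto simp: crossings_def)
  qed
  also have "\<dots> = crossings (S - {s}) (par (<) 0 N f (Z - {s}))"
    by (rule crossings_cong) (simp add: par_remove)
  finally show ?thesis using z n by (simp add: weight_def del: Compl_Diff_eq)
qed

text \<open>The largest letter can be up, and the smallest down, only as a fixed point on the
  matching side of \<open>Z\<close>. These are the boundary relations D V = b V and W E = a W of the
  ansatz.\<close>

lemma gen_sum_remove_fixed:
  assumes S: "finite S" "S \<subseteq> {1..<N}" and s: "s \<in> S" and H: "H \<subseteq> S"
    and ext: "\<And>x. x \<in> S \<Longrightarrow> if s \<in> H then x \<le> s else s \<le> x"
  shows "gen_sum N a b q S H = (if s \<in> H then b else a) * gen_sum N a b q (S - {s}) (H - {s})"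
proof -
  let ?A = "{\<pi>. \<pi> \<in> marked_perms S \<and> up_set S \<pi> = H}"
  let ?B = "{\<pi>. \<pi> \<in> marked_perms (S - {s}) \<and> up_set (S - {s}) \<pi> = H - {s}}"
  let ?j = "\<lambda>(f :: nat \<Rightarrow> nat, Z). (f, Z - {s})"
  let ?i = "\<lambda>(f :: nat \<Rightarrow> nat, Z). (f, if s \<in> H then Z else insert s Z)"
  have A: "\<exists>f Z. \<pi> = (f, Z) \<and> f s = s \<and> (s \<in> Z \<longleftrightarrow> s \<notin> H) \<and> f permutes S \<and> Z \<subseteq> S
      \<and> (\<forall>a. f a \<in> Z \<longleftrightarrow> a \<in> Z) \<and> up_set S (f, Z) = H" if \<pi>: "\<pi> \<in> ?A" for \<pi>
  proof -
    obtain f Z where fZ: "\<pi> = (f, Z)" by (cases \<pi>)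
    have f: "f permutes S" using \<pi> fZ by (simp add: marked_perms_def)
    then have fS: "f s \<in> S" using s by (simp add: permutes_in_image)
    have "s \<in> up_set S (f, Z) \<longleftrightarrow> s \<in> H" using \<pi> fZ by simp
    then have "f s = s \<and> (s \<in> Z \<longleftrightarrow> s \<notin> H)"
      using ext[OF fS] s by (auto simp: up_set_def split: if_splits)
    then show ?thesis using \<pi> fZ by (auto simp: marked_perms_def)
  qed
  have "sum (weight N a b q S) ?A =
      sum (\<lambda>\<pi>. (if s \<in> H then b else a) * weight N a b q (S - {s}) \<pi>) ?B"
  proof (rule sum.reindex_bij_witness[of _ ?i ?j])
    fix \<pi> assume "\<pi> \<in> ?A"
    from A[OF this] obtain f Z where \<pi>: "\<pi> = (f, Z)" and fs: "f s = s" "s \<in> Z \<longleftrightarrow> s \<notin> H"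
      and f: "f permutes S" and Z: "Z \<subseteq> S" "\<And>a. f a \<in> Z \<longleftrightarrow> a \<in> Z" and up: "up_set S (f, Z) = H"
      by blast
    show "?i (?j \<pi>) = \<pi>" using fs by (auto simp: \<pi>)
    have "f permutes S - {s}" by (rule permutes_superset[OF f]) (use fs in auto)
    moreover have "f a \<in> Z - {s} \<longleftrightarrow> a \<in> Z - {s}" for a
    proof -
      have "f a = s \<longleftrightarrow> a = s" using fs(1) permutes_inj[OF f] by (metis injD)
      then show ?thesis using Z(2)[of a] by auto
    qed
    ultimately have "(f, Z - {s}) \<in> marked_perms (S - {s})"
      using Z(1) unfolding marked_perms_def by blast
    moreover have "up_set (S - {s}) (f, Z - {s}) = H - {s}"
      unfolding up[symmetric] by (auto simp: up_set_def)
    ultimately show "?j \<pi> \<in> ?B" by (simp add: \<pi>)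
    have "if s \<in> Z then s \<le> x else x \<le> s" if "x \<in> S" for x using ext[OF that] fs(2) by simp
    from weight_remove_fixed[where f = f and Z = Z, OF S s fs(1) this]
    show "(if s \<in> H then b else a) * weight N a b q (S - {s}) (?j \<pi>) = weight N a b q S \<pi>"
      using fs(2) by (simp add: \<pi>)
  next
    fix \<pi> assume "\<pi> \<in> ?B"
    then obtain f Z where \<pi>: "\<pi> = (f, Z)" and f: "f permutes S - {s}"
      and Z: "Z \<subseteq> S - {s}" "\<And>a. f a \<in> Z \<longleftrightarrow> a \<in> Z" and up: "up_set (S - {s}) (f, Z) = H - {s}"
      by (cases \<pi>) (auto simp: marked_perms_def)
    show "?j (?i \<pi>) = \<pi>" using Z(1) by (auto simp: \<pi>)
    have fs: "f s = s" using f by (simp add: permutes_def)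
    let ?Z = "if s \<in> H then Z else insert s Z"
    have "f permutes S" using f by (rule permutes_subset) auto
    moreover have "f a \<in> ?Z \<longleftrightarrow> a \<in> ?Z" for a
    proof -
      have "f a = s \<longleftrightarrow> a = s" using fs(1) permutes_inj[OF f] by (metis injD)
      then show ?thesis using Z(2)[of a] by auto
    qed
    ultimately have "(f, ?Z) \<in> marked_perms S"
      using Z(1) s unfolding marked_perms_def by auto
    moreover have "up_set S (f, ?Z) = H"
    proof (rule set_eqI)
      fix x
      have "x \<in> up_set (S - {s}) (f, Z) \<longleftrightarrow> x \<in> H - {s}" using up by simp
      then show "x \<in> up_set S (f, ?Z) \<longleftrightarrow> x \<in> H"
        using fs Z(1) s by (cases "x = s") (auto simp: up_set_def)
    qed
    ultimately show "?i \<pi> \<in> ?A" by (simp add: \<pi>)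
  qed
  then show ?thesis by (simp add: gen_sum_def sum_distrib_left)
qed

section \<open>Moving a gap by an order-preserving relabelling\<close>

lemma best_image:
  assumes P: "strict_total P" and X: "finite X" "X \<noteq> {}"
    and mono: "\<And>x y. x \<in> X \<Longrightarrow> y \<in> X \<Longrightarrow> P (h x) (h y) \<longleftrightarrow> P x y"
  shows "best P (h ` X) = h (best P X)"
proof (rule best_eqI[OF P])
  note bp = best_props[OF P X]
  show "h (best P X) \<in> h ` X" using bp(1) by blast
  fix y assume "y \<in> h ` X"
  then obtain x where x: "x \<in> X" "y = h x" by blast
  then show "y = h (best P X) \<or> P (h (best P X)) y" using bp(2)[OF x(1)] mono[OF bp(1) x(1)] by auto
qed

text \<open>Everything in question is defined by comparisons within cycles, so monotonicity on
  \<open>S\<close> suffices. Unlike in \<open>peak_swap\<close> no comparison is reversed: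
  \<open>h\<close> will be a transposition of neighbours that do not both lie in
  \<open>S\<close>.\<close>

locale order_conj =
  fixes P :: "'a \<Rightarrow> 'a \<Rightarrow> bool" and S :: "'a set" and f g h :: "'a \<Rightarrow> 'a"
  assumes P: "strict_total P" and f: "f permutes S" and S: "finite S" and h: "bij h"
    and mono: "\<And>x y. x \<in> S \<Longrightarrow> y \<in> S \<Longrightarrow> P (h x) (h y) \<longleftrightarrow> P x y"
    and g: "\<And>x. g (h x) = h (f x)"
begin

lemma dual: "order_conj P\<inverse>\<inverse> S f g h"
  by unfold_locales (use P f S h mono g in \<open>auto intro: strict_total_conversep\<close>)

lemma cycle_root_conj:
  assumes a: "a \<in> S"
  shows "cycle_root P g (h ` Y) (h a) \<longleftrightarrow> cycle_root P f Y a"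
proof -
  have "h b = h a \<or> P (h b) (h a) \<longleftrightarrow> b = a \<or> P b a" if "b \<in> orbit f a" for b
    using mono[of b a] that a orbit_subset_permutes[OF f a] bij_is_inj[OF h] by (auto dest: injD)
  then show ?thesis
    unfolding cycle_root_def orbit_conj[of g h f, OF g]
    using bij_is_inj[OF h] by (simp add: inj_image_mem_iff)
qed

lemma run_parent_down_conj:
  assumes a: "a \<in> S" and fa: "P (f a) a"
  shows "run_parent P g (h a) = h (run_parent P f a)"
proof -
  have sub: "orbit f a \<subseteq> S" by (rule orbit_subset_permutes[OF f a])
  let ?R = "reach (\<lambda>b. P b a) f a"
  have "reach (\<lambda>b. P b (h a)) g (h a) = h ` reach (\<lambda>b. P (h b) (h a)) f a"
    by (rule reach_conj) (rule g)
  also have "reach (\<lambda>b. P (h b) (h a)) f a = ?R"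
    by (rule reach_cong) (use mono a sub in blast)
  finally have R: "reach (\<lambda>b. P b (h a)) g (h a) = h ` ?R" .
  have "?R \<noteq> {}" using reach.start[of "\<lambda>b. P b a" f a, OF fa] by auto
  moreover have "?R \<subseteq> S" using reach_subset_orbit sub by (rule order_trans)
  ultimately have "best P (h ` ?R) = h (best P ?R)"
    using mono by (intro best_image P finite_reach_permutes[OF f S]) auto
  moreover have "P (g (h a)) (h a)"
    unfolding g using mono[of "f a" a] a fa f by (simp add: permutes_in_image)
  ultimately show ?thesis using fa by (simp add: run_parent_def R)
qed

lemma par_conj:
  assumes a: "a \<in> S"
  shows "par P (h lo) (h hi) g (h ` Y) (h a) = h (par P lo hi f Y a)"
proof -
  interpret D: order_conj "P\<inverse>\<inverse>" S f g h by (rule dual)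
  have Y: "- (h ` Y) = h ` (- Y)" by (rule bij_image_Compl_eq[symmetric, OF h])
  show ?thesis
  proof (cases "f a = a")
    case True
    then show ?thesis
      unfolding par_def cycle_root_conj[OF a] Y D.cycle_root_conj[OF a] by (auto simp: cycle_root_fixed)
  next
    case False
    then have ga: "g (h a) \<noteq> h a" using g bij_is_inj[OF h] by (metis injD)
    have "run_parent P g (h a) = h (run_parent P f a)"
    proof (cases "P (f a) a")
      case True
      then show ?thesis by (rule run_parent_down_conj[OF a])
    next
      case F: False
      then have "P\<inverse>\<inverse> (f a) a" using strict_totalD(3)[OF P, of a "f a"] False by auto
      from D.run_parent_down_conj[OF a this] show ?thesis
        unfolding run_parent_conversep[of P f a, OF P False] run_parent_conversep[of P g, OF P ga] .
    qed
    then show ?thesis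
      unfolding par_def cycle_root_conj[OF a] Y D.cycle_root_conj[OF a] by simp
  qed
qed

end

text \<open>A gap at one of the two places moves to the other. The bounds on \<open>k\<close> keep
  both places away from the outer labels, so the transposition fixes these and stays monotone when
  they are added to \<open>S\<close>.\<close>

lemma gen_sum_relabel:
  assumes S: "finite S" "S \<subseteq> {1..<N}" and k: "0 < k" "Suc k < N" "\<not> (k \<in> S \<and> Suc k \<in> S)"
  shows "gen_sum N a b q (Transposition.transpose k (Suc k) ` S) (Transposition.transpose k (Suc k) ` H)
    = gen_sum N a b q S H"
proof -
  let ?t = "Transposition.transpose k (Suc k)"
  have mono: "?t x < ?t y \<longleftrightarrow> x < y" if "x \<in> S" "y \<in> S" for x y
    by (rule transpose_Suc_less) (use that k in auto)
  have tt: "?t ` ?t ` X = X" for X by (simp add: image_image)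
  have main: "up_set (?t ` S) (swap_conj k (f, Z)) = ?t ` up_set S (f, Z)"
    "weight N a b q (?t ` S) (swap_conj k (f, Z)) = weight N a b q S (f, Z)"
    if fZ: "(f, Z) \<in> marked_perms S" for f Z
  proof -
    let ?g = "?t \<circ> f \<circ> ?t"
    have f: "f permutes S" using fZ by (simp add: marked_perms_def)
    interpret A: order_conj "(<)" S f ?g ?t
      using f S mono by unfold_locales auto
    interpret B: order_conj "(>)" S f ?g ?t
      using A.dual unfolding conversep_less_greater .
    have fS: "f x \<in> S" if "x \<in> S" for x using f that by (simp add: permutes_in_image)
    show "up_set (?t ` S) (swap_conj k (f, Z)) = ?t ` up_set S (f, Z)"
    proof (rule set_eqI)
      fix x
      obtain y where x: "x = ?t y" by (metis transpose_involutory)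
      have mem: "?t y \<in> ?t ` X \<longleftrightarrow> y \<in> X" for X by (simp add: inj_image_mem_iff)
      show "x \<in> up_set (?t ` S) (swap_conj k (f, Z)) \<longleftrightarrow> x \<in> ?t ` up_set S (f, Z)"
        unfolding x mem using mono[of y "f y"] fS[of y]
        by (auto simp: up_set_def mem dest: injD[OF inj_transpose])
    qed
    have im: "card {x \<in> ?t ` S. R' x} = card {x \<in> S. R x}"
      if "\<And>x. x \<in> S \<Longrightarrow> R' (?t x) \<longleftrightarrow> R x" for R R'
    proof -
      have "{x \<in> ?t ` S. R' x} = ?t ` {x \<in> S. R x}" using that by auto
      then show ?thesis by (simp add: card_image inj_on_subset[OF inj_transpose])
    qed
    have 1: "card {x \<in> ?t ` S. cycle_root (<) ?g (?t ` Z) x} = card {x \<in> S. cycle_root (<) f Z x}"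
      by (rule im) (rule A.cycle_root_conj)
    have "- (?t ` Z) = ?t ` (- Z)" by (rule bij_image_Compl_eq[symmetric]) simp
    then have 2: "card {x \<in> ?t ` S. cycle_root (>) ?g (- (?t ` Z)) x} = card {x \<in> S. cycle_root (>) f (- Z) x}"
      using im B.cycle_root_conj by simp
    let ?p = "par (<) 0 N f Z" and ?p' = "par (<) 0 N ?g (?t ` Z)"
    have p': "?p' (?t x) = ?t (?p x)" if "x \<in> S" for x
      using A.par_conj[OF that, of 0 N Z] k by simp
    have tless: "?t x < ?t y \<longleftrightarrow> x < y"
      if "x \<in> insert 0 (insert N S)" "y \<in> insert 0 (insert N S)" for x y
      by (rule transpose_Suc_less) (use that k in auto)
    have pS: "?p x \<in> insert 0 (insert N S)" if "x \<in> S" for x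
      using par_in[OF strict_total_less f S(1) that] .
    have iff: "(?t i, ?t j) \<in> crossings (?t ` S) ?p' \<longleftrightarrow> (i, j) \<in> crossings S ?p"
      if "i \<in> S" "j \<in> S" for i j
      using that tless[of i j] tless[OF pS[OF that(2)], of i] tless[OF _ pS[OF that(1)], of j]
      by (simp add: crossings_def p')
    have "crossings (?t ` S) ?p' = map_prod ?t ?t ` crossings S ?p"
    proof (intro set_eqI iffI)
      fix x assume x: "x \<in> crossings (?t ` S) ?p'"
      then obtain i j where ij: "i \<in> S" "j \<in> S" "x = (?t i, ?t j)" by (auto simp: crossings_def)
      then have "(i, j) \<in> crossings S ?p" using iff x by blast
      then show "x \<in> map_prod ?t ?t ` crossings S ?p" using ij(3) by force
    next
      fix x assume "x \<in> map_prod ?t ?t ` crossings S ?p"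
      then obtain i j where ij: "(i, j) \<in> crossings S ?p" "x = (?t i, ?t j)" by auto
      then have "i \<in> S" "j \<in> S" by (auto simp: crossings_def)
      then show "x \<in> crossings (?t ` S) ?p'" using iff ij by blast
    qed
    then have 3: "card (crossings (?t ` S) ?p') = card (crossings S ?p)"
      by (simp only:) (rule card_image, auto intro!: inj_onI dest: injD[OF inj_transpose])
    show "weight N a b q (?t ` S) (swap_conj k (f, Z)) = weight N a b q S (f, Z)"
      by (simp add: weight_def 1 2 3)
  qed
  show ?thesis
    unfolding gen_sum_def
  proof (rule sum.reindex_bij_witness[of _ "swap_conj k" "swap_conj k"])
    fix \<pi> assume \<pi>: "\<pi> \<in> {\<pi>. \<pi> \<in> marked_perms S \<and> up_set S \<pi> = H}"
    then show "swap_conj k \<pi> \<in> {\<pi>. \<pi> \<in> marked_perms (?t ` S) \<and> up_set (?t ` S) \<pi> = ?t ` H}"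
      using swap_conj_marked_perms[of \<pi> S k] main(1)[of "fst \<pi>" "snd \<pi>"] by auto
  next
    fix \<pi> assume \<pi>: "\<pi> \<in> {\<pi>. \<pi> \<in> marked_perms (?t ` S) \<and> up_set (?t ` S) \<pi> = ?t ` H}"
    obtain f Z where fZ: "swap_conj k \<pi> = (f, Z)" by (cases "swap_conj k \<pi>")
    have mem: "(f, Z) \<in> marked_perms S"
      using swap_conj_marked_perms[of \<pi> "?t ` S" k] \<pi> fZ tt by simp
    have \<pi>': "swap_conj k (f, Z) = \<pi>" using swap_conj_swap_conj[of k \<pi>] fZ by simp
    have "?t ` up_set S (f, Z) = ?t ` H" using main(1)[OF mem] \<pi> \<pi>' by simp
    then have "up_set S (f, Z) = H" by (simp add: inj_image_eq_iff)
    then show "swap_conj k \<pi> \<in> {\<pi>. \<pi> \<in> marked_perms S \<and> up_set S \<pi> = H}"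
      using mem fZ by simp
    show "weight N a b q S (swap_conj k \<pi>) = weight N a b q (?t ` S) \<pi>"
      using main(2)[OF mem] \<pi>' fZ by simp
  qed (simp_all only: swap_conj_swap_conj)
qed

section \<open>The generator of the ASEP\<close>

text \<open>
  If \<open>g\<close> is in the kernel, so is \<open>\<bar>g\<bar>\<close>: the triangle inequality holds at every state, and it
  cannot be strict because the row sums vanish. A zero of \<open>\<bar>g\<bar>\<close> then propagates to all
  predecessors.
\<close>

lemma generator_kernel_zero:
  fixes r :: "'a \<Rightarrow> 'a \<Rightarrow> real" and g :: "'a \<Rightarrow> real" and N :: "'a \<Rightarrow> nat"
  assumes X: "finite X"
    and nonneg: "\<And>x y. x \<in> X \<Longrightarrow> y \<in> X \<Longrightarrow> 0 \<le> r x y"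
    and kernel: "\<And>y. y \<in> X \<Longrightarrow>
      (\<Sum>x\<in>X. g x * (if x = y then - (\<Sum>z\<in>X - {x}. r x z) else r x y)) = 0"
    and descent: "\<And>x. x \<in> X \<Longrightarrow> x \<noteq> t \<Longrightarrow> \<exists>y\<in>X. y \<noteq> x \<and> r x y > 0 \<and> N y < N x"
    and t: "g t = 0" and x: "x \<in> X"
  shows "g x = 0"
proof -
  have split: "g y * (\<Sum>z\<in>X - {y}. r y z) = (\<Sum>x\<in>X - {y}. g x * r x y)" if y: "y \<in> X" for y
    using kernel[OF y] by (simp add: sum.remove[OF X y])
  have le: "\<bar>g y\<bar> * (\<Sum>z\<in>X - {y}. r y z) \<le> (\<Sum>x\<in>X - {y}. \<bar>g x\<bar> * r x y)" if y: "y \<in> X" for y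
  proof -
    have "\<bar>g y\<bar> * (\<Sum>z\<in>X - {y}. r y z) = \<bar>\<Sum>x\<in>X - {y}. g x * r x y\<bar>"
      unfolding split[OF y, symmetric] abs_mult using sum_nonneg[of "X - {y}" "r y"] y nonneg by simp
    also have "\<dots> \<le> (\<Sum>x\<in>X - {y}. \<bar>g x * r x y\<bar>)" by (rule sum_abs)
    also have "\<dots> = (\<Sum>x\<in>X - {y}. \<bar>g x\<bar> * r x y)"
      using y nonneg by (intro sum.cong) (auto simp: abs_mult)
    finally show ?thesis .
  qed
  have total: "(\<Sum>y\<in>X. \<bar>g y\<bar> * (\<Sum>z\<in>X - {y}. r y z)) = (\<Sum>y\<in>X. \<Sum>x\<in>X - {y}. \<bar>g x\<bar> * r x y)"
  proof -
    have rem: "(\<Sum>z\<in>X - {y}. h z) = (\<Sum>z\<in>X. if z = y then 0 else h z)" for y and h :: "'a \<Rightarrow> real"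
      using X by (intro sum.mono_neutral_cong_left) auto
    have "(\<Sum>y\<in>X. \<bar>g y\<bar> * (\<Sum>z\<in>X - {y}. r y z)) = (\<Sum>y\<in>X. \<Sum>z\<in>X. if z = y then 0 else \<bar>g y\<bar> * r y z)"
      unfolding rem sum_distrib_left by (intro sum.cong) auto
    also have "\<dots> = (\<Sum>z\<in>X. \<Sum>y\<in>X. if z = y then 0 else \<bar>g y\<bar> * r y z)" by (rule sum.swap)
    also have "\<dots> = (\<Sum>z\<in>X. \<Sum>y\<in>X - {z}. \<bar>g y\<bar> * r y z)"
      unfolding rem by (intro sum.cong) auto
    finally show ?thesis .
  qed
  have eq: "\<bar>g y\<bar> * (\<Sum>z\<in>X - {y}. r y z) = (\<Sum>x\<in>X - {y}. \<bar>g x\<bar> * r x y)" if y: "y \<in> X" for y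
    by (rule sum_mono_inv[OF total le y X])
  show ?thesis
    using x
  proof (induction "N x" arbitrary: x rule: less_induct)
    case less
    show ?case
    proof (cases "x = t")
      case False
      then obtain y where y: "y \<in> X" "y \<noteq> x" "r x y > 0" "N y < N x"
        using descent less.prems by blast
      have "(\<Sum>x\<in>X - {y}. \<bar>g x\<bar> * r x y) = 0" using eq[OF y(1)] less.hyps[OF y(4,1)] by simp
      then have "\<bar>g x\<bar> * r x y = 0"
        using y less.prems nonneg X by (subst (asm) sum_nonneg_eq_0_iff) auto
      then show ?thesis using y by simp
    qed (use t in simp)
  qed
qed

section \<open>Inflow and outflow, sorted by bonds\<close>

lemma finite_configs: "finite (configs n)"
  unfolding configs_def by (intro finite_PiE) auto

lemma configs_upd: "\<eta> \<in> configs n \<Longrightarrow> i \<in> {1..n} \<Longrightarrow> v \<in> {0, 1} \<Longrightarrow> \<eta>(i := v) \<in> configs n"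
  unfolding configs_def by (auto simp: PiE_def extensional_def Pi_def)

lemma configs_01: "\<eta> \<in> configs n \<Longrightarrow> i \<in> {1..n} \<Longrightarrow> \<eta> i = 0 \<or> \<eta> i = 1"
  unfolding configs_def by (auto simp: PiE_def Pi_def)

text \<open>Jumps to the left are indexed by their bond instead of their starting site, so that both
  directions across a bond share a summand.\<close>

lemma asep_rate_eq:
  "asep_rate n q \<alpha> \<beta> 0 0 \<eta> \<eta>' =
     (\<Sum>i\<in>{1..<n}. (if \<eta> i = 1 \<and> \<eta> (Suc i) = 0 \<and> \<eta>' = \<eta>(i := 0, Suc i := 1) then 1 else 0)
       + (if \<eta> (Suc i) = 1 \<and> \<eta> i = 0 \<and> \<eta>' = \<eta>(Suc i := 0, i := 1) then q else 0))
   + (if \<eta> 1 = 0 \<and> \<eta>' = \<eta>(1 := 1) then \<alpha> else 0)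
   + (if \<eta> n = 1 \<and> \<eta>' = \<eta>(n := 0) then \<beta> else 0)"
proof -
  have im: "{2..n} = Suc ` {1..<n}"
    by (auto simp: image_Suc_atLeastLessThan)
  show ?thesis
    unfolding asep_rate_def im by (subst sum.reindex) (auto simp: sum.distrib)
qed

lemma asep_rate_nonneg:
  "0 \<le> q \<Longrightarrow> 0 \<le> \<alpha> \<Longrightarrow> 0 \<le> \<beta> \<Longrightarrow> 0 \<le> asep_rate n q \<alpha> \<beta> 0 0 \<eta> \<eta>'"
  unfolding asep_rate_eq by (intro add_nonneg_nonneg sum_nonneg) auto

lemma asep_rate_self: "asep_rate n q \<alpha> \<beta> 0 0 \<eta> \<eta> = 0"
proof -
  have "\<eta> \<noteq> \<eta>(i := 0, j := 1)" if "\<eta> i = 1" "\<eta> j = 0" for i j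
    using that by (metis fun_upd_same zero_neq_one)
  moreover have "\<eta> \<noteq> \<eta>(i := v)" if "\<eta> i \<noteq> v" for i v
    using that by (metis fun_upd_same)
  ultimately show ?thesis unfolding asep_rate_eq by (auto intro!: sum.neutral)
qed

lemma sum_delta_cond:
  fixes g :: "'a \<Rightarrow> real"
  assumes "finite X" "\<And>x. x \<in> X \<Longrightarrow> C x \<longleftrightarrow> c \<and> x = x0" "c \<Longrightarrow> x0 \<in> X"
  shows "(\<Sum>x\<in>X. g x * (if C x then v else 0)) = (if c then g x0 * v else 0)"
proof -
  have "(\<Sum>x\<in>X. g x * (if C x then v else 0)) = (\<Sum>x\<in>X. if x = x0 then (if c then g x0 * v else 0) else 0)"
    using assms(2) by (intro sum.cong) auto
  then show ?thesis using assms(1,3) by (simp add: sum.delta')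
qed

lemma upd2_eq_iff:
  fixes \<eta> \<eta>' :: "nat \<Rightarrow> nat"
  assumes "i \<noteq> j"
  shows "\<eta> i = 1 \<and> \<eta> j = 0 \<and> \<eta>' = \<eta>(i := 0, j := 1) \<longleftrightarrow>
    (\<eta>' i = 0 \<and> \<eta>' j = 1) \<and> \<eta> = \<eta>'(i := 1, j := 0)"
  using assms by (auto simp: fun_eq_iff)

text \<open>Gain minus loss at \<open>\<eta>\<close>: each mechanism leads into
  \<open>\<eta>\<close> from at most one configuration, and a bond contributes only if its two sites
  differ.\<close>

lemma asep_flow:
  assumes n: "n \<ge> 1" and \<eta>: "\<eta> \<in> configs n"
  shows "(\<Sum>\<zeta>\<in>configs n. g \<zeta> * asep_generator n q \<alpha> \<beta> 0 0 \<zeta> \<eta>) =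
    (\<Sum>i\<in>{1..<n}. (if \<eta> i = 0 \<and> \<eta> (Suc i) = 1 then g (\<eta>(i := 1, Suc i := 0)) - q * g \<eta> else 0)
       + (if \<eta> i = 1 \<and> \<eta> (Suc i) = 0 then q * g (\<eta>(i := 0, Suc i := 1)) - g \<eta> else 0))
    + \<alpha> * (if \<eta> 1 = 1 then g (\<eta>(1 := 0)) else - g \<eta>)
    + \<beta> * (if \<eta> n = 0 then g (\<eta>(n := 1)) else - g \<eta>)"
proof -
  let ?X = "configs n" and ?r = "asep_rate n q \<alpha> \<beta> 0 0"
  note fin = finite_configs[of n]
  have bond: "(if \<eta> i = 0 \<and> \<eta> (Suc i) = 1 then g (\<eta>(i := 1, Suc i := 0)) - q * g \<eta> else 0)
       + (if \<eta> i = 1 \<and> \<eta> (Suc i) = 0 then q * g (\<eta>(i := 0, Suc i := 1)) - g \<eta> else 0) =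
     ((if \<eta> i = 0 \<and> \<eta> (Suc i) = 1 then g (\<eta>(i := 1, Suc i := 0)) * 1 else 0)
        + (if \<eta> (Suc i) = 0 \<and> \<eta> i = 1 then g (\<eta>(Suc i := 1, i := 0)) * q else 0))
     - g \<eta> * ((if \<eta> i = 1 \<and> \<eta> (Suc i) = 0 then 1 else 0)
        + (if \<eta> (Suc i) = 1 \<and> \<eta> i = 0 then q else 0))" for i
    using fun_upd_twist[of i "Suc i" \<eta> 0 1] by (auto simp: algebra_simps)
  have "(\<Sum>\<zeta>\<in>?X. g \<zeta> * asep_generator n q \<alpha> \<beta> 0 0 \<zeta> \<eta>) =
      (\<Sum>\<zeta>\<in>?X. g \<zeta> * ?r \<zeta> \<eta>) - g \<eta> * (\<Sum>\<zeta>\<in>?X. ?r \<eta> \<zeta>)"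
    by (simp add: asep_generator_def sum.remove[OF fin \<eta>] asep_rate_self)
  also have "(\<Sum>\<zeta>\<in>?X. g \<zeta> * ?r \<zeta> \<eta>) =
      (\<Sum>i\<in>{1..<n}. (if \<eta> i = 0 \<and> \<eta> (Suc i) = 1 then g (\<eta>(i := 1, Suc i := 0)) * 1 else 0)
        + (if \<eta> (Suc i) = 0 \<and> \<eta> i = 1 then g (\<eta>(Suc i := 1, i := 0)) * q else 0))
      + (if \<eta> 1 = 1 then g (\<eta>(1 := 0)) * \<alpha> else 0) + (if \<eta> n = 0 then g (\<eta>(n := 1)) * \<beta> else 0)"
  proof -
    have 1: "(\<Sum>\<zeta>\<in>?X. g \<zeta> * (if \<zeta> i = 1 \<and> \<zeta> j = 0 \<and> \<eta> = \<zeta>(i := 0, j := 1) then v else 0)) =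
        (if \<eta> i = 0 \<and> \<eta> j = 1 then g (\<eta>(i := 1, j := 0)) * v else 0)"
      if "i \<noteq> j" "i \<in> {1..n}" "j \<in> {1..n}" for i j v
      by (rule sum_delta_cond[OF fin upd2_eq_iff[OF that(1)]])
        (rule configs_upd[OF configs_upd[OF \<eta> that(2)] that(3)], simp_all)
    have 2: "(\<Sum>\<zeta>\<in>?X. g \<zeta> * (if \<zeta> 1 = 0 \<and> \<eta> = \<zeta>(1 := 1) then \<alpha> else 0)) =
        (if \<eta> 1 = 1 then g (\<eta>(1 := 0)) * \<alpha> else 0)"
      by (rule sum_delta_cond[OF fin]) (use n in \<open>auto intro!: configs_upd \<eta>\<close>)
    have 3: "(\<Sum>\<zeta>\<in>?X. g \<zeta> * (if \<zeta> n = 1 \<and> \<eta> = \<zeta>(n := 0) then \<beta> else 0)) =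
        (if \<eta> n = 0 then g (\<eta>(n := 1)) * \<beta> else 0)"
      by (rule sum_delta_cond[OF fin]) (use n in \<open>auto intro!: configs_upd \<eta>\<close>)
    have "(\<Sum>\<zeta>\<in>?X. g \<zeta> * ?r \<zeta> \<eta>) =
      (\<Sum>i\<in>{1..<n}. (\<Sum>\<zeta>\<in>?X. g \<zeta> * (if \<zeta> i = 1 \<and> \<zeta> (Suc i) = 0 \<and> \<eta> = \<zeta>(i := 0, Suc i := 1) then 1 else 0))
        + (\<Sum>\<zeta>\<in>?X. g \<zeta> * (if \<zeta> (Suc i) = 1 \<and> \<zeta> i = 0 \<and> \<eta> = \<zeta>(Suc i := 0, i := 1) then q else 0)))
      + (\<Sum>\<zeta>\<in>?X. g \<zeta> * (if \<zeta> 1 = 0 \<and> \<eta> = \<zeta>(1 := 1) then \<alpha> else 0))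
      + (\<Sum>\<zeta>\<in>?X. g \<zeta> * (if \<zeta> n = 1 \<and> \<eta> = \<zeta>(n := 0) then \<beta> else 0))"
      unfolding asep_rate_eq distrib_left sum.distrib sum_distrib_left
      by (subst (1 2) sum.swap) (rule refl)
    also have "\<dots> = (\<Sum>i\<in>{1..<n}. (if \<eta> i = 0 \<and> \<eta> (Suc i) = 1 then g (\<eta>(i := 1, Suc i := 0)) * 1 else 0)
        + (if \<eta> (Suc i) = 0 \<and> \<eta> i = 1 then g (\<eta>(Suc i := 1, i := 0)) * q else 0))
      + (if \<eta> 1 = 1 then g (\<eta>(1 := 0)) * \<alpha> else 0) + (if \<eta> n = 0 then g (\<eta>(n := 1)) * \<beta> else 0)"
      unfolding 2 3 by (intro arg_cong2[of _ _ _ _ "(+)"] sum.cong refl 1) auto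
    finally show ?thesis .
  qed
  also have "(\<Sum>\<zeta>\<in>?X. ?r \<eta> \<zeta>) =
      (\<Sum>i\<in>{1..<n}. (if \<eta> i = 1 \<and> \<eta> (Suc i) = 0 then 1 else 0)
        + (if \<eta> (Suc i) = 1 \<and> \<eta> i = 0 then q else 0))
      + (if \<eta> 1 = 0 then \<alpha> else 0) + (if \<eta> n = 1 then \<beta> else 0)"
  proof -
    have 1: "(\<Sum>\<zeta>\<in>?X. (if \<eta> i = 1 \<and> \<eta> j = 0 \<and> \<zeta> = \<eta>(i := 0, j := 1) then v else 0)) =
        (if \<eta> i = 1 \<and> \<eta> j = 0 then v else 0)"
      if "i \<in> {1..n}" "j \<in> {1..n}" for i j and v :: real
      using configs_upd[OF configs_upd[OF \<eta> that(1), of 0] that(2), of 1] fin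
      by (cases "\<eta> i = 1 \<and> \<eta> j = 0") (auto simp: sum.delta)
    have 2: "(\<Sum>\<zeta>\<in>?X. (if \<eta> i = u \<and> \<zeta> = \<eta>(i := w) then v else 0)) = (if \<eta> i = u then v else 0)"
      if "i \<in> {1..n}" "w \<in> {0, 1}" for i u w and v :: real
      using configs_upd[OF \<eta> that] fin
      by (cases "\<eta> i = u") (auto simp: sum.delta)
    have "(\<Sum>\<zeta>\<in>?X. ?r \<eta> \<zeta>) =
      (\<Sum>i\<in>{1..<n}. (\<Sum>\<zeta>\<in>?X. (if \<eta> i = 1 \<and> \<eta> (Suc i) = 0 \<and> \<zeta> = \<eta>(i := 0, Suc i := 1) then 1 else 0))
        + (\<Sum>\<zeta>\<in>?X. (if \<eta> (Suc i) = 1 \<and> \<eta> i = 0 \<and> \<zeta> = \<eta>(Suc i := 0, i := 1) then q else 0)))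
      + (\<Sum>\<zeta>\<in>?X. (if \<eta> 1 = 0 \<and> \<zeta> = \<eta>(1 := 1) then \<alpha> else 0))
      + (\<Sum>\<zeta>\<in>?X. (if \<eta> n = 1 \<and> \<zeta> = \<eta>(n := 0) then \<beta> else 0))"
      unfolding asep_rate_eq sum.distrib
      by (subst (1 2) sum.swap) (rule refl)
    also have "\<dots> = (\<Sum>i\<in>{1..<n}. (if \<eta> i = 1 \<and> \<eta> (Suc i) = 0 then 1 else 0)
        + (if \<eta> (Suc i) = 1 \<and> \<eta> i = 0 then q else 0))
      + (if \<eta> 1 = 0 then \<alpha> else 0) + (if \<eta> n = 1 then \<beta> else 0)"
      using n by (intro arg_cong2[of _ _ _ _ "(+)"] sum.cong refl 1 2) auto
    finally show ?thesis .
  qed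
  finally show ?thesis
    unfolding bond sum_subtractf sum_distrib_left[symmetric]
    using configs_01[OF \<eta>, of 1] configs_01[OF \<eta>, of n] n
    by (auto simp: algebra_simps)
qed

section \<open>Stationarity\<close>

definition occupied :: "nat \<Rightarrow> (nat \<Rightarrow> nat) \<Rightarrow> nat set" where
  "occupied n \<eta> = {i \<in> {1..n}. \<eta> i = 1}"

context
  fixes n :: nat and a b q :: real
begin

abbreviation (input) config_weight :: "(nat \<Rightarrow> nat) \<Rightarrow> real" where
  "config_weight \<eta> \<equiv> gen_sum (n + 1) a b q {1..n} (occupied n \<eta>)"

text \<open>The net flow through the bond between \<open>i\<close> and \<open>i + 1\<close> is a difference of these terms.\<close>

definition site_term :: "(nat \<Rightarrow> nat) \<Rightarrow> nat \<Rightarrow> real" where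
  "site_term \<eta> i = (if \<eta> i = 1 then 1 else - 1) *
     gen_sum (n + 1) a b q ({1..n} - {i}) (occupied n \<eta> - {i})"

lemma relabel_adjacent:
  assumes k: "1 \<le> k" "k < n"
  shows "gen_sum (n + 1) a b q ({1..n} - {Suc k}) (Transposition.transpose k (Suc k) ` H)
    = gen_sum (n + 1) a b q ({1..n} - {k}) H"
proof -
  have "Transposition.transpose k (Suc k) ` ({1..n} - {k}) = {1..n} - {Suc k}"
  proof -
    have "Transposition.transpose k (Suc k) ` {1..n} = {1..n}"
      using k by (intro transpose_image_both) auto
    then show ?thesis by (simp add: image_set_diff[OF inj_transpose])
  qed
  moreover have "{1..n} - {k} \<subseteq> {1..<n + 1}" by auto
  ultimately show ?thesis
    using gen_sum_relabel[of "{1..n} - {k}" "n + 1" k a b q H] k by simp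
qed

lemma transpose_image_none:
  "k \<notin> H \<Longrightarrow> l \<notin> H \<Longrightarrow> Transposition.transpose k l ` H = H"
  by (auto simp: image_iff Transposition.transpose_def split: if_splits)

text \<open>For unequal sites this is the relation DE = q ED + D + E, with the peak in
  \<open>\<eta>\<close> or in its exchanged configuration; the signs in \<open>site_term\<close>
  turn the two deletion terms into a difference. For equal sites nothing flows, and moving the gap
  shows that both site terms agree.\<close>

lemma bond_term:
  assumes \<eta>: "\<eta> \<in> configs n" and k: "1 \<le> k" "k < n"
  shows "(if \<eta> k = 0 \<and> \<eta> (Suc k) = 1 then config_weight (\<eta>(k := 1, Suc k := 0)) - q * config_weight \<eta> else 0)
       + (if \<eta> k = 1 \<and> \<eta> (Suc k) = 0 then q * config_weight (\<eta>(k := 0, Suc k := 1)) - config_weight \<eta> else 0)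
     = site_term \<eta> (Suc k) - site_term \<eta> k"
proof -
  let ?H = "occupied n \<eta>" and ?F = "gen_sum (n + 1) a b q"
  have S: "finite {1..n}" "{1..n} \<subseteq> {1..<n + 1}" "k \<in> {1..n}" "Suc k \<in> {1..n}" using k by auto
  have in_H: "k \<in> ?H \<longleftrightarrow> \<eta> k = 1" "Suc k \<in> ?H \<longleftrightarrow> \<eta> (Suc k) = 1"
    using k by (auto simp: occupied_def)
  consider "\<eta> k = 1" "\<eta> (Suc k) = 0" | "\<eta> k = 0" "\<eta> (Suc k) = 1" | "\<eta> k = \<eta> (Suc k)"
    using configs_01[OF \<eta>, of k] configs_01[OF \<eta>, of "Suc k"] k by force
  then show ?thesis
  proof cases
    case 1
    have H: "k \<in> ?H" "Suc k \<notin> ?H" using in_H 1 by auto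
    have "occupied n (\<eta>(k := 0, Suc k := 1)) = insert (Suc k) (?H - {k})"
      using k by (auto simp: occupied_def)
    moreover have "?H - {Suc k} = ?H" using H by blast
    ultimately show ?thesis
      using gen_sum_peak[OF S H, of a b q] 1 by (simp add: site_term_def)
  next
    case 2
    let ?H' = "insert k (?H - {Suc k})"
    have "k \<notin> ?H" "Suc k \<in> ?H" using in_H 2 by auto
    then have H: "k \<in> ?H'" "Suc k \<notin> ?H'" "insert (Suc k) (?H' - {k}) = ?H" "?H' - {k} = ?H - {Suc k}" by auto
    have o: "occupied n (\<eta>(k := 1, Suc k := 0)) = ?H'"
      using k by (auto simp: occupied_def)
    \<comment> \<open>The peak relation for \<open>?H'\<close> leaves both gaps at the place
      opposite to the one used by \<open>site_term\<close>, so each is moved by one site.\<close>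
    have "?F ({1..n} - {k}) (?H - {Suc k}) = ?F ({1..n} - {Suc k}) (?H - {Suc k})"
      using relabel_adjacent[OF k, of "?H - {Suc k}"] \<open>k \<notin> ?H\<close> by (simp add: transpose_image_none)
    moreover have "?F ({1..n} - {Suc k}) ?H' = ?F ({1..n} - {k}) ?H"
    proof -
      have "Transposition.transpose k (Suc k) ` ?H = ?H'"
      proof -
        have "?H = insert (Suc k) (?H - {Suc k})" using \<open>Suc k \<in> ?H\<close> by blast
        then have "Transposition.transpose k (Suc k) ` ?H =
            insert k (Transposition.transpose k (Suc k) ` (?H - {Suc k}))"
          by (metis image_insert transpose_apply_second)
        then show ?thesis using \<open>k \<notin> ?H\<close> by (simp add: transpose_image_none)
      qed
      then show ?thesis using relabel_adjacent[OF k, of ?H] by simp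
    qed
    moreover have "?H - {k} = ?H" using \<open>k \<notin> ?H\<close> by blast
    moreover have "config_weight (\<eta>(k := 1, Suc k := 0)) =
        q * config_weight \<eta> + ?F ({1..n} - {k}) (?H - {Suc k}) + ?F ({1..n} - {Suc k}) ?H'"
      unfolding o using gen_sum_peak[OF S H(1,2), of a b q] unfolding H(4)
      using \<open>Suc k \<in> ?H\<close> by (simp only: insert_Diff)
    ultimately show ?thesis using 2 by (simp add: site_term_def)
  next
    case 3
    have "?F ({1..n} - {Suc k}) (?H - {Suc k}) = ?F ({1..n} - {k}) (?H - {k})"
    proof (cases "\<eta> k = 1")
      case True
      then have "k \<in> ?H" "Suc k \<in> ?H" using in_H 3 by auto
      then have "Transposition.transpose k (Suc k) ` (?H - {k}) = ?H - {Suc k}"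
        by (simp add: image_set_diff[OF inj_transpose] transpose_image_both)
      then show ?thesis using relabel_adjacent[OF k, of "?H - {k}"] by simp
    next
      case False
      then have "k \<notin> ?H" "Suc k \<notin> ?H" using in_H 3 by auto
      then show ?thesis using relabel_adjacent[OF k, of ?H] by (simp add: transpose_image_none)
    qed
    then show ?thesis using 3 by (auto simp: site_term_def)
  qed
qed

text \<open>Gain and loss both involve the configuration with site 1 empty, whose weight is a times
  the sum with that site deleted; the rate \<alpha> cancels a.\<close>

lemma left_boundary_term:
  assumes n: "n \<ge> 1" and \<eta>: "\<eta> \<in> configs n" and \<alpha>: "\<alpha> * a = 1"
  shows "\<alpha> * (if \<eta> 1 = 1 then config_weight (\<eta>(1 := 0)) else - config_weight \<eta>) = site_term \<eta> 1"
proof -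
  let ?\<zeta> = "if \<eta> 1 = 1 then \<eta>(1 := 0) else \<eta>"
  have z: "1 \<notin> occupied n ?\<zeta>" by (simp add: occupied_def)
  have H: "occupied n ?\<zeta> - {1} = occupied n \<eta> - {1}" by (auto simp: occupied_def)
  let ?R = "gen_sum (n + 1) a b q ({1..n} - {1}) (occupied n \<eta> - {1})"
  have "config_weight ?\<zeta> = (if 1 \<in> occupied n ?\<zeta> then b else a) * gen_sum (n + 1) a b q ({1..n} - {1}) (occupied n ?\<zeta> - {1})"
    by (rule gen_sum_remove_fixed) (use n z in \<open>auto simp: occupied_def\<close>)
  then have "config_weight ?\<zeta> = a * ?R" unfolding H using z by (simp only: if_False)
  moreover have "\<alpha> * (a * ?R) = ?R" using \<alpha> by (simp add: mult.assoc[symmetric])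
  ultimately show ?thesis by (cases "\<eta> 1 = 1") (simp_all add: site_term_def)
qed

lemma right_boundary_term:
  assumes n: "n \<ge> 1" and \<eta>: "\<eta> \<in> configs n" and \<beta>: "\<beta> * b = 1"
  shows "\<beta> * (if \<eta> n = 0 then config_weight (\<eta>(n := 1)) else - config_weight \<eta>) = - site_term \<eta> n"
proof -
  let ?\<zeta> = "if \<eta> n = 0 then \<eta>(n := 1) else \<eta>"
  have \<eta>n: "\<eta> n = 0 \<or> \<eta> n = 1" using configs_01[OF \<eta>] n by simp
  have z: "n \<in> occupied n ?\<zeta>" using n \<eta>n by (auto simp: occupied_def)
  have H: "occupied n ?\<zeta> - {n} = occupied n \<eta> - {n}" by (auto simp: occupied_def)
  let ?R = "gen_sum (n + 1) a b q ({1..n} - {n}) (occupied n \<eta> - {n})"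
  have "config_weight ?\<zeta> = (if n \<in> occupied n ?\<zeta> then b else a) * gen_sum (n + 1) a b q ({1..n} - {n}) (occupied n ?\<zeta> - {n})"
    by (rule gen_sum_remove_fixed) (use n z in \<open>auto simp: occupied_def\<close>)
  then have "config_weight ?\<zeta> = b * ?R" unfolding H using z by (simp only: if_True)
  moreover have "\<beta> * (b * ?R) = ?R" using \<beta> by (simp add: mult.assoc[symmetric])
  ultimately show ?thesis using \<eta>n by (cases "\<eta> n = 0") (simp_all add: site_term_def)
qed

lemma gen_sum_kernel:
  assumes n: "n \<ge> 1" and \<eta>: "\<eta> \<in> configs n" and "\<alpha> * a = 1" "\<beta> * b = 1"
  shows "(\<Sum>\<zeta>\<in>configs n. config_weight \<zeta> * asep_generator n q \<alpha> \<beta> 0 0 \<zeta> \<eta>) = 0"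
proof -
  have "(\<Sum>i\<in>{1..<n}. (if \<eta> i = 0 \<and> \<eta> (Suc i) = 1 then config_weight (\<eta>(i := 1, Suc i := 0)) - q * config_weight \<eta> else 0)
       + (if \<eta> i = 1 \<and> \<eta> (Suc i) = 0 then q * config_weight (\<eta>(i := 0, Suc i := 1)) - config_weight \<eta> else 0))
    = (\<Sum>i\<in>{1..<n}. site_term \<eta> (Suc i) - site_term \<eta> i)"
    by (intro sum.cong refl bond_term[OF \<eta>]) auto
  also have "\<dots> = site_term \<eta> n - site_term \<eta> 1"
    using sum_Suc_diff'[of 1 n "site_term \<eta>"] n by simp
  finally show ?thesis
    using left_boundary_term[OF n \<eta> assms(3)] right_boundary_term[OF n \<eta> assms(4)]
    by (simp only: asep_flow[OF n \<eta>])
qed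

end

section \<open>Positivity and uniqueness of the stationary vector\<close>

lemma weight_nonneg: "0 \<le> a \<Longrightarrow> 0 \<le> b \<Longrightarrow> 0 \<le> q \<Longrightarrow> 0 \<le> weight N a b q S \<pi>"
  by (cases \<pi>) (simp add: weight_def)

text \<open>The identity with empty \<open>Z\<close> has all parents equal to \<open>n + 1\<close>,
  hence no crossings, and contributes a positive term even for q = 0. This permits normalization at
  the full configuration.\<close>

lemma gen_sum_full_pos:
  assumes "0 < a" "0 < b" "0 \<le> q"
  shows "0 < gen_sum (n + 1) a b q {1..n} {1..n}"
proof -
  have "par (<) 0 (n + 1) id {} x = n + 1" for x
    by (auto simp: par_def cycle_root_def orbit_eq_singleton_iff[THEN iffD2])
  then have "crossings {1..n} (par (<) 0 (n + 1) id {}) = {}"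
    by (auto simp: crossings_def)
  then have "0 < weight (n + 1) a b q {1..n} (id, {})"
    using assms by (simp add: weight_def)
  moreover have "(id, {}) \<in> {\<pi>. \<pi> \<in> marked_perms {1..n} \<and> up_set {1..n} \<pi> = {1..n}}"
    by (auto simp: marked_perms_def up_set_def permutes_id)
  ultimately show ?thesis
    unfolding gen_sum_def using finite_marked_perms[of "{1..n}"] assms
    by (intro sum_pos2[of _ "(id, {})"]) (auto intro: weight_nonneg finite_subset[rotated])
qed

text \<open>\<open>N\<close> adds up the positions of the empty sites. It drops when site 1 is
  filled or the leftmost hole moves one step left, moves of rate at least \<alpha> and at least 1,
  so q = 0 is covered.\<close>

lemma asep_descent:
  assumes n: "n \<ge> 1" and \<alpha>: "\<alpha> > 0" and \<beta>: "\<beta> > 0" and q: "q \<ge> 0"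
    and \<eta>: "\<eta> \<in> configs n" and not_full: "\<eta> \<noteq> (\<lambda>i\<in>{1..n}. 1)"
  defines "N \<equiv> \<lambda>\<eta> :: nat \<Rightarrow> nat. \<Sum>i\<in>{1..n}. (1 - \<eta> i) * i"
  shows "\<exists>\<zeta>\<in>configs n. \<zeta> \<noteq> \<eta> \<and> 0 < asep_rate n q \<alpha> \<beta> 0 0 \<eta> \<zeta> \<and> N \<zeta> < N \<eta>"
proof (cases "\<eta> 1 = 0")
  case True
  let ?\<zeta> = "\<eta>(1 := 1)"
  have 1: "1 \<in> {1..n}" using n by simp
  have "?\<zeta> \<in> configs n" using configs_upd[OF \<eta> 1, of 1] by simp
  moreover have "?\<zeta> \<noteq> \<eta>" using True by (metis fun_upd_same zero_neq_one)
  moreover have "0 < asep_rate n q \<alpha> \<beta> 0 0 \<eta> ?\<zeta>"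
  proof -
    have "0 \<le> (\<Sum>i\<in>{1..<n}. (if \<eta> i = 1 \<and> \<eta> (Suc i) = 0 \<and> ?\<zeta> = \<eta>(i := 0, Suc i := 1) then 1 else 0)
       + (if \<eta> (Suc i) = 1 \<and> \<eta> i = 0 \<and> ?\<zeta> = \<eta>(Suc i := 0, i := 1) then q else 0))"
      using q by (intro sum_nonneg) auto
    then show ?thesis unfolding asep_rate_eq using True \<alpha> \<beta> by auto
  qed
  moreover have "N ?\<zeta> < N \<eta>"
    unfolding N_def by (rule sum_strict_mono_ex1) (use True 1 in auto)
  ultimately show ?thesis by blast
next
  case False
  have "\<exists>i\<in>{1..n}. \<eta> i \<noteq> 1"
  proof (rule ccontr)
    assume "\<not> (\<exists>i\<in>{1..n}. \<eta> i \<noteq> 1)"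
    then have "\<eta> = (\<lambda>i\<in>{1..n}. 1)"
      using \<eta> unfolding configs_def by (auto simp: fun_eq_iff PiE_def extensional_def)
    then show False using not_full by simp
  qed
  then obtain i0 where i0: "i0 \<in> {1..n}" "\<eta> i0 = 0" using configs_01[OF \<eta>] by blast
  define m where "m = (LEAST i. i \<in> {1..n} \<and> \<eta> i = 0)"
  have m: "m \<in> {1..n}" "\<eta> m = 0"
    using LeastI[of "\<lambda>i. i \<in> {1..n} \<and> \<eta> i = 0" i0] i0 unfolding m_def by auto
  then have "m \<noteq> 1" using False by auto
  then obtain k where k: "m = Suc k" "1 \<le> k" "k < n" using m by (cases m) auto
  have "\<eta> k \<noteq> 0" using not_less_Least[of k "\<lambda>i. i \<in> {1..n} \<and> \<eta> i = 0"] k unfolding m_def by auto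
  then have \<eta>k: "\<eta> k = 1" using configs_01[OF \<eta>, of k] k by auto
  let ?\<zeta> = "\<eta>(k := 0, Suc k := 1)"
  have in_n: "k \<in> {1..n}" "Suc k \<in> {1..n}" using k by auto
  have "?\<zeta> \<in> configs n" using configs_upd[OF configs_upd[OF \<eta> in_n(1), of 0] in_n(2), of 1] by simp
  moreover have "?\<zeta> \<noteq> \<eta>" using m k by (metis fun_upd_same zero_neq_one)
  moreover have "0 < asep_rate n q \<alpha> \<beta> 0 0 \<eta> ?\<zeta>"
  proof -
    have "0 < (\<Sum>i\<in>{1..<n}. (if \<eta> i = 1 \<and> \<eta> (Suc i) = 0 \<and> ?\<zeta> = \<eta>(i := 0, Suc i := 1) then 1 else 0)
       + (if \<eta> (Suc i) = 1 \<and> \<eta> i = 0 \<and> ?\<zeta> = \<eta>(Suc i := 0, i := 1) then q else 0))"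
      using q \<eta>k m k by (intro sum_pos2[of _ k]) auto
    then show ?thesis unfolding asep_rate_eq using \<alpha> \<beta> by (auto intro: add_pos_nonneg)
  qed
  moreover have "N ?\<zeta> < N \<eta>"
  proof -
    have "N \<xi> = (1 - \<xi> k) * k + (1 - \<xi> (Suc k)) * Suc k + (\<Sum>i\<in>{1..n} - {k} - {Suc k}. (1 - \<xi> i) * i)" for \<xi>
      unfolding N_def using in_n by (simp add: sum.remove[of _ k] sum.remove[of _ "Suc k"])
    moreover have "(\<Sum>i\<in>{1..n} - {k} - {Suc k}. (1 - ?\<zeta> i) * i) = (\<Sum>i\<in>{1..n} - {k} - {Suc k}. (1 - \<eta> i) * i)"
      by (intro sum.cong) auto
    ultimately show ?thesis using \<eta>k m k by simp
  qed
  ultimately show ?thesis by blast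
qed

theorem asep_stationary_gen_sum:
  assumes n: "n \<ge> 1" and \<alpha>: "\<alpha> > 0" and \<beta>: "\<beta> > 0" and q: "q \<ge> 0"
    and stat: "asep_stationary n q \<alpha> \<beta> 0 0 \<mu>"
  shows "\<exists>c. \<forall>\<eta>\<in>configs n. pmf \<mu> \<eta> = c * gen_sum (n + 1) (1 / \<alpha>) (1 / \<beta>) q {1..n} (occupied n \<eta>)"
proof -
  let ?W = "\<lambda>\<eta>. gen_sum (n + 1) (1 / \<alpha>) (1 / \<beta>) q {1..n} (occupied n \<eta>)"
  let ?full = "\<lambda>i\<in>{1..n}. 1 :: nat"
  have "occupied n ?full = {1..n}" by (auto simp: occupied_def)
  then have pos: "?W ?full > 0" using gen_sum_full_pos[of "1 / \<alpha>" "1 / \<beta>" q n] \<alpha> \<beta> q by simp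
  \<comment> \<open>Makes the difference vanish at the full configuration, from which zeros spread
    to all predecessors.\<close>
  define c where "c = pmf \<mu> ?full / ?W ?full"
  have "pmf \<mu> \<eta> - c * ?W \<eta> = 0" if \<eta>: "\<eta> \<in> configs n" for \<eta>
  proof (rule generator_kernel_zero[OF finite_configs, where
        g = "\<lambda>\<eta>. pmf \<mu> \<eta> - c * ?W \<eta>" and x = \<eta> and r = "asep_rate n q \<alpha> \<beta> 0 0" and t = ?full and N = "\<lambda>\<eta>. \<Sum>i\<in>{1..n}. (1 - \<eta> i) * i"])
    fix \<zeta> assume \<zeta>: "\<zeta> \<in> configs n"
    have "(\<Sum>\<eta>\<in>configs n. pmf \<mu> \<eta> * asep_generator n q \<alpha> \<beta> 0 0 \<eta> \<zeta>) = 0"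
      using stat \<zeta> by (simp add: asep_stationary_def)
    moreover have "(\<Sum>\<eta>\<in>configs n. ?W \<eta> * asep_generator n q \<alpha> \<beta> 0 0 \<eta> \<zeta>) = 0"
      using gen_sum_kernel[OF n \<zeta>, of \<alpha> "1 / \<alpha>" \<beta> "1 / \<beta>" q] \<alpha> \<beta> by simp
    ultimately have "(\<Sum>\<eta>\<in>configs n. (pmf \<mu> \<eta> - c * ?W \<eta>) * asep_generator n q \<alpha> \<beta> 0 0 \<eta> \<zeta>) = 0"
      by (simp add: left_diff_distrib sum_subtractf mult.assoc sum_distrib_left[symmetric])
    then show "(\<Sum>\<eta>\<in>configs n. (pmf \<mu> \<eta> - c * ?W \<eta>) *
        (if \<eta> = \<zeta> then - (\<Sum>z\<in>configs n - {\<eta>}. asep_rate n q \<alpha> \<beta> 0 0 \<eta> z)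
         else asep_rate n q \<alpha> \<beta> 0 0 \<eta> \<zeta>)) = 0"
      by (simp add: asep_generator_def)
  next
    show "pmf \<mu> ?full - c * ?W ?full = 0" using pos by (simp add: c_def)
  qed (use asep_rate_nonneg[of q \<alpha> \<beta>] asep_descent[OF n \<alpha> \<beta> q] \<alpha> \<beta> q \<eta> in auto)
  then show ?thesis by (intro exI[of _ c]) simp
qed

section \<open>Trees of marked cycles\<close>

declare cycle_of_list.simps [simp del]

lemma cycle_of_list_nth:
  assumes "distinct u" "i < length u"
  shows "cycle_of_list u (u ! i) = u ! (Suc i mod length u)"
proof -
  have "map (cycle_of_list u) u ! i = rotate 1 u ! i"
    using cyclic_rotation[OF assms(1), of 1] by simp
  then show ?thesis using assms(2) nth_rotate[OF assms(2), of 1] by simp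
qed

lemma cycle_of_list_rotate: "distinct (A @ B) \<Longrightarrow> cycle_of_list (A @ B) = cycle_of_list (B @ A)"
  using cycle_of_list_rotate_independent[of "A @ B" "length A"] by (simp add: rotate_append)

lemma cycle_of_list_Cons: "distinct (a # w) \<Longrightarrow> cycle_of_list (a # w) a = hd (w @ [a])"
  using cycle_of_list_nth[of "a # w" 0] by (cases w) auto

text \<open>With \<open>a\<close> in front, the run reads \<open>w\<close> from left to right;
  \<open>\<not> Q a\<close> keeps it from wrapping around.\<close>

lemma reach_cycle_of_list:
  assumes d: "distinct (a # w)" and Q: "\<not> Q a"
  shows "reach Q (cycle_of_list (a # w)) a = set (takeWhile Q w)"
proof -
  let ?c = "cycle_of_list (a # w)"
  have c0: "?c a = hd (w @ [a])" by (rule cycle_of_list_Cons[OF d])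
  have c1: "?c (w ! i) = (if Suc i < length w then w ! Suc i else a)" if "i < length w" for i
    using cycle_of_list_nth[OF d, of "Suc i", unfolded nth_Cons_Suc] that by (cases "Suc i = length w") auto
  have sub: "reach Q ?c a \<subseteq> {w ! i | i. i < length w \<and> (\<forall>j\<le>i. Q (w ! j))}"
  proof
    fix b assume "b \<in> reach Q ?c a"
    then show "b \<in> {w ! i | i. i < length w \<and> (\<forall>j\<le>i. Q (w ! j))}"
    proof induction
      case start
      then have "w \<noteq> []" using c0 Q by (cases w) auto
      then have "?c a = w ! 0" "0 < length w" using c0 by (auto simp: hd_conv_nth nth_append)
      then show ?case using start by auto
    next
      case (step b)
      then obtain i where i: "b = w ! i" "i < length w" "\<forall>j\<le>i. Q (w ! j)" by auto
      have "Suc i < length w" using c1[OF i(2)] step.hyps(2) i(1) Q by (auto split: if_splits)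
      moreover have "\<forall>j\<le>Suc i. Q (w ! j)"
        using i(3) c1[OF i(2)] step.hyps(2) i(1) calculation by (auto simp: le_Suc_eq)
      ultimately show ?case using c1[OF i(2)] i(1) by auto
    qed
  qed
  have sup: "w ! i \<in> reach Q ?c a" if "i < length w" "\<forall>j\<le>i. Q (w ! j)" for i
    using that
  proof (induction i)
    case 0
    then show ?case using c0 reach.start[of Q ?c a] by (cases w) auto
  next
    case (Suc i)
    then show ?case using c1[of i] reach.step[of "w ! i" Q ?c a] by auto
  qed
  have eq: "set (takeWhile Q w) = {w ! i | i. i < length w \<and> (\<forall>j\<le>i. Q (w ! j))}"
  proof (intro equalityI subsetI)
    fix b assume "b \<in> set (takeWhile Q w)"
    then obtain i where i: "i < length (takeWhile Q w)" "b = takeWhile Q w ! i"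
      by (auto simp: in_set_conv_nth)
    have "Q (w ! j)" if "j \<le> i" for j
    proof -
      have "takeWhile Q w ! j \<in> set (takeWhile Q w)" using that i by simp
      then show ?thesis using that i by (metis le_less_trans set_takeWhileD takeWhile_nth)
    qed
    moreover have "i < length w" using i length_takeWhile_le[of Q w] by linarith
    ultimately show "b \<in> {w ! i | i. i < length w \<and> (\<forall>j\<le>i. Q (w ! j))}"
      using i by (auto simp: takeWhile_nth)
  next
    fix b assume "b \<in> {w ! i | i. i < length w \<and> (\<forall>j\<le>i. Q (w ! j))}"
    then obtain i where i: "b = w ! i" "i < length w" "\<forall>j\<le>i. Q (w ! j)" by auto
    have "i < length (takeWhile Q w)"
    proof (rule ccontr)
      assume "\<not> ?thesis"
      then have le: "length (takeWhile Q w) \<le> i" by simp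
      then have "\<not> Q (w ! length (takeWhile Q w))" using i(2) by (intro nth_length_takeWhile) simp
      then show False using i(3) le by blast
    qed
    then show "b \<in> set (takeWhile Q w)" using i(1) takeWhile_nth[of i Q w] by (metis nth_mem)
  qed
  show ?thesis
    unfolding eq
  proof (rule equalityI[OF sub], rule subsetI)
    fix b assume "b \<in> {w ! i | i. i < length w \<and> (\<forall>j\<le>i. Q (w ! j))}"
    then show "b \<in> reach Q ?c a" by (elim CollectE exE conjE) (simp add: sup)
  qed
qed

lemma run_parent_cycle_of_list:
  assumes P: "strict_total P" and d: "distinct (A @ a # B)"
  shows "run_parent P (cycle_of_list (A @ a # B)) a =
    (if P (hd (B @ A @ [a])) a then best P (set (takeWhile (\<lambda>b. P b a) (B @ A)))
     else best P\<inverse>\<inverse> (set (takeWhile (P a) (B @ A))))"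
proof -
  have c: "cycle_of_list (A @ a # B) = cycle_of_list (a # B @ A)"
    using cycle_of_list_rotate[OF d] by simp
  have d': "distinct (a # B @ A)" using d by auto
  have "\<not> P a a" by (rule strict_totalD(1)[OF P])
  then show ?thesis
    unfolding c run_parent_def cycle_of_list_Cons[OF d']
    using reach_cycle_of_list[OF d', of "\<lambda>b. P b a"] reach_cycle_of_list[OF d', of "P a"] by simp
qed

text \<open>The record \<open>x\<close> shields its block. A downward run of \<open>a\<close> stops
  before \<open>x\<close> in either cycle. An upward run that gets to \<open>x\<close> has
  \<open>x\<close> as its optimum: afterwards it meets only letters of \<open>B\<close> and stops at
  \<open>s\<close>, or, in the small cycle, only letters of \<open>V\<close>.\<close>

lemma run_parent_block:
  assumes P: "strict_total P" and d: "distinct (A @ (V @ [x]) @ B @ [s])"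
    and s: "\<And>y. y \<in> set (A @ (V @ [x]) @ B) \<Longrightarrow> P s y"
    and x: "\<And>y. y \<in> set V \<union> set B \<Longrightarrow> P y x" and a: "a \<in> set V"
  shows "run_parent P (cycle_of_list (A @ (V @ [x]) @ B @ [s])) a =
    run_parent P (cycle_of_list (V @ [x])) a"
proof -
  obtain V1 V2 where V: "V = V1 @ a # V2" using a by (auto dest: split_list)
  have u: "A @ (V @ [x]) @ B @ [s] = (A @ V1) @ a # (V2 @ x # B @ [s])" by (simp add: V)
  have v: "V @ [x] = V1 @ a # (V2 @ [x])" by (simp add: V)
  have du: "distinct ((A @ V1) @ a # (V2 @ x # B @ [s]))" using d by (auto simp: V)
  have dv: "distinct (V1 @ a # (V2 @ [x]))" using d by (auto simp: V)
  have Pax: "P a x" using x a by simp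
  have nax: "\<not> P x a" using Pax strict_totalD(4)[OF P] by blast
  have nas: "\<not> P a s" using s[of a] a strict_totalD(4)[OF P, of s a] by simp
  let ?Q = "\<lambda>b. P b a"
  have hd: "hd ((V2 @ x # B @ [s]) @ (A @ V1) @ [a]) = hd ((V2 @ [x]) @ V1 @ [a])"
    by (cases V2) auto
  have down: "takeWhile ?Q ((V2 @ x # B @ [s]) @ A @ V1) = takeWhile ?Q ((V2 @ [x]) @ V1)"
    using takeWhile_tail[of ?Q x V2] nax by simp
  have up: "best P\<inverse>\<inverse> (set (takeWhile (P a) ((V2 @ x # B @ [s]) @ A @ V1))) =
      best P\<inverse>\<inverse> (set (takeWhile (P a) ((V2 @ [x]) @ V1)))"
  proof (cases "\<forall>z\<in>set V2. P a z")
    case True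
    have best: "best P\<inverse>\<inverse> (set (V2 @ x # X)) = x" if "\<And>y. y \<in> set X \<Longrightarrow> P y x" for X
      using x that by (intro best_eqI[OF strict_total_conversep[OF P]]) (auto simp: V)
    have 1: "takeWhile (P a) ((V2 @ x # B @ [s]) @ A @ V1) = V2 @ x # takeWhile (P a) B"
      using True Pax takeWhile_tail[of "P a" s B "A @ V1"] nas by (simp add: takeWhile_append2)
    have 2: "takeWhile (P a) ((V2 @ [x]) @ V1) = V2 @ x # takeWhile (P a) V1"
      using True Pax by (simp add: takeWhile_append2)
    show ?thesis unfolding 1 2
      using best[of "takeWhile (P a) B"] best[of "takeWhile (P a) V1"] x
      by (metis UnCI Un_iff V set_append set_takeWhileD)
  next
    case False
    then obtain z where "z \<in> set V2" "\<not> P a z" by blast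
    then show ?thesis by (simp add: takeWhile_append1)
  qed
  have "run_parent P (cycle_of_list (V @ [x])) a =
      (if P (hd ((V2 @ [x]) @ V1 @ [a])) a then best P (set (takeWhile ?Q ((V2 @ [x]) @ V1)))
       else best P\<inverse>\<inverse> (set (takeWhile (P a) ((V2 @ [x]) @ V1))))"
    unfolding v by (rule run_parent_cycle_of_list[OF P dv])
  then show ?thesis
    unfolding u run_parent_cycle_of_list[OF P du] hd down up by (rule sym)
qed

text \<open>All letters from \<open>x\<close> to the end of the list precede the record
  \<open>x\<close>, so its run gets as far as \<open>s\<close>, which precedes everything.\<close>

lemma run_parent_record:
  assumes P: "strict_total P" and d: "distinct (A @ (V @ [x]) @ B @ [s])"
    and s: "\<And>y. y \<in> set (A @ (V @ [x]) @ B) \<Longrightarrow> P s y"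
    and x: "\<And>y. y \<in> set V \<union> set B \<Longrightarrow> P y x"
  shows "run_parent P (cycle_of_list (A @ (V @ [x]) @ B @ [s])) x = s"
proof -
  have u: "A @ (V @ [x]) @ B @ [s] = (A @ V) @ x # (B @ [s])" by simp
  have du: "distinct ((A @ V) @ x # (B @ [s]))" using d by simp
  have "P (hd ((B @ [s]) @ (A @ V) @ [x])) x" using x s by (cases B) auto
  moreover have "best P (set (takeWhile (\<lambda>b. P b x) ((B @ [s]) @ A @ V))) = s"
  proof (rule best_eqI[OF P])
    show "s \<in> set (takeWhile (\<lambda>b. P b x) ((B @ [s]) @ A @ V))"
      using x s by (simp add: takeWhile_append2)
    fix y assume "y \<in> set (takeWhile (\<lambda>b. P b x) ((B @ [s]) @ A @ V))"
    then have "y \<in> set ((B @ [s]) @ A @ V)" by (rule set_takeWhileD[THEN conjunct1])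
    then show "y = s \<or> P s y" using s by auto
  qed
  ultimately show ?thesis
    unfolding u run_parent_cycle_of_list[OF P du] by simp
qed

text \<open>A letter that is not a record fails against some letter to its right, which is, or is
  dominated by, the last letter of the first block. By transitivity that last letter also dominates
  the letter prepended to the block.\<close>

lemma record_split_block:
  assumes R: "strict_total R"
  shows "distinct W \<Longrightarrow> record_split R W = us1 @ v # us2 \<Longrightarrow>
    v \<noteq> [] \<and> (\<forall>y\<in>set (butlast v) \<union> set (concat us2). R (last v) y)"
proof (induction W arbitrary: us1 v us2)
  case (Cons a W)
  show ?case
  proof (cases "\<forall>y\<in>set W. R a y")
    case True
    then have eq: "[a] # record_split R W = us1 @ v # us2" using Cons.prems(2) by simp
    show ?thesis
    proof (cases us1)
      case Nil
      then have "v = [a]" "us2 = record_split R W" using eq by auto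
      then show ?thesis using True concat_record_split[of R W] by auto
    next
      case (Cons x us1')
      then have "record_split R W = us1' @ v # us2" using eq by simp
      then show ?thesis using Cons.IH Cons.prems by simp
    qed
  next
    case False
    then obtain y where y: "y \<in> set W" "\<not> R a y" by blast
    have "record_split R W \<noteq> []" using y concat_record_split[of R W] by auto
    then obtain w ws where ws: "record_split R W = w # ws" by (cases "record_split R W") auto
    then have "record_split R (a # W) = (a # w) # ws"
      unfolding record_split.simps if_not_P[OF False] by simp
    then have eq: "(a # w) # ws = us1 @ v # us2" using Cons.prems(2) by metis
    show ?thesis
    proof (cases us1)
      case Nil
      then have v: "v = a # w" "us2 = ws" using eq by auto
      have IH: "w \<noteq> [] \<and> (\<forall>y\<in>set (butlast w) \<union> set (concat ws). R (last w) y)"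
        using Cons.IH[of "[]" w ws] Cons.prems(1) ws by simp
      have "y \<noteq> a" using y Cons.prems(1) by auto
      then have ya: "R y a" using y strict_totalD(3)[OF R, of y a] by blast
      have "set W = set w \<union> set (concat ws)" using concat_record_split[of R W] ws by (metis concat.simps(2) set_append)
      moreover have "set w = insert (last w) (set (butlast w))"
        using IH by (metis append_butlast_last_id list.simps(15) rotate1.simps(2) set_rotate1)
      ultimately have "y = last w \<or> R (last w) y" using y(1) IH by blast
      then have "R (last w) a" using ya strict_totalD(2)[OF R, of "last w" y a] by blast
      then show ?thesis using v IH by auto
    next
      case (Cons x us1')
      then have "record_split R W = (w # us1') @ v # us2" using eq ws by simp
      moreover have "distinct W" using Cons.prems(1) by simp
      ultimately show ?thesis by (intro Cons.IH)
    qed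
  qed
qed simp

lemma cycle_of_list_not_fixed:
  assumes "distinct u" "2 \<le> length u" "a \<in> set u"
  shows "cycle_of_list u a \<noteq> a"
proof -
  obtain i where i: "i < length u" "a = u ! i" using assms(3) by (auto simp: in_set_conv_nth)
  have "Suc i mod length u \<noteq> i"
    using i assms(2) by (cases "Suc i = length u") auto
  moreover have "Suc i mod length u < length u" using i by (intro mod_less_divisor) auto
  ultimately show ?thesis
    using cycle_of_list_nth[OF assms(1) i(1)] i nth_eq_iff_index_eq[OF assms(1)] by auto
qed

lemma funpow_cycle_of_list:
  assumes d: "distinct u" "u \<noteq> []" and j: "j < length u"
  shows "(cycle_of_list u ^^ Suc j) (last u) = u ! j"
  using j
proof (induction j)
  case 0
  then show ?case
    using cycle_of_list_nth[OF d(1), of "length u - 1"] d by (simp add: last_conv_nth)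
next
  case (Suc j)
  then show ?case using cycle_of_list_nth[OF d(1), of j] by simp
qed

text \<open>A marked cycle is written as a list ending with the marked letter. Then its word is the
  list without the end, and the blocks of the factorization are already such lists for the
  subtrees.\<close>

lemma cycle_word_cycle_of_list:
  assumes "distinct u" "u \<noteq> []"
  shows "cycle_word (set u) (cycle_of_list u) (last u) = butlast u"
proof (rule nth_equalityI)
  show "length (cycle_word (set u) (cycle_of_list u) (last u)) = length (butlast u)"
    using assms by (simp add: cycle_word_def distinct_card)
  fix i assume "i < length (cycle_word (set u) (cycle_of_list u) (last u))"
  then have i: "Suc i < length u" using assms by (simp add: cycle_word_def distinct_card)
  then have "[1..<length u] ! i = Suc i" by (subst nth_upt) auto
  with i show "cycle_word (set u) (cycle_of_list u) (last u) ! i = butlast u ! i"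
    using funpow_cycle_of_list[OF assms, of i] assms
    by (simp add: cycle_word_def distinct_card nth_butlast)
qed

lemma root_cycle_tree: "root (cycle_tree S \<sigma> s) = s"
  by (subst cycle_tree.simps) simp

text \<open>One level of the recursion, in the order for which the root comes first: the last letter
  of a block gets the root as parent, the others keep the parent they have within their
  block.\<close>

lemma parent_pairs_cycle_tree_aux:
  assumes P: "strict_total P"
    and R: "record_split P\<inverse>\<inverse> (butlast u) = us"
    and d: "distinct u" "2 \<le> length u" and s: "\<And>y. y \<in> set (butlast u) \<Longrightarrow> P (last u) y"
    and IH: "\<And>v. v \<in> set us \<Longrightarrow> parent_pairs (T v) =
        {(a, run_parent P (cycle_of_list v) a) | a. a \<in> set (butlast v)}"
    and T: "\<And>v. root (T v) = last v"
  shows "parent_pairs (Node (last u) (map T us)) =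
    {(a, run_parent P (cycle_of_list u) a) | a. a \<in> set (butlast u)}"
proof -
  have "u \<noteq> []" using d by auto
  then have u: "u = butlast u @ [last u]" by simp
  have cc: "butlast u = concat us" using concat_record_split[of "P\<inverse>\<inverse>" "butlast u"] R by simp
  have block: "insert (last v, last u) {(a, run_parent P (cycle_of_list v) a) | a. a \<in> set (butlast v)} =
      {(a, run_parent P (cycle_of_list u) a) | a. a \<in> set v}" if v: "v \<in> set us" for v
  proof -
    obtain us1 us2 where us: "us = us1 @ v # us2" using v by (auto dest: split_list)
    have rb: "v \<noteq> []" "\<And>y. y \<in> set (butlast v) \<union> set (concat us2) \<Longrightarrow> P y (last v)"
      using record_split_block[OF strict_total_conversep[OF P], of "butlast u" us1 v us2] d(1) R us
      by (auto simp: distinct_butlast)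
    then have vv: "v = butlast v @ [last v]" by simp
    have uu: "u = concat us1 @ (butlast v @ [last v]) @ concat us2 @ [last u]"
      using u cc us vv by (metis append_assoc concat.simps(2) concat_append)
    have ss: "\<And>y. y \<in> set (concat us1 @ (butlast v @ [last v]) @ concat us2) \<Longrightarrow> P (last u) y"
      using s cc us vv by (metis append_assoc concat.simps(2) concat_append)
    have dd: "distinct (concat us1 @ (butlast v @ [last v]) @ concat us2 @ [last u])"
      using d(1) uu by metis
    have 1: "run_parent P (cycle_of_list u) a = run_parent P (cycle_of_list v) a" if "a \<in> set (butlast v)" for a
      using run_parent_block[OF P dd ss rb(2) that] uu vv by metis
    have 2: "run_parent P (cycle_of_list u) (last v) = last u"
      using run_parent_record[OF P dd ss rb(2)] uu by metis
    have "set v = insert (last v) (set (butlast v))" using vv by (metis Un_insert_right append_Nil2 list.simps(15) set_append sup_bot_right empty_set)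
    then show ?thesis using 1 2 by auto
  qed
  have "parent_pairs (Node (last u) (map T us)) =
      (\<Union>v\<in>set us. insert (last v, last u) {(a, run_parent P (cycle_of_list v) a) | a. a \<in> set (butlast v)})"
    using IH T by auto
  also have "\<dots> = (\<Union>v\<in>set us. {(a, run_parent P (cycle_of_list u) a) | a. a \<in> set v})"
    using block by simp
  also have "\<dots> = {(a, run_parent P (cycle_of_list u) a) | a. a \<in> set (butlast u)}"
    unfolding cc by auto
  finally show ?thesis .
qed

text \<open>Minima and maxima alternate between the levels, but away from fixed points
  \<open>run_parent\<close> does not depend on the direction of the order, so the induction can be
  phrased with \<open>(<)\<close> throughout.\<close>

lemma parent_pairs_cycle_tree:
  assumes "distinct u" "u \<noteq> []" "last u = Min (set u) \<or> last u = Max (set u)"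
  shows "parent_pairs (cycle_tree (set u) (cycle_of_list u) (last u)) =
    {(a, run_parent (<) (cycle_of_list u) a) | a. a \<in> set (butlast u)}"
  using assms
proof (induction "length u" arbitrary: u rule: less_induct)
  case less
  show ?case
  proof (cases "length u = 1")
    case True
    then obtain s where "u = [s]" by (auto simp: length_Suc_conv)
    then show ?thesis by (simp add: cycle_tree.simps)
  next
    case False
    have u2: "2 \<le> length u" using False less.prems(2) by (cases u) (auto simp: Suc_le_eq)
    have us: "u = butlast u @ [last u]" using less.prems(2) by simp
    have notin: "last u \<notin> set (butlast u)"
    proof -
      have "distinct (butlast u @ [last u])" using less.prems(1) us by simp
      then show ?thesis by simp
    qed
    have ne: "set u \<noteq> {last u}"
    proof
      assume "set u = {last u}"
      then have "card (set u) = card {last u}" by (rule arg_cong)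
      then show False using distinct_card[OF less.prems(1)] u2 by simp
    qed
    \<comment> \<open>The marked letter is \<open>P\<close>-first; the records of its word are those
      for the converse of \<open>P\<close>.\<close>
    define P :: "nat \<Rightarrow> nat \<Rightarrow> bool" where "P = (if last u = Min (set u) then (<) else (>))"
    have P: "strict_total P" by (simp add: P_def)
    have P': "P\<inverse>\<inverse> = (if last u = Min (set u) then (>) else (<))"
      by (simp add: P_def conversep_less_greater)
    have rp: "run_parent P (cycle_of_list v) a = run_parent (<) (cycle_of_list v) a"
      if "distinct v" "2 \<le> length v" "a \<in> set v" for v a
      using run_parent_conversep[of "(<)" "cycle_of_list v" a] cycle_of_list_not_fixed[OF that]
      by (simp add: P_def conversep_less_greater)
    let ?us = "record_split P\<inverse>\<inverse> (butlast u)"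
    let ?T = "\<lambda>v. cycle_tree (set v) (cycle_of_list v) (last v)"
    have s: "P (last u) y" if y: "y \<in> set (butlast u)" for y
    proof -
      have "y \<in> set u" using y by (rule in_set_butlastD)
      then have "Min (set u) \<le> y" "y \<le> Max (set u)" "y \<noteq> last u" using y notin by auto
      then show ?thesis using less.prems(3) by (auto simp: P_def)
    qed
    have tree: "?T u = Node (last u) (map ?T ?us)"
      using ne by (subst cycle_tree.simps) (simp add: P' cycle_word_cycle_of_list[OF less.prems(1,2)])
    have IH: "parent_pairs (?T v) = {(a, run_parent P (cycle_of_list v) a) | a. a \<in> set (butlast v)}"
      if v: "v \<in> set ?us" for v
    proof -
      have db: "distinct (butlast u)" using less.prems(1) by (simp add: distinct_butlast)
      obtain us1 us2 where split: "?us = us1 @ v # us2" using v by (auto dest: split_list)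
      have rb: "v \<noteq> []" "\<And>y. y \<in> set (butlast v) \<Longrightarrow> P y (last v)"
        using record_split_block[OF strict_total_conversep[OF P] db split] by auto
      have len: "length v < length u"
        using length_record_split[OF v] u2 by simp
      have "butlast u = concat us1 @ v @ concat us2"
        using concat_record_split[of "P\<inverse>\<inverse>" "butlast u"] split by simp
      then have dv: "distinct v" using db by simp
      have sv: "set v = insert (last v) (set (butlast v))"
        using rb(1) by (metis append_butlast_last_id list.simps(15) rotate1.simps(2) set_rotate1)
      have "last v = Min (set v) \<or> last v = Max (set v)"
      proof (cases "last u = Min (set u)")
        case True
        then have "\<forall>y\<in>set v. y \<le> last v" using rb(2) sv by (auto simp: P_def less_imp_le)
        then have "Max (set v) = last v" using rb(1) by (intro Max_eqI) auto
        then show ?thesis by simp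
      next
        case False
        then have "\<forall>y\<in>set v. last v \<le> y" using rb(2) sv by (auto simp: P_def less_imp_le)
        then have "Min (set v) = last v" using rb(1) by (intro Min_eqI) auto
        then show ?thesis by simp
      qed
      from less.hyps[OF len dv rb(1) this]
      have "parent_pairs (?T v) = {(a, run_parent (<) (cycle_of_list v) a) | a. a \<in> set (butlast v)}" .
      moreover have "run_parent P (cycle_of_list v) a = run_parent (<) (cycle_of_list v) a"
        if a: "a \<in> set (butlast v)" for a
      proof (rule rp[OF dv])
        show "2 \<le> length v" using a by (cases v; cases "tl v") auto
      qed (rule in_set_butlastD[OF a])
      ultimately show ?thesis by auto
    qed
    have "parent_pairs (?T u) = {(a, run_parent P (cycle_of_list u) a) | a. a \<in> set (butlast u)}"
      unfolding tree
      by (rule parent_pairs_cycle_tree_aux[OF P refl less.prems(1) u2 s IH root_cycle_tree])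
    moreover have "run_parent P (cycle_of_list u) a = run_parent (<) (cycle_of_list u) a"
      if "a \<in> set (butlast u)" for a
      by (rule rp[OF less.prems(1) u2 in_set_butlastD[OF that]])
    ultimately show ?thesis by auto
  qed
qed

section \<open>Colored permutations\<close>

lemma reach_cong_fun:
  assumes "a \<in> C" "\<And>x. x \<in> C \<Longrightarrow> f x = g x \<and> f x \<in> C"
  shows "reach Q f a = reach Q g a"
proof -
  have sub: "reach Q f a \<subseteq> reach Q g a" if eq: "\<forall>x\<in>C. f x = g x \<and> f x \<in> C" for f g
  proof
    fix b assume "b \<in> reach Q f a"
    then have "b \<in> reach Q g a \<and> b \<in> C"
    proof induction
      case start
      then show ?case using eq assms(1) reach.start[of Q g a] by auto
    next
      case (step b)
      then show ?case using eq reach.step[of b Q g a] by auto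
    qed
    then show "b \<in> reach Q g a" ..
  qed
  have "\<forall>x\<in>C. f x = g x \<and> f x \<in> C" "\<forall>x\<in>C. g x = f x \<and> g x \<in> C" using assms(2) by metis+
  then show ?thesis by (intro equalityI sub)
qed

lemma cycle_list_of_orbit:
  assumes \<sigma>: "\<sigma> permutes S" "finite S"
  obtains u where "distinct u" "u \<noteq> []" "set u = orbit \<sigma> s" "last u = s"
    "cycle_of_list u = perm_restrict \<sigma> (orbit \<sigma> s)"
proof -
  have perm: "permutation \<sigma>" using \<sigma> by (auto simp: permutation_permutes)
  have self: "s \<in> orbit \<sigma> s" by (rule permutation_self_in_orbit[OF perm])
  define d where "d = funpow_dist1 \<sigma> s s"
  have period: "(\<sigma> ^^ d) s = s" unfolding d_def by (rule funpow_dist1_prop[OF self])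
  have d0: "0 < d" by (simp add: d_def)
  have orb: "orbit \<sigma> s = (\<lambda>n. (\<sigma> ^^ n) s) ` {0..<d}"
    unfolding d_def by (rule orbit_conv_funpow_dist1[OF self])
  have card: "card (orbit \<sigma> s) = d"
    using card_image[OF inj_on_funpow_dist1[OF self]] unfolding orb d_def by simp
  \<comment> \<open>Running the exponents from 1 up to the period \<open>d\<close> puts
    \<open>s\<close> last.\<close>
  define u where "u = map (\<lambda>j. (\<sigma> ^^ j) s) [1..<Suc d]"
  have nth: "u ! i = (\<sigma> ^^ Suc i) s" if "i < d" for i
    using that by (simp add: u_def nth_append del: upt_Suc)
  have len: "length u = d" by (simp add: u_def)
  have set: "set u = orbit \<sigma> s"
  proof -
    have "set u = (\<lambda>n. (\<sigma> ^^ n) s) ` {1..<Suc d}" by (simp add: u_def del: upt_Suc)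
    also have "{1..<Suc d} = insert d {1..<d}" using d0 by auto
    also have "(\<lambda>n. (\<sigma> ^^ n) s) ` \<dots> = (\<lambda>n. (\<sigma> ^^ n) s) ` insert 0 {1..<d}" using period by simp
    also have "insert 0 {1..<d} = {0..<d}" using d0 by auto
    finally show ?thesis using orb by simp
  qed
  have dist: "distinct u" using card len set by (intro card_distinct) simp
  have ne: "u \<noteq> []" using len d0 by auto
  have last: "last u = s" using nth[of "d - 1"] len d0 period by (simp add: last_conv_nth[OF ne])
  have "cycle_of_list u x = perm_restrict \<sigma> (orbit \<sigma> s) x" for x
  proof (cases "x \<in> set u")
    case True
    then obtain i where i: "i < d" "x = u ! i" using len by (auto simp: in_set_conv_nth)
    have c: "cycle_of_list u x = u ! (Suc i mod d)"
      using cycle_of_list_nth[OF dist, of i] i len by simp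
    have "u ! (Suc i mod d) = \<sigma> x"
    proof (cases "Suc i = d")
      case True
      then have "x = s" using i nth period by simp
      moreover have "u ! 0 = \<sigma> s" using nth[of 0] d0 by simp
      ultimately show ?thesis using True by simp
    next
      case False
      then show ?thesis using i nth by simp
    qed
    then show ?thesis using c True set by (simp add: perm_restrict_simps)
  next
    case False
    then show ?thesis using set by (simp add: id_outside_supp perm_restrict_simps)
  qed
  then show thesis using that[OF dist ne set last] by blast
qed

lemma parent_pairs_orbit_tree:
  assumes \<sigma>: "\<sigma> permutes S" "finite S"
    and s: "s = Min (orbit \<sigma> s) \<or> s = Max (orbit \<sigma> s)"
  shows "parent_pairs (cycle_tree (orbit \<sigma> s) (perm_restrict \<sigma> (orbit \<sigma> s)) s) =
    {(a, run_parent (<) \<sigma> a) | a. a \<in> orbit \<sigma> s - {s}}"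
proof -
  let ?C = "orbit \<sigma> s"
  obtain u where u: "distinct u" "u \<noteq> []" "set u = ?C" "last u = s"
    "cycle_of_list u = perm_restrict \<sigma> ?C"
    by (rule cycle_list_of_orbit[OF \<sigma>])
  have "set (butlast u) = ?C - {s}"
  proof -
    have e: "butlast u @ [s] = u" using u(2) unfolding u(4)[symmetric] by simp
    have "distinct (butlast u @ [s])" "set (butlast u @ [s]) = ?C" unfolding e by (rule u(1), rule u(3))
    then show ?thesis by auto
  qed
  moreover have "run_parent (<) (perm_restrict \<sigma> ?C) a = run_parent (<) \<sigma> a" if a: "a \<in> ?C" for a
  proof -
    have "reach Q (perm_restrict \<sigma> ?C) a = reach Q \<sigma> a" for Q
      by (rule reach_cong_fun[OF a]) (auto simp: perm_restrict_simps orbit.step)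
    then show ?thesis using a by (simp add: run_parent_def perm_restrict_simps)
  qed
  ultimately show ?thesis
    using parent_pairs_cycle_tree[OF u(1,2)] s unfolding u(3,4,5) by auto
qed

definition zero_part :: "nat \<Rightarrow> (nat \<Rightarrow> nat) \<times> (nat \<Rightarrow> nat) \<Rightarrow> nat set" where
  "zero_part n = (\<lambda>(\<kappa>, \<sigma>). {a \<in> {1..n}. \<kappa> (Max (orbit \<sigma> a)) = 0})"

section \<open>The tree of a colored permutation in terms of runs\<close>

context
  fixes n :: nat and \<kappa> \<sigma> :: "nat \<Rightarrow> nat" and Z :: "nat set"
  assumes \<sigma>: "\<sigma> permutes {1..n}" and Z: "Z = zero_part n (\<kappa>, \<sigma>)"
begin

lemma orbit_in: "a \<in> {1..n} \<Longrightarrow> orbit \<sigma> a \<subseteq> {1..n}"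
  by (rule orbit_subset_permutes[OF \<sigma>])

lemma finite_orbit_n: "finite (orbit \<sigma> a)"
  using finite_orbit_permutes[OF \<sigma>] by simp

lemma self_in_orbit: "a \<in> orbit \<sigma> a"
  using \<sigma> by (intro permutation_self_in_orbit) (auto simp: permutation_permutes)

lemma orbit_eq: "b \<in> orbit \<sigma> a \<Longrightarrow> orbit \<sigma> b = orbit \<sigma> a"
  using cyclic_on_orbit[OF \<sigma>, of a] orbit_cyclic_eq3[of \<sigma> "orbit \<sigma> a" b] by simp

lemma Max_orbit: "Max (orbit \<sigma> a) \<in> orbit \<sigma> a" "b \<in> orbit \<sigma> a \<Longrightarrow> b \<le> Max (orbit \<sigma> a)"
  using finite_orbit_n self_in_orbit by (auto intro!: Max_in)

lemma Min_orbit: "Min (orbit \<sigma> a) \<in> orbit \<sigma> a" "b \<in> orbit \<sigma> a \<Longrightarrow> Min (orbit \<sigma> a) \<le> b"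
  using finite_orbit_n self_in_orbit by (auto intro!: Min_in)

lemma mem_Z_orbit: "b \<in> orbit \<sigma> a \<Longrightarrow> a \<in> {1..n} \<Longrightarrow> b \<in> Z \<longleftrightarrow> a \<in> Z"
  using orbit_eq[of b a] orbit_in[of a] by (auto simp: Z zero_part_def)

lemma zero_part_marked: "(\<sigma>, Z) \<in> marked_perms {1..n}"
proof -
  have "\<sigma> a \<in> Z \<longleftrightarrow> a \<in> Z" for a
  proof (cases "a \<in> {1..n}")
    case True
    then show ?thesis using mem_Z_orbit[OF orbit.base True] by simp
  qed (use \<sigma> in \<open>simp add: permutes_not_in\<close>)
  moreover have "Z \<subseteq> {1..n}" by (auto simp: Z zero_part_def)
  ultimately show ?thesis using \<sigma> unfolding marked_perms_def by blast
qed

lemma cycle_root_less_iff: "cycle_root (<) \<sigma> Y a \<longleftrightarrow> a \<in> Y \<and> Max (orbit \<sigma> a) = a"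
proof -
  have "(\<forall>b\<in>orbit \<sigma> a. b = a \<or> b < a) \<longleftrightarrow> Max (orbit \<sigma> a) = a"
  proof
    assume "\<forall>b\<in>orbit \<sigma> a. b = a \<or> b < a"
    then show "Max (orbit \<sigma> a) = a"
      using finite_orbit_n self_in_orbit by (intro Max_eqI) auto
  next
    assume M: "Max (orbit \<sigma> a) = a"
    show "\<forall>b\<in>orbit \<sigma> a. b = a \<or> b < a"
    proof
      fix b assume "b \<in> orbit \<sigma> a"
      from Max_orbit(2)[OF this] M show "b = a \<or> b < a" by auto
    qed
  qed
  then show ?thesis by (simp add: cycle_root_def)
qed

lemma cycle_root_greater_iff: "cycle_root (>) \<sigma> Y a \<longleftrightarrow> a \<in> Y \<and> Min (orbit \<sigma> a) = a"
proof -
  have "(\<forall>b\<in>orbit \<sigma> a. b = a \<or> a < b) \<longleftrightarrow> Min (orbit \<sigma> a) = a"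
  proof
    assume "\<forall>b\<in>orbit \<sigma> a. b = a \<or> a < b"
    then show "Min (orbit \<sigma> a) = a"
      using finite_orbit_n self_in_orbit by (intro Min_eqI) auto
  next
    assume M: "Min (orbit \<sigma> a) = a"
    show "\<forall>b\<in>orbit \<sigma> a. b = a \<or> a < b"
    proof
      fix b assume "b \<in> orbit \<sigma> a"
      from Min_orbit(2)[OF this] M show "b = a \<or> a < b" by auto
    qed
  qed
  then show ?thesis by (simp add: cycle_root_def)
qed

lemma zero_cycle_iff: "a \<in> {1..n} \<Longrightarrow> orbit \<sigma> a \<in> zero_cycles n (\<kappa>, \<sigma>) \<longleftrightarrow> a \<in> Z"
  by (auto simp: zero_cycles_def Z zero_part_def)

lemma nonzero_cycle_iff: "a \<in> {1..n} \<Longrightarrow> orbit \<sigma> a \<in> nonzero_cycles n (\<kappa>, \<sigma>) \<longleftrightarrow> a \<notin> Z"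
  by (auto simp: nonzero_cycles_def Z zero_part_def)

text \<open>The representative \<open>M\<close> is left open because cycles outside \<open>Z\<close>
  are counted both by their minima, which are roots in the tree, and by their maxima, which carry
  the decisive color.\<close>

lemma card_cycles:
  assumes "\<And>C. C \<in> X \<Longrightarrow> \<exists>a\<in>{1..n}. C = orbit \<sigma> a"
    and X: "\<And>a. a \<in> {1..n} \<Longrightarrow> orbit \<sigma> a \<in> X \<longleftrightarrow> a \<in> Y"
    and M: "\<And>a. M (orbit \<sigma> a) \<in> orbit \<sigma> a"
  shows "card X = card {a \<in> {1..n}. a \<in> Y \<and> M (orbit \<sigma> a) = a}"
    and "M ` X = {a \<in> {1..n}. a \<in> Y \<and> M (orbit \<sigma> a) = a}"
proof -
  have inj: "inj_on M X"
  proof (rule inj_onI)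
    fix C C' assume C: "C \<in> X" "C' \<in> X" "M C = M C'"
    then obtain a a' where a: "C = orbit \<sigma> a" "C' = orbit \<sigma> a'" using assms(1)[OF C(1)] assms(1)[OF C(2)] by auto
    have "orbit \<sigma> (M C) = C" unfolding a(1) by (rule orbit_eq[OF M])
    moreover have "orbit \<sigma> (M C') = C'" unfolding a(2) by (rule orbit_eq[OF M])
    ultimately show "C = C'" using C(3) by metis
  qed
  show im: "M ` X = {a \<in> {1..n}. a \<in> Y \<and> M (orbit \<sigma> a) = a}"
  proof (intro equalityI subsetI)
    fix m assume "m \<in> M ` X"
    then obtain a where a: "a \<in> {1..n}" "orbit \<sigma> a \<in> X" "m = M (orbit \<sigma> a)" using assms(1) by blast
    have m: "m \<in> orbit \<sigma> a" using M a(3) by simp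
    then have "m \<in> {1..n}" "orbit \<sigma> m = orbit \<sigma> a" using orbit_in[OF a(1)] orbit_eq[OF m] by auto
    then show "m \<in> {a \<in> {1..n}. a \<in> Y \<and> M (orbit \<sigma> a) = a}" using a X[of m] by simp
  next
    fix a assume "a \<in> {a \<in> {1..n}. a \<in> Y \<and> M (orbit \<sigma> a) = a}"
    then show "a \<in> M ` X" using X[of a] by (metis (mono_tags, lifting) image_eqI mem_Collect_eq)
  qed
  show "card X = card {a \<in> {1..n}. a \<in> Y \<and> M (orbit \<sigma> a) = a}"
    using card_image[OF inj] im by simp
qed

lemma zc_eq: "zc n (\<kappa>, \<sigma>) = card {a \<in> {1..n}. cycle_root (<) \<sigma> Z a}"
  and Max_zero_cycles: "Max ` zero_cycles n (\<kappa>, \<sigma>) = {a \<in> {1..n}. cycle_root (<) \<sigma> Z a}"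
  using card_cycles[of "zero_cycles n (\<kappa>, \<sigma>)" Z Max, OF _ zero_cycle_iff Max_orbit(1)]
  by (auto simp: zc_def cycle_root_less_iff zero_cycles_def)

lemma nc_eq: "nc n (\<kappa>, \<sigma>) = card {a \<in> {1..n}. cycle_root (>) \<sigma> (- Z) a}"
  and Min_nonzero_cycles: "Min ` nonzero_cycles n (\<kappa>, \<sigma>) = {a \<in> {1..n}. cycle_root (>) \<sigma> (- Z) a}"
  using card_cycles[of "nonzero_cycles n (\<kappa>, \<sigma>)" "- Z" Min, OF _ _ Min_orbit(1)] nonzero_cycle_iff
  by (auto simp: nc_def cycle_root_greater_iff nonzero_cycles_def)

lemma nc_eq_Max: "nc n (\<kappa>, \<sigma>) = card {a \<in> {1..n}. a \<notin> Z \<and> Max (orbit \<sigma> a) = a}"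
  using card_cycles(1)[of "nonzero_cycles n (\<kappa>, \<sigma>)" "- Z" Max, OF _ _ Max_orbit(1)] nonzero_cycle_iff
  by (auto simp: nc_def nonzero_cycles_def)

text \<open>A fixed point is the maximum of its own cycle, so its color decides whether it lies in
  \<open>Z\<close>.\<close>

lemma excedance_set_eq: "excedance_set n (\<kappa>, \<sigma>) = up_set {1..n} (\<sigma>, Z)"
proof -
  have "i \<notin> Z \<longleftrightarrow> \<kappa> i \<noteq> 0" if "i \<in> {1..n}" "\<sigma> i = i" for i
  proof -
    have "orbit \<sigma> i = {i}" using that by (simp add: orbit_eq_singleton_iff)
    then show ?thesis using that by (simp add: Z zero_part_def)
  qed
  then show ?thesis by (auto simp: excedance_set_def up_set_def)
qed

text \<open>Within a cycle only the marked letter is a root in the sense of \<open>par\<close>, so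
  all others keep their run parent. Every cycle has such a root, its maximum or minimum according to
  \<open>Z\<close>, so every letter is covered.\<close>

lemma parent_pairs_perm_tree:
  "parent_pairs (perm_tree n (\<kappa>, \<sigma>)) =
    insert (n + 1, 0) {(a, par (<) 0 (n + 1) \<sigma> Z a) | a. a \<in> {1..n}}"
proof -
  let ?T = "\<lambda>s. cycle_tree (orbit \<sigma> s) (perm_restrict \<sigma> (orbit \<sigma> s)) s"
  let ?A = "{a \<in> {1..n}. cycle_root (<) \<sigma> Z a}" and ?B = "{a \<in> {1..n}. cycle_root (>) \<sigma> (- Z) a}"
  let ?p = "par (<) 0 (n + 1) \<sigma> Z"
  have "set (sorted_list_of_set (Max ` zero_cycles n (\<kappa>, \<sigma>))) = ?A"
    "set (sorted_list_of_set (Min ` nonzero_cycles n (\<kappa>, \<sigma>))) = ?B"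
    unfolding Max_zero_cycles Min_nonzero_cycles by simp_all
  then have eq: "parent_pairs (perm_tree n (\<kappa>, \<sigma>)) = insert (n + 1, 0)
      ((\<Union>s\<in>?B. insert (s, n + 1) (parent_pairs (?T s))) \<union> (\<Union>s\<in>?A. insert (s, 0) (parent_pairs (?T s))))"
    by (auto simp: perm_tree_def Let_def root_cycle_tree)
  have pp: "parent_pairs (?T s) = {(a, run_parent (<) \<sigma> a) | a. a \<in> orbit \<sigma> s - {s}}"
    if "s \<in> ?A \<union> ?B" for s
    by (rule parent_pairs_orbit_tree[OF \<sigma>]) (use that in \<open>auto simp: cycle_root_less_iff cycle_root_greater_iff\<close>)
  have not_root: "\<not> cycle_root (<) \<sigma> Z a \<and> \<not> cycle_root (>) \<sigma> (- Z) a"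
    if s: "s \<in> ?A \<union> ?B" and a: "a \<in> orbit \<sigma> s - {s}" for a s
    using s a orbit_eq[of a s] mem_Z_orbit[of a s]
    by (auto simp: cycle_root_less_iff cycle_root_greater_iff)
  have pA: "?p s = 0" if "s \<in> ?A" for s using that by (simp add: par_def)
  have pB: "?p s = n + 1" if "s \<in> ?B" for s
    using that by (auto simp: par_def conversep_less_greater cycle_root_def)
  have block: "insert (s, ?p s) (parent_pairs (?T s)) = {(a, ?p a) | a. a \<in> orbit \<sigma> s}"
    if s: "s \<in> ?A \<union> ?B" for s
  proof -
    have "run_parent (<) \<sigma> a = ?p a" if "a \<in> orbit \<sigma> s - {s}" for a
      using not_root[OF s that] by (simp add: par_def conversep_less_greater)
    then have "parent_pairs (?T s) = (\<lambda>a. (a, ?p a)) ` (orbit \<sigma> s - {s})"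
      unfolding pp[OF s] Setcompr_eq_image by (intro image_cong) simp_all
    then have "insert (s, ?p s) (parent_pairs (?T s)) = (\<lambda>a. (a, ?p a)) ` insert s (orbit \<sigma> s - {s})"
      by (simp only: image_insert)
    then show ?thesis unfolding insert_Diff[OF self_in_orbit] Setcompr_eq_image .
  qed
  have cover: "(\<Union>s\<in>?A \<union> ?B. orbit \<sigma> s) = {1..n}"
  proof (intro equalityI subsetI)
    fix a assume a: "a \<in> {1..n}"
    let ?s = "if a \<in> Z then Max (orbit \<sigma> a) else Min (orbit \<sigma> a)"
    have s: "?s \<in> orbit \<sigma> a" using Max_orbit Min_orbit by simp
    have "?s \<in> {1..n}" "orbit \<sigma> ?s = orbit \<sigma> a" "?s \<in> Z \<longleftrightarrow> a \<in> Z"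
      using s orbit_in[OF a] orbit_eq[OF s] mem_Z_orbit[OF s a] by auto
    then have "?s \<in> ?A \<union> ?B" by (auto simp: cycle_root_less_iff cycle_root_greater_iff split: if_splits)
    then show "a \<in> (\<Union>s\<in>?A \<union> ?B. orbit \<sigma> s)" using \<open>orbit \<sigma> ?s = orbit \<sigma> a\<close> self_in_orbit[of a] by blast
  qed (use orbit_in in blast)
  have "(\<Union>s\<in>?B. insert (s, n + 1) (parent_pairs (?T s))) \<union> (\<Union>s\<in>?A. insert (s, 0) (parent_pairs (?T s)))
      = (\<Union>s\<in>?B. insert (s, ?p s) (parent_pairs (?T s))) \<union> (\<Union>s\<in>?A. insert (s, ?p s) (parent_pairs (?T s)))"
    using pA pB by simp
  also have "\<dots> = (\<Union>s\<in>?A \<union> ?B. insert (s, ?p s) (parent_pairs (?T s)))" by blast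
  also have "\<dots> = (\<Union>s\<in>?A \<union> ?B. {(a, ?p a) | a. a \<in> orbit \<sigma> s})" using block by simp
  also have "\<dots> = {(a, ?p a) | a. a \<in> (\<Union>s\<in>?A \<union> ?B. orbit \<sigma> s)}" by blast
  finally show ?thesis unfolding eq cover by simp
qed

lemma yy_eq: "yy n (\<kappa>, \<sigma>) = card (crossings {1..n} (par (<) 0 (n + 1) \<sigma> Z))"
proof -
  have "parent (perm_tree n (\<kappa>, \<sigma>)) i = par (<) 0 (n + 1) \<sigma> Z i" if "i \<in> {1..n}" for i
    unfolding parent_def parent_pairs_perm_tree using that by (intro the_equality) auto
  then have "crossings {1..n} (parent (perm_tree n (\<kappa>, \<sigma>))) = crossings {1..n} (par (<) 0 (n + 1) \<sigma> Z)"
    by (rule crossings_cong)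
  moreover have "{(i, j). 1 \<le> i \<and> i < j \<and> j \<le> n \<and> p j < i \<and> j < p i} = crossings {1..n} p" for p
    by (auto simp: crossings_def)
  ultimately show ?thesis by (simp only: yy_def Let_def)
qed

end

section \<open>Summation over colorings\<close>

lemma power_card_eq_prod:
  fixes c :: real
  shows "finite S \<Longrightarrow> c ^ card {x \<in> S. R x} = (\<Prod>x\<in>S. if R x then c else 1)"
  by (simp add: prod.If_cases Int_def)

text \<open>Only the colors of the cycle maxima are constrained by \<open>Z\<close>.\<close>

lemma colorings_of_zero_part:
  assumes m: "(\<sigma>, Z) \<in> marked_perms {1..n}"
  shows "{\<kappa> \<in> {1..n} \<rightarrow>\<^sub>E {0..<r}. zero_part n (\<kappa>, \<sigma>) = Z} =
    (\<Pi>\<^sub>E a\<in>{1..n}. if Max (orbit \<sigma> a) = a then (if a \<in> Z then {0..<r} \<inter> {0} else {0..<r} - {0}) else {0..<r})"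
    (is "?L = ?R")
proof -
  have \<sigma>: "\<sigma> permutes {1..n}" and Zn: "Z \<subseteq> {1..n}" and inv: "\<And>a. \<sigma> a \<in> Z \<longleftrightarrow> a \<in> Z"
    using m by (auto simp: marked_perms_def)
  have inv_orbit: "b \<in> Z \<longleftrightarrow> a \<in> Z" if "b \<in> orbit \<sigma> a" for a b
    using that by induction (auto simp: inv)
  note Mx = Max_orbit(1)[OF \<sigma> refl] and oe = orbit_eq[OF \<sigma> refl]
  have zp: "zero_part n (\<kappa>, \<sigma>) = Z \<longleftrightarrow> (\<forall>a\<in>{1..n}. Max (orbit \<sigma> a) = a \<longrightarrow> (\<kappa> a = 0 \<longleftrightarrow> a \<in> Z))" for \<kappa>
  proof
    assume "zero_part n (\<kappa>, \<sigma>) = Z"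
    then show "\<forall>a\<in>{1..n}. Max (orbit \<sigma> a) = a \<longrightarrow> (\<kappa> a = 0 \<longleftrightarrow> a \<in> Z)" by (auto simp: zero_part_def)
  next
    assume R: "\<forall>a\<in>{1..n}. Max (orbit \<sigma> a) = a \<longrightarrow> (\<kappa> a = 0 \<longleftrightarrow> a \<in> Z)"
    have "\<kappa> (Max (orbit \<sigma> a)) = 0 \<longleftrightarrow> a \<in> Z" if a: "a \<in> {1..n}" for a
    proof -
      let ?m = "Max (orbit \<sigma> a)"
      have "?m \<in> {1..n}" using Mx[of a] orbit_in[OF \<sigma> refl a] by auto
      moreover have "Max (orbit \<sigma> ?m) = ?m" using oe[OF Mx[of a]] by simp
      ultimately show ?thesis using R inv_orbit[OF Mx[of a]] by blast
    qed
    then show "zero_part n (\<kappa>, \<sigma>) = Z" using Zn unfolding zero_part_def by blast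
  qed
  have "?L = {\<kappa> \<in> {1..n} \<rightarrow>\<^sub>E {0..<r}. \<forall>a\<in>{1..n}. Max (orbit \<sigma> a) = a \<longrightarrow> (\<kappa> a = 0 \<longleftrightarrow> a \<in> Z)}"
    by (simp only: zp)
  also have "\<dots> = ?R"
  proof (rule set_eqI)
    fix \<kappa> :: "nat \<Rightarrow> nat"
    have "\<kappa> a \<in> {0..<r} \<and> (Max (orbit \<sigma> a) = a \<longrightarrow> (\<kappa> a = 0 \<longleftrightarrow> a \<in> Z)) \<longleftrightarrow>
      \<kappa> a \<in> (if Max (orbit \<sigma> a) = a then (if a \<in> Z then {0..<r} \<inter> {0} else {0..<r} - {0}) else {0..<r})" for a
      by (cases "Max (orbit \<sigma> a) = a"; cases "a \<in> Z") simp_all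
    then show "\<kappa> \<in> {\<kappa> \<in> {1..n} \<rightarrow>\<^sub>E {0..<r}. \<forall>a\<in>{1..n}. Max (orbit \<sigma> a) = a \<longrightarrow> (\<kappa> a = 0 \<longleftrightarrow> a \<in> Z)} \<longleftrightarrow> \<kappa> \<in> ?R"
      unfolding PiE_iff mem_Collect_eq by blast
  qed
  finally show ?thesis .
qed

text \<open>Each letter yields one factor r: a letter that is not maximal in its cycle has r colors;
  the maximum of a zero cycle has one color and the r of r / \<alpha>; the maximum of a non-zero
  cycle has r - 1 colors, which reduce r / ((r - 1) \<beta>) to r / \<beta>.\<close>

lemma sum_colored_perms:
  assumes r: "r \<ge> 2" and \<alpha>: "\<alpha> > 0" and \<beta>: "\<beta> > 0"
  shows "(\<Sum>\<pi>\<in>colored_perms r n.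
      (real r / \<alpha>) ^ zc n \<pi> * (real r / ((real r - 1) * \<beta>)) ^ nc n \<pi>
        * q ^ yy n \<pi> * (\<Prod>i\<in>excedance_set n \<pi>. x i)) =
    real r ^ n * (\<Sum>\<pi>\<in>marked_perms {1..n}. weight (n + 1) (1 / \<alpha>) (1 / \<beta>) q {1..n} \<pi> * (\<Prod>i\<in>up_set {1..n} \<pi>. x i))"
    (is "sum ?f _ = _ * sum ?g _")
proof -
  let ?h = "\<lambda>\<pi>. (snd \<pi>, zero_part n \<pi>)"
  have fin: "finite (colored_perms r n)"
    unfolding colored_perms_def by (intro finite_cartesian_product finite_PiE finite_permutations) auto
  have im: "?h ` colored_perms r n \<subseteq> marked_perms {1..n}"
    using zero_part_marked by (fastforce simp: colored_perms_def)
  have "sum ?f (colored_perms r n) =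
      (\<Sum>\<rho>\<in>marked_perms {1..n}. \<Sum>\<pi> | \<pi> \<in> colored_perms r n \<and> ?h \<pi> = \<rho>. ?f \<pi>)"
    using sum.group[OF fin finite_marked_perms[of "{1..n}"] im, of ?f] by simp
  also have "\<dots> = (\<Sum>\<rho>\<in>marked_perms {1..n}. real r ^ n * ?g \<rho>)"
  proof (rule sum.cong[OF refl])
    fix \<rho> assume \<rho>: "\<rho> \<in> marked_perms {1..n}"
    obtain \<sigma> Z where \<rho>_eq: "\<rho> = (\<sigma>, Z)" by (cases \<rho>)
    have \<sigma>: "\<sigma> permutes {1..n}" using \<rho> \<rho>_eq by (auto simp: marked_perms_def)
    let ?K = "{\<kappa> \<in> {1..n} \<rightarrow>\<^sub>E {0..<r}. zero_part n (\<kappa>, \<sigma>) = Z}"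
    let ?zm = "\<lambda>a. cycle_root (<) \<sigma> Z a" and ?nm = "\<lambda>a. a \<notin> Z \<and> Max (orbit \<sigma> a) = a"
    let ?nz = "card {a \<in> {1..n}. ?zm a}" and ?nn = "card {a \<in> {1..n}. ?nm a}"
    let ?P = "q ^ card (crossings {1..n} (par (<) 0 (n + 1) \<sigma> Z)) * (\<Prod>i\<in>up_set {1..n} \<rho>. x i)"
    have set: "{\<pi>. \<pi> \<in> colored_perms r n \<and> ?h \<pi> = \<rho>} = (\<lambda>\<kappa>. (\<kappa>, \<sigma>)) ` ?K"
      using \<sigma> by (auto simp: colored_perms_def \<rho>_eq)
    have summand: "?f (\<kappa>, \<sigma>) = (real r / \<alpha>) ^ ?nz * (real r / ((real r - 1) * \<beta>)) ^ ?nn * ?P"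
      if "\<kappa> \<in> ?K" for \<kappa>
    proof -
      have Z: "Z = zero_part n (\<kappa>, \<sigma>)" using that by simp
      show ?thesis
        by (simp only: zc_eq[OF \<sigma> Z] nc_eq_Max[OF \<sigma> Z] yy_eq[OF \<sigma> Z] excedance_set_eq[OF \<sigma> Z]
          \<rho>_eq mult.assoc)
    qed
    have "(\<Sum>\<pi> | \<pi> \<in> colored_perms r n \<and> ?h \<pi> = \<rho>. ?f \<pi>) = (\<Sum>\<kappa>\<in>?K. ?f (\<kappa>, \<sigma>))"
      unfolding set by (subst sum.reindex) (auto simp: inj_on_def)
    also have "\<dots> = real (card ?K) * ((real r / \<alpha>) ^ ?nz * (real r / ((real r - 1) * \<beta>)) ^ ?nn * ?P)"
      using summand by simp
    also have "\<dots> = (real (card ?K) * (real r / \<alpha>) ^ ?nz * (real r / ((real r - 1) * \<beta>)) ^ ?nn) * ?P"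
      by (simp only: mult.assoc)
    also have "real (card ?K) * (real r / \<alpha>) ^ ?nz * (real r / ((real r - 1) * \<beta>)) ^ ?nn =
        real r ^ n * (1 / \<alpha>) ^ ?nz * (1 / \<beta>) ^ ?nn"
    proof -
      have zm: "?zm a \<longleftrightarrow> a \<in> Z \<and> Max (orbit \<sigma> a) = a" for a
        using cycle_root_less_iff[OF \<sigma> refl] by simp
      have K: "real (card ?K) = (\<Prod>a\<in>{1..n}. if ?zm a then 1 else if ?nm a then real r - 1 else real r)"
        using r unfolding colorings_of_zero_part[OF \<rho>[unfolded \<rho>_eq]]
        by (subst card_PiE) (auto simp: zm intro!: prod.cong)
      have rn: "real r ^ n = (\<Prod>a\<in>{1..n}. real r)" by simp
      show ?thesis
        unfolding K rn power_card_eq_prod[OF finite_atLeastAtMost] prod.distrib[symmetric]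
        using r \<alpha> \<beta> by (intro prod.cong) (auto simp: zm)
    qed
    also have "real r ^ n * (1 / \<alpha>) ^ ?nz * (1 / \<beta>) ^ ?nn * ?P = real r ^ n * ?g \<rho>"
    proof -
      \<comment> \<open>The facts about cycles are stated for the zero part of a coloring; the
        colors 0 and 1 already realize every \<open>Z\<close>.\<close>
      have ex: "\<exists>\<kappa>. Z = zero_part n (\<kappa>, \<sigma>)"
      proof -
        have "(\<lambda>a\<in>{1..n}. if a \<in> Z then 0 else 1) \<in> {\<kappa> \<in> {1..n} \<rightarrow>\<^sub>E {0..<2}. zero_part n (\<kappa>, \<sigma>) = Z}"
          unfolding colorings_of_zero_part[OF \<rho>[unfolded \<rho>_eq]] by auto
        then show ?thesis by blast
      qed
      then obtain \<kappa> where Z: "Z = zero_part n (\<kappa>, \<sigma>)" by blast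
      have "?nn = card {a \<in> {1..n}. cycle_root (>) \<sigma> (- Z) a}"
        using nc_eq[OF \<sigma> Z] nc_eq_Max[OF \<sigma> Z] by simp
      then show ?thesis by (simp add: \<rho>_eq weight_def mult.assoc)
    qed
    finally show "(\<Sum>\<pi> | \<pi> \<in> colored_perms r n \<and> ?h \<pi> = \<rho>. ?f \<pi>) = real r ^ n * ?g \<rho>" .
  qed
  finally show ?thesis by (simp add: sum_distrib_left)
qed

lemma sum_configs_gen_sum:
  "(\<Sum>\<eta>\<in>configs n. gen_sum N a b q {1..n} (occupied n \<eta>) * (\<Prod>i\<in>{1..n}. x i ^ \<eta> i)) =
    (\<Sum>\<pi>\<in>marked_perms {1..n}. weight N a b q {1..n} \<pi> * (\<Prod>i\<in>up_set {1..n} \<pi>. x i))"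
proof -
  let ?G = "\<lambda>H. gen_sum N a b q {1..n} H * (\<Prod>i\<in>H. x i)"
  have "(\<Sum>\<eta>\<in>configs n. gen_sum N a b q {1..n} (occupied n \<eta>) * (\<Prod>i\<in>{1..n}. x i ^ \<eta> i)) =
      (\<Sum>\<eta>\<in>configs n. ?G (occupied n \<eta>))"
  proof (intro sum.cong refl arg_cong2[of _ _ _ _ "(*)"])
    fix \<eta> assume "\<eta> \<in> configs n"
    then have "x i ^ \<eta> i = (if i \<in> occupied n \<eta> then x i else 1)" if "i \<in> {1..n}" for i
      using configs_01[of \<eta> n i] that by (auto simp: occupied_def)
    then have "(\<Prod>i\<in>{1..n}. x i ^ \<eta> i) = (\<Prod>i\<in>{1..n}. if i \<in> occupied n \<eta> then x i else 1)"
      by (intro prod.cong) auto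
    also have "\<dots> = (\<Prod>i\<in>occupied n \<eta>. x i)"
      by (simp add: prod.If_cases) (rule prod.cong, auto simp: occupied_def)
    finally show "(\<Prod>i\<in>{1..n}. x i ^ \<eta> i) = (\<Prod>i\<in>occupied n \<eta>. x i)" .
  qed
  also have "\<dots> = (\<Sum>H\<in>Pow {1..n}. ?G H)"
  proof (rule sum.reindex_bij_betw)
    show "bij_betw (occupied n) (configs n) (Pow {1..n})"
    proof (rule bij_betw_byWitness[where f' = "\<lambda>H. \<lambda>i\<in>{1..n}. if i \<in> H then 1 else 0"])
      show "\<forall>\<eta>\<in>configs n. (\<lambda>i\<in>{1..n}. if i \<in> occupied n \<eta> then 1 else 0) = \<eta>"
      proof (intro ballI ext)
        fix \<eta> i assume \<eta>: "\<eta> \<in> configs n"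
        show "(\<lambda>i\<in>{1..n}. if i \<in> occupied n \<eta> then 1 else 0) i = \<eta> i"
          using configs_01[OF \<eta>, of i] \<eta>
          by (cases "i \<in> {1..n}") (auto simp: occupied_def configs_def PiE_def extensional_def)
      qed
    qed (auto simp: occupied_def configs_def split: if_splits)
  qed
  also have "\<dots> = (\<Sum>H\<in>Pow {1..n}. \<Sum>\<pi> | \<pi> \<in> marked_perms {1..n} \<and> up_set {1..n} \<pi> = H.
      weight N a b q {1..n} \<pi> * (\<Prod>i\<in>up_set {1..n} \<pi>. x i))"
    by (intro sum.cong) (auto simp: gen_sum_def sum_distrib_right)
  also have "\<dots> = (\<Sum>\<pi>\<in>marked_perms {1..n}. weight N a b q {1..n} \<pi> * (\<Prod>i\<in>up_set {1..n} \<pi>. x i))"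
    by (rule sum.group) (auto simp: finite_marked_perms up_set_def)
  finally show ?thesis .
qed

theorem theorem4p3:
  fixes n r :: nat and \<alpha> \<beta> q :: real and \<mu> :: "(nat \<Rightarrow> nat) pmf"
  assumes "n \<ge> 1" and "r \<ge> 2"
    and "\<alpha> > 0" and "\<beta> > 0" and "q \<ge> 0"
    and "asep_stationary n q \<alpha> \<beta> 0 0 \<mu>"
  shows "(\<exists>c::real. \<forall>x::nat \<Rightarrow> real. partition_function n \<mu> x =
            c * (\<Sum>\<pi>\<in>colored_perms r n.
                   (real r / \<alpha>) ^ zc n \<pi> * (real r / ((real r - 1) * \<beta>)) ^ nc n \<pi>
                   * q ^ yy n \<pi> * (\<Prod>i\<in>excedance_set n \<pi>. x i)))
       \<and> (\<alpha> = real r \<and> \<beta> = real r / (real r - 1) \<longrightarrow>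
          (\<exists>c::real. \<forall>x::nat \<Rightarrow> real. partition_function n \<mu> x =
            c * (\<Sum>\<pi>\<in>colored_perms r n. q ^ yy n \<pi> * (\<Prod>i\<in>excedance_set n \<pi>. x i))))"
proof -
  let ?P = "\<lambda>x. \<Sum>\<pi>\<in>colored_perms r n.
     (real r / \<alpha>) ^ zc n \<pi> * (real r / ((real r - 1) * \<beta>)) ^ nc n \<pi>
     * q ^ yy n \<pi> * (\<Prod>i\<in>excedance_set n \<pi>. x i)"
  obtain c where c: "\<And>\<eta>. \<eta> \<in> configs n \<Longrightarrow>
      pmf \<mu> \<eta> = c * gen_sum (n + 1) (1 / \<alpha>) (1 / \<beta>) q {1..n} (occupied n \<eta>)"
    using asep_stationary_gen_sum[OF assms(1,3,4,5,6)] by blast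
  have "partition_function n \<mu> x = c / real r ^ n * ?P x" for x
  proof -
    have "partition_function n \<mu> x = (\<Sum>\<eta>\<in>configs n. c *
        (gen_sum (n + 1) (1 / \<alpha>) (1 / \<beta>) q {1..n} (occupied n \<eta>) * (\<Prod>i\<in>{1..n}. x i ^ \<eta> i)))"
      unfolding partition_function_def using c by (intro sum.cong) auto
    also have "\<dots> = c * (\<Sum>\<pi>\<in>marked_perms {1..n}.
        weight (n + 1) (1 / \<alpha>) (1 / \<beta>) q {1..n} \<pi> * (\<Prod>i\<in>up_set {1..n} \<pi>. x i))"
      unfolding sum_distrib_left[symmetric] sum_configs_gen_sum ..
    finally show ?thesis
      unfolding sum_colored_perms[OF assms(2,3,4)] using assms(2) by simp
  qed
  then have 1: "\<exists>c. \<forall>x. partition_function n \<mu> x = c * ?P x" by blast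
  \<comment> \<open>For these parameters both bases r / \<alpha> and r / ((r - 1) \<beta>) equal
    1.\<close>
  moreover have "?P x = (\<Sum>\<pi>\<in>colored_perms r n. q ^ yy n \<pi> * (\<Prod>i\<in>excedance_set n \<pi>. x i))"
    if "\<alpha> = real r \<and> \<beta> = real r / (real r - 1)" for x
    using that assms(2) by simp
  ultimately show ?thesis by auto
qed

end
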